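(* Let $G$ be a connected non-commutative nilpotent Lie group equipped with a left invariant metric $F$ which is either a Matsumoto metric $F(x,y)=\dfrac{g(y,y)}{\sqrt{g(y,y)}-g(X(x),y)}$ or a Kropina metric $F(x,y)=\dfrac{g(y,y)}{g(X(x),y)}$, arising from a left invariant Riemannian metric $g$ and a left invariant vector field $X$ on $G$, such that the Chern connection of $F$ coincides with the Levi-Civita connection of $g$. Then at every point $x\in G$ the flag curvature of $F$ takes positive, negative and zero values; that is, there are flags at $x$ with positive, with negative, and with zero flag curvature.
   Context: In the Matsumoto case $F$ is assumed to be a Finsler metric (smooth on $TG\setminus\{0\}$, positively homogeneous of degree one in $y$, with $\left(\frac12\frac{\partial^2F^2}{\partial y^i\partial y^j}\right)$ positive definite), which holds if and only if $\sqrt{g(X,X)}<\frac12$. In the Kropina case $F$ is considered on the open cone of tangent vectors $y$ with $g(X,y)>0$, and only flags $(P,y)$ with $g(X,y)>0$ are considered. A flag $(P,y)$ at $x$ consists of a 2-dimensional subspace $P\subset T_xG$ and a nonzero vector $y\in P$. The flag curvature is $$K^F(P,y)=\frac{g_y(R_y(u),u)}{g_y(y,y)g_y(u,u)-g_y(y,u)^2},$$ where $P=\mathrm{span}\{u,y\}$, $g_y(u,v)=\frac12\frac{\partial^2}{\partial s\,\partial t}F^2(y+su+tv)\big|_{s=t=0}$, $R_y(u)=R(u,y)y=\nabla_u\nabla_yy-\nabla_y\nabla_uy-\nabla_{[u,y]}y$ and $\nabla$ is the Chern connection of $F$. *)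

theory Defs
  imports "HOL-Analysis.Analysis" "HOL-Algebra.Generated_Groups"
begin

section \<open>Smooth manifolds\<close>

text \<open>
  On an open set, \<open>Ck_on k\<close> is \<open>k\<close>-fold continuous differentiability: all iterated directional
  derivatives up to order \<open>k\<close> exist and are continuous.
\<close>

primrec Ck_on :: "nat \<Rightarrow> 'a::real_normed_vector set \<Rightarrow> ('a \<Rightarrow> 'b::real_normed_vector) \<Rightarrow> bool" where
  "Ck_on 0 S f \<longleftrightarrow> continuous_on S f"
| "Ck_on (Suc k) S f \<longleftrightarrow>
     (\<forall>x\<in>S. f differentiable (at x)) \<and> (\<forall>v. Ck_on k S (\<lambda>x. frechet_derivative f (at x) v))"

definition smooth_on :: "'a::real_normed_vector set \<Rightarrow> ('a \<Rightarrow> 'b::real_normed_vector) \<Rightarrow> bool" where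
  "smooth_on S f \<longleftrightarrow> (\<forall>k. Ck_on k S f)"

text \<open>
  A chart is a pair of its domain and its coordinate map; the values of the map outside the
  domain are irrelevant.
\<close>

type_synonym ('a, 'n) chart = "'a set \<times> ('a \<Rightarrow> real^'n)"

definition chart_dom :: "('a, 'n::finite) chart \<Rightarrow> 'a set" where
  "chart_dom c = fst c"

definition chart_map :: "('a, 'n::finite) chart \<Rightarrow> 'a \<Rightarrow> real^'n" where
  "chart_map c = snd c"

definition chart_img :: "('a, 'n::finite) chart \<Rightarrow> (real^'n) set" where
  "chart_img c = chart_map c ` chart_dom c"

definition chart_inv :: "('a, 'n::finite) chart \<Rightarrow> real^'n \<Rightarrow> 'a" where
  "chart_inv c = inv_into (chart_dom c) (chart_map c)"

definition is_chart :: "('a::topological_space, 'n::finite) chart \<Rightarrow> bool" where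
  "is_chart c \<longleftrightarrow> open (chart_dom c) \<and> open (chart_img c) \<and> inj_on (chart_map c) (chart_dom c) \<and>
     continuous_on (chart_dom c) (chart_map c) \<and> continuous_on (chart_img c) (chart_inv c)"

text \<open>
  The underlying space of the manifold is the whole type \<open>'a\<close>. The atlas need not be maximal:
  all notions below are invariant under smooth changes of coordinates.
\<close>

locale smooth_manifold =
  fixes A :: "('a::{t2_space, second_countable_topology}, 'n::finite) chart set"
  assumes charts: "c \<in> A \<Longrightarrow> is_chart c"
    and cover: "(\<Union>c\<in>A. chart_dom c) = UNIV"
    and compatible: "\<lbrakk>c \<in> A; c' \<in> A\<rbrakk> \<Longrightarrow>
      smooth_on (chart_map c ` (chart_dom c \<inter> chart_dom c')) (\<lambda>p. chart_map c' (chart_inv c p))"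

definition charts_at :: "('a, 'n::finite) chart set \<Rightarrow> 'a \<Rightarrow> ('a, 'n) chart set" where
  "charts_at A x = {c \<in> A. x \<in> chart_dom c}"

section \<open>Tangent vectors\<close>

text \<open>
  A tangent vector at \<open>x\<close> is a directional derivative acting on functions that are differentiable
  at \<open>x\<close>; on all other functions it takes the dummy value 0, so that equality of tangent vectors
  is equality of functionals.  \<open>tvec c x v\<close> is the vector \<open>v\<^sup>i \<partial>/\<partial>x\<^sup>i\<close> at \<open>x\<close> in the chart \<open>c\<close>.
\<close>

type_synonym 'a tangent = "('a \<Rightarrow> real) \<Rightarrow> real"

definition tvec :: "('a, 'n::finite) chart \<Rightarrow> 'a \<Rightarrow> real^'n \<Rightarrow> 'a tangent" where
  "tvec c x v = (\<lambda>h. if (\<lambda>p. h (chart_inv c p)) differentiable (at (chart_map c x))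
      then frechet_derivative (\<lambda>p. h (chart_inv c p)) (at (chart_map c x)) v else 0)"

definition coords :: "('a, 'n::finite) chart \<Rightarrow> 'a tangent \<Rightarrow> real^'n" where
  "coords c y = (\<chi> i. y (\<lambda>q. chart_map c q $ i))"

definition tangent_space :: "('a, 'n::finite) chart set \<Rightarrow> 'a \<Rightarrow> 'a tangent set" where
  "tangent_space A x = (\<Union>c\<in>charts_at A x. range (tvec c x))"

definition tzero :: "'a tangent" where
  "tzero = (\<lambda>h. 0)"

definition tcomb :: "real \<Rightarrow> 'a tangent \<Rightarrow> real \<Rightarrow> 'a tangent \<Rightarrow> 'a tangent" where
  "tcomb a u b v = (\<lambda>h. a * u h + b * v h)"

definition tspan :: "'a tangent \<Rightarrow> 'a tangent \<Rightarrow> 'a tangent set" where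
  "tspan u v = {tcomb a u b v | a b. True}"

definition tindependent :: "'a tangent \<Rightarrow> 'a tangent \<Rightarrow> bool" where
  "tindependent u v \<longleftrightarrow> (\<forall>a b. tcomb a u b v = tzero \<longrightarrow> a = 0 \<and> b = 0)"

definition vector_field :: "('a, 'n::finite) chart set \<Rightarrow> ('a \<Rightarrow> 'a tangent) \<Rightarrow> bool" where
  "vector_field A X \<longleftrightarrow> (\<forall>x. X x \<in> tangent_space A x) \<and>
     (\<forall>c\<in>A. smooth_on (chart_img c) (\<lambda>p. coords c (X (chart_inv c p))))"

section \<open>Lie groups and left invariant structures\<close>

locale lie_group = group G + smooth_manifold A
  for G :: "'a::{t2_space, second_countable_topology} monoid"
    and A :: "('a, 'n::finite) chart set" +
  assumes carrier_UNIV: "carrier G = UNIV"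
    and continuous_mult: "continuous_on UNIV (\<lambda>(x, y). x \<otimes>\<^bsub>G\<^esub> y)"
    and smooth_mult: "\<lbrakk>c1 \<in> A; c2 \<in> A; c3 \<in> A\<rbrakk> \<Longrightarrow>
      smooth_on {(p, q). p \<in> chart_img c1 \<and> q \<in> chart_img c2 \<and>
                   chart_inv c1 p \<otimes>\<^bsub>G\<^esub> chart_inv c2 q \<in> chart_dom c3}
        (\<lambda>(p, q). chart_map c3 (chart_inv c1 p \<otimes>\<^bsub>G\<^esub> chart_inv c2 q))"
    and continuous_inverse: "continuous_on UNIV (\<lambda>x. inv\<^bsub>G\<^esub> x)"
    and smooth_inverse: "\<lbrakk>c1 \<in> A; c2 \<in> A\<rbrakk> \<Longrightarrow>
      smooth_on {p. p \<in> chart_img c1 \<and> inv\<^bsub>G\<^esub> (chart_inv c1 p) \<in> chart_dom c2}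
        (\<lambda>p. chart_map c2 (inv\<^bsub>G\<^esub> (chart_inv c1 p)))"

primrec lower_central :: "('a, 'b) monoid_scheme \<Rightarrow> nat \<Rightarrow> 'a set" where
  "lower_central G 0 = carrier G"
| "lower_central G (Suc k) = generate G
     (\<Union>x\<in>lower_central G k. \<Union>y\<in>carrier G. {x \<otimes>\<^bsub>G\<^esub> y \<otimes>\<^bsub>G\<^esub> inv\<^bsub>G\<^esub> x \<otimes>\<^bsub>G\<^esub> inv\<^bsub>G\<^esub> y})"

definition nilpotent_group :: "('a, 'b) monoid_scheme \<Rightarrow> bool" where
  "nilpotent_group G \<longleftrightarrow> group G \<and> (\<exists>k. lower_central G k = {\<one>\<^bsub>G\<^esub>})"

text \<open>The differential of the left translation by \<open>a\<close>.\<close>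

definition dleft :: "('a, 'b) monoid_scheme \<Rightarrow> 'a \<Rightarrow> 'a tangent \<Rightarrow> 'a tangent" where
  "dleft G a u = (\<lambda>h. u (\<lambda>q. h (a \<otimes>\<^bsub>G\<^esub> q)))"

definition left_invariant_field ::
  "('a, 'b) monoid_scheme \<Rightarrow> ('a, 'n::finite) chart set \<Rightarrow> ('a \<Rightarrow> 'a tangent) \<Rightarrow> bool" where
  "left_invariant_field G A X \<longleftrightarrow> vector_field A X \<and>
     (\<forall>a\<in>carrier G. \<forall>x\<in>carrier G. X (a \<otimes>\<^bsub>G\<^esub> x) = dleft G a (X x))"

definition local_metric :: "('a, 'n::finite) chart \<Rightarrow> ('a \<Rightarrow> 'a tangent \<Rightarrow> 'a tangent \<Rightarrow> real)
    \<Rightarrow> real^'n \<Rightarrow> real^'n \<Rightarrow> real^'n \<Rightarrow> real" where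
  "local_metric c g p v w =
     g (chart_inv c p) (tvec c (chart_inv c p) v) (tvec c (chart_inv c p) w)"

definition riemannian_metric ::
  "('a, 'n::finite) chart set \<Rightarrow> ('a \<Rightarrow> 'a tangent \<Rightarrow> 'a tangent \<Rightarrow> real) \<Rightarrow> bool" where
  "riemannian_metric A g \<longleftrightarrow> (\<forall>c\<in>A.
     (\<forall>p\<in>chart_img c. bilinear (local_metric c g p) \<and>
        (\<forall>v w. local_metric c g p v w = local_metric c g p w v) \<and>
        (\<forall>v. v \<noteq> 0 \<longrightarrow> local_metric c g p v v > 0)) \<and>
     (\<forall>v w. smooth_on (chart_img c) (\<lambda>p. local_metric c g p v w)))"

definition left_invariant_riemannian_metric ::
  "('a, 'b) monoid_scheme \<Rightarrow> ('a, 'n::finite) chart set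
    \<Rightarrow> ('a \<Rightarrow> 'a tangent \<Rightarrow> 'a tangent \<Rightarrow> real) \<Rightarrow> bool" where
  "left_invariant_riemannian_metric G A g \<longleftrightarrow> riemannian_metric A g \<and>
     (\<forall>a\<in>carrier G. \<forall>x\<in>carrier G. \<forall>u\<in>tangent_space A x. \<forall>v\<in>tangent_space A x.
        g (a \<otimes>\<^bsub>G\<^esub> x) (dleft G a u) (dleft G a v) = g x u v)"

section \<open>Finsler geometry in local coordinates\<close>

text \<open>
  In this section \<open>f p y\<close> is the coordinate expression of a Finsler function: \<open>p\<close> is the position
  and \<open>y\<close> the fibre coordinate.  All quantities are given by derivatives at \<open>(p, y)\<close>, so they make
  sense also for an \<open>f\<close> that is smooth only on an open cone bundle.
\<close>

definition local_finsler :: "('a, 'n::finite) chart \<Rightarrow> ('a \<Rightarrow> 'a tangent \<Rightarrow> real)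
    \<Rightarrow> real^'n \<Rightarrow> real^'n \<Rightarrow> real" where
  "local_finsler c F p y = F (chart_inv c p) (tvec c (chart_inv c p) y)"

definition partial :: "'n::finite \<Rightarrow> (real^'n \<Rightarrow> real) \<Rightarrow> real^'n \<Rightarrow> real" where
  "partial i h p = deriv (\<lambda>t. h (p + t *\<^sub>R axis i 1)) 0"

definition fundamental_tensor ::
  "(real^'n::finite \<Rightarrow> real^'n \<Rightarrow> real) \<Rightarrow> real^'n \<Rightarrow> real^'n \<Rightarrow> real^'n \<Rightarrow> real^'n \<Rightarrow> real" where
  "fundamental_tensor f p y u v =
     1/2 * deriv (\<lambda>s. deriv (\<lambda>t. (f p (y + s *\<^sub>R u + t *\<^sub>R v))\<^sup>2) 0) 0"

text \<open>\<open>g\<^sub>i\<^sub>j = 1/2 \<partial>\<^sup>2F\<^sup>2/\<partial>y\<^sup>i\<partial>y\<^sup>j\<close>\<close>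

definition fundamental_matrix ::
  "(real^'n::finite \<Rightarrow> real^'n \<Rightarrow> real) \<Rightarrow> real^'n \<Rightarrow> real^'n \<Rightarrow> real^'n^'n" where
  "fundamental_matrix f p y = (\<chi> i j. fundamental_tensor f p y (axis i 1) (axis j 1))"

text \<open>
  The geodesic coefficients
  \<open>G\<^sup>i = 1/4 g\<^sup>i\<^sup>l ((\<partial>\<^sup>2F\<^sup>2/\<partial>x\<^sup>k\<partial>y\<^sup>l) y\<^sup>k - \<partial>F\<^sup>2/\<partial>x\<^sup>l)\<close>
  and the associated nonlinear connection \<open>N\<^sup>i\<^sub>j = \<partial>G\<^sup>i/\<partial>y\<^sup>j\<close>.
\<close>

definition spray_coeff ::
  "(real^'n::finite \<Rightarrow> real^'n \<Rightarrow> real) \<Rightarrow> real^'n \<Rightarrow> real^'n \<Rightarrow> 'n \<Rightarrow> real" where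
  "spray_coeff f p y i = 1/4 * (\<Sum>l\<in>UNIV. matrix_inv (fundamental_matrix f p y) $ i $ l *
     ((\<Sum>k\<in>UNIV. partial k (\<lambda>q. partial l (\<lambda>w. (f q w)\<^sup>2) y) p * y $ k)
      - partial l (\<lambda>q. (f q y)\<^sup>2) p))"

definition nonlinear_connection ::
  "(real^'n::finite \<Rightarrow> real^'n \<Rightarrow> real) \<Rightarrow> real^'n \<Rightarrow> real^'n \<Rightarrow> 'n \<Rightarrow> 'n \<Rightarrow> real" where
  "nonlinear_connection f p y i j = partial j (\<lambda>w. spray_coeff f p w i) y"

text \<open>\<open>\<delta>/\<delta>x\<^sup>k = \<partial>/\<partial>x\<^sup>k - N\<^sup>m\<^sub>k \<partial>/\<partial>y\<^sup>m\<close>\<close>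

definition horizontal_partial ::
  "(real^'n::finite \<Rightarrow> real^'n \<Rightarrow> real) \<Rightarrow> 'n \<Rightarrow> (real^'n \<Rightarrow> real^'n \<Rightarrow> real)
    \<Rightarrow> real^'n \<Rightarrow> real^'n \<Rightarrow> real" where
  "horizontal_partial f k h p y = partial k (\<lambda>q. h q y) p
     - (\<Sum>m\<in>UNIV. nonlinear_connection f p y m k * partial m (\<lambda>w. h p w) y)"

text \<open>
  The coefficients \<open>\<Gamma>\<^sup>i\<^sub>j\<^sub>k(x, y)\<close> of the Chern connection,
  \<open>1/2 g\<^sup>i\<^sup>l (\<delta>g\<^sub>l\<^sub>j/\<delta>x\<^sup>k + \<delta>g\<^sub>l\<^sub>k/\<delta>x\<^sup>j - \<delta>g\<^sub>j\<^sub>k/\<delta>x\<^sup>l)\<close>.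
\<close>

definition chern_coeff ::
  "(real^'n::finite \<Rightarrow> real^'n \<Rightarrow> real) \<Rightarrow> real^'n \<Rightarrow> real^'n \<Rightarrow> 'n \<Rightarrow> 'n \<Rightarrow> 'n \<Rightarrow> real" where
  "chern_coeff f p y i j k = 1/2 * (\<Sum>l\<in>UNIV. matrix_inv (fundamental_matrix f p y) $ i $ l *
     (horizontal_partial f k (\<lambda>q w. fundamental_matrix f q w $ l $ j) p y
      + horizontal_partial f j (\<lambda>q w. fundamental_matrix f q w $ l $ k) p y
      - horizontal_partial f l (\<lambda>q w. fundamental_matrix f q w $ j $ k) p y))"

text \<open>
  The Chern connection is a linear connection in the pullback of the tangent bundle, and
  \<open>R(u, y)y\<close> is its curvature on the horizontal lifts of \<open>u\<close> and \<open>y\<close>.  The Chern connection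
  forms have no \<open>dy\<close>-components, so the vertical part of the bracket of the lifts contributes
  nothing and
  \<open>R(\<partial>\<^sub>k, \<partial>\<^sub>l)\<partial>\<^sub>j = (\<delta>\<Gamma>\<^sup>i\<^sub>j\<^sub>l/\<delta>x\<^sup>k - \<delta>\<Gamma>\<^sup>i\<^sub>j\<^sub>k/\<delta>x\<^sup>l + \<Gamma>\<^sup>i\<^sub>h\<^sub>k \<Gamma>\<^sup>h\<^sub>j\<^sub>l - \<Gamma>\<^sup>i\<^sub>h\<^sub>l \<Gamma>\<^sup>h\<^sub>j\<^sub>k) \<partial>\<^sub>i\<close>.
\<close>

definition chern_curvature :: "(real^'n::finite \<Rightarrow> real^'n \<Rightarrow> real) \<Rightarrow> real^'n \<Rightarrow> real^'n
    \<Rightarrow> 'n \<Rightarrow> 'n \<Rightarrow> 'n \<Rightarrow> 'n \<Rightarrow> real" where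
  "chern_curvature f p y i j k l =
     horizontal_partial f k (\<lambda>q w. chern_coeff f q w i j l) p y
     - horizontal_partial f l (\<lambda>q w. chern_coeff f q w i j k) p y
     + (\<Sum>h\<in>UNIV. chern_coeff f p y i h k * chern_coeff f p y h j l
          - chern_coeff f p y i h l * chern_coeff f p y h j k)"

definition riemann_curvature ::
  "(real^'n::finite \<Rightarrow> real^'n \<Rightarrow> real) \<Rightarrow> real^'n \<Rightarrow> real^'n \<Rightarrow> real^'n \<Rightarrow> real^'n" where
  "riemann_curvature f p y u = (\<chi> i. \<Sum>j\<in>UNIV. \<Sum>k\<in>UNIV. \<Sum>l\<in>UNIV.
     chern_curvature f p y i j k l * y $ j * u $ k * y $ l)"

definition metric_matrix :: "('a, 'n::finite) chart \<Rightarrow> ('a \<Rightarrow> 'a tangent \<Rightarrow> 'a tangent \<Rightarrow> real)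
    \<Rightarrow> real^'n \<Rightarrow> real^'n^'n" where
  "metric_matrix c g p = (\<chi> i j. local_metric c g p (axis i 1) (axis j 1))"

definition levi_civita_coeff :: "('a, 'n::finite) chart \<Rightarrow> ('a \<Rightarrow> 'a tangent \<Rightarrow> 'a tangent \<Rightarrow> real)
    \<Rightarrow> real^'n \<Rightarrow> 'n \<Rightarrow> 'n \<Rightarrow> 'n \<Rightarrow> real" where
  "levi_civita_coeff c g p i j k = 1/2 * (\<Sum>l\<in>UNIV. matrix_inv (metric_matrix c g p) $ i $ l *
     (partial k (\<lambda>q. metric_matrix c g q $ l $ j) p
      + partial j (\<lambda>q. metric_matrix c g q $ l $ k) p
      - partial l (\<lambda>q. metric_matrix c g q $ j $ k) p))"

section \<open>Finsler metrics and flag curvature\<close>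

definition finsler_metric ::
  "('a, 'n::finite) chart set \<Rightarrow> ('a \<Rightarrow> 'a tangent \<Rightarrow> real) \<Rightarrow> bool" where
  "finsler_metric A F \<longleftrightarrow> (\<forall>c\<in>A.
     smooth_on (chart_img c \<times> (UNIV - {0})) (\<lambda>(p, y). local_finsler c F p y) \<and>
     (\<forall>p\<in>chart_img c. \<forall>y. y \<noteq> 0 \<longrightarrow>
        (\<forall>r>0. local_finsler c F p (r *\<^sub>R y) = r * local_finsler c F p y) \<and>
        (\<forall>\<xi>. \<xi> \<noteq> 0 \<longrightarrow> \<xi> \<bullet> (fundamental_matrix (local_finsler c F) p y *v \<xi>) > 0)))"

definition matsumoto :: "('a \<Rightarrow> 'a tangent \<Rightarrow> 'a tangent \<Rightarrow> real) \<Rightarrow> ('a \<Rightarrow> 'a tangent)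
    \<Rightarrow> 'a \<Rightarrow> 'a tangent \<Rightarrow> real" where
  "matsumoto g X x y = g x y y / (sqrt (g x y y) - g x (X x) y)"

definition kropina :: "('a \<Rightarrow> 'a tangent \<Rightarrow> 'a tangent \<Rightarrow> real) \<Rightarrow> ('a \<Rightarrow> 'a tangent)
    \<Rightarrow> 'a \<Rightarrow> 'a tangent \<Rightarrow> real" where
  "kropina g X x y = g x y y / g x (X x) y"

text \<open>
  In both cases \<open>D x\<close> is the set of tangent vectors at \<open>x\<close> on which the metric is considered.
  A Kropina metric needs \<open>D x\<close> to be nonempty, that is, \<open>X\<close> must not vanish.
\<close>

definition is_matsumoto_metric :: "('a, 'n::finite) chart set
    \<Rightarrow> ('a \<Rightarrow> 'a tangent \<Rightarrow> 'a tangent \<Rightarrow> real) \<Rightarrow> ('a \<Rightarrow> 'a tangent)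
    \<Rightarrow> ('a \<Rightarrow> 'a tangent \<Rightarrow> real) \<Rightarrow> ('a \<Rightarrow> 'a tangent set) \<Rightarrow> bool" where
  "is_matsumoto_metric A g X F D \<longleftrightarrow> F = matsumoto g X \<and> finsler_metric A F \<and>
     D = (\<lambda>x. tangent_space A x - {tzero})"

definition is_kropina_metric :: "('a, 'n::finite) chart set
    \<Rightarrow> ('a \<Rightarrow> 'a tangent \<Rightarrow> 'a tangent \<Rightarrow> real) \<Rightarrow> ('a \<Rightarrow> 'a tangent)
    \<Rightarrow> ('a \<Rightarrow> 'a tangent \<Rightarrow> real) \<Rightarrow> ('a \<Rightarrow> 'a tangent set) \<Rightarrow> bool" where
  "is_kropina_metric A g X F D \<longleftrightarrow> F = kropina g X \<and> (\<forall>x. X x \<noteq> tzero) \<and>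
     D = (\<lambda>x. {y \<in> tangent_space A x. g x (X x) y > 0})"

definition chern_eq_levi_civita :: "('a, 'n::finite) chart set
    \<Rightarrow> ('a \<Rightarrow> 'a tangent \<Rightarrow> 'a tangent \<Rightarrow> real)
    \<Rightarrow> ('a \<Rightarrow> 'a tangent \<Rightarrow> real) \<Rightarrow> ('a \<Rightarrow> 'a tangent set) \<Rightarrow> bool" where
  "chern_eq_levi_civita A g F D \<longleftrightarrow> (\<forall>c\<in>A. \<forall>x\<in>chart_dom c. \<forall>y\<in>D x. \<forall>i j k.
     chern_coeff (local_finsler c F) (chart_map c x) (coords c y) i j k
       = levi_civita_coeff c g (chart_map c x) i j k)"

definition is_flag ::
  "('a, 'n::finite) chart set \<Rightarrow> 'a \<Rightarrow> 'a tangent set \<Rightarrow> 'a tangent \<Rightarrow> bool" where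
  "is_flag A x P y \<longleftrightarrow>
     (\<exists>u\<in>tangent_space A x. \<exists>v\<in>tangent_space A x. tindependent u v \<and> P = tspan u v) \<and>
     y \<in> P \<and> y \<noteq> tzero"

text \<open>
  The flag curvature of \<open>(P, y)\<close> at \<open>x\<close>, computed in the chart \<open>c\<close> around \<open>x\<close>.  Its value depends
  neither on \<open>c\<close> nor on the choice of \<open>u\<close>.
\<close>

definition flag_curvature :: "('a, 'n::finite) chart \<Rightarrow> ('a \<Rightarrow> 'a tangent \<Rightarrow> real)
    \<Rightarrow> 'a \<Rightarrow> 'a tangent set \<Rightarrow> 'a tangent \<Rightarrow> real" where
  "flag_curvature c F x P y =
     (let f = local_finsler c F; p = chart_map c x;
          \<eta> = coords c y; \<mu> = coords c (SOME u. P = tspan u y);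
          gy = fundamental_tensor f p \<eta>
      in gy (riemann_curvature f p \<eta> \<mu>) \<mu> / (gy \<eta> \<eta> * gy \<mu> \<mu> - (gy \<eta> \<mu>)\<^sup>2))"

end

theory Submission
  imports Defs
begin

text \<open>
  Write \<open>F\<^sup>2 = L(\<alpha>\<^sup>2, \<beta>)\<close> with \<open>\<alpha>\<^sup>2 = g(y, y)\<close> and \<open>\<beta> = g(X, y)\<close>.  If the Chern
  connection is the Levi-Civita connection, then \<open>F\<^sup>2\<close> is constant along Levi-Civita horizontal
  directions; so is \<open>\<alpha>\<^sup>2\<close>, hence so is \<open>\<beta>\<close>, and \<open>X\<close> is parallel.  Then \<open>R(u, y)y\<close> is orthogonal to
  \<open>y\<close> and \<open>X\<close>, so \<open>g\<^sub>y(R(u, y)y, u)\<close> is \<open>L\<^sub>1 g(R(u, y)y, u)\<close> with \<open>L\<^sub>1 > 0\<close>, and the flag curvature has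
  the sign of a sectional curvature of \<open>g\<close>.  The signs of the latter are found in the Lie algebra: a
  central vector in the derived algebra gives positive curvature; a vector \<open>b\<close> orthogonal to the
  derived algebra and a vector \<open>v\<close> orthogonal to the image of \<open>ad b\<close> with \<open>[b, v] \<noteq> 0\<close> give
  \<open>- 3/4 |[b, v]|\<^sup>2\<close>; zero follows by the intermediate value theorem.  A parallel \<open>X\<close> is central,
  so adding multiples of it to \<open>y\<close> moves a flag into the cone \<open>\<beta> > 0\<close> without changing curvature.
\<close>

section \<open>Sectional curvature of nilpotent metric Lie algebras\<close>

text \<open>Nilpotency and noncommutativity are given for the abstract group, while the curvature
  argument needs them for the bracket of left invariant fields. The bridge is differentiation at the
  identity: the commutator with \<open>b\<close> has differential \<open>v - Ad b v\<close>, and the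
  differential of \<open>Ad\<close> is the bracket. Commutator identities of the group thus become
  statements about iterated brackets; conversely a vanishing bracket makes \<open>Ad\<close>, and
  then every commutator map, locally constant, hence constant by connectedness. Left invariant
  fields have constant inner products and constant structure coefficients, so the Koszul formula
  yields connection coefficients \<open>nab\<close> that are the same at every point and in every
  chart. Riemannian curvature becomes algebra in one tangent space. The sign of
  \<open>L\<^sub>1\<close> is not computed from \<open>L\<close>; it is read off from positive
  definiteness of \<open>g\<^sub>y\<close> at the curvature vector itself. For the zero value,
  planes of opposite sign must first be linked through planes that share a vector.\<close>

primrec upper_central :: "('v \<Rightarrow> 'v \<Rightarrow> 'v::real_vector) \<Rightarrow> nat \<Rightarrow> 'v set" where
  "upper_central br 0 = {0}"
| "upper_central br (Suc j) = {v. \<forall>u. br u v \<in> upper_central br j}"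

text \<open>The coordinate space already carries the Euclidean inner product; \<open>ip\<close> is a
  second, arbitrary one, and orthogonality below refers to it.\<close>

locale inner_space =
  fixes ip :: "'v::euclidean_space \<Rightarrow> 'v \<Rightarrow> real"
  assumes ip_bilinear: "bilinear ip"
    and ip_sym: "ip u v = ip v u"
    and ip_pos: "v \<noteq> 0 \<Longrightarrow> ip v v > 0"
begin

lemmas ip_simps [simp] =
  bilinear_ladd[OF ip_bilinear] bilinear_radd[OF ip_bilinear]
  bilinear_lsub[OF ip_bilinear] bilinear_rsub[OF ip_bilinear]
  bilinear_lmul[OF ip_bilinear] bilinear_rmul[OF ip_bilinear]
  bilinear_lneg[OF ip_bilinear] bilinear_rneg[OF ip_bilinear]
  bilinear_lzero[OF ip_bilinear] bilinear_rzero[OF ip_bilinear]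

lemma ip_self_eq_0 [simp]: "ip v v = 0 \<longleftrightarrow> v = 0"
  using ip_pos[of v] by (cases "v = 0") simp_all

lemma ip_eqI: "(\<And>w. ip u w = ip v w) \<Longrightarrow> u = v"
  using ip_self_eq_0[of "u - v"] by simp

lemma ip_span_eq_0: "x \<in> span S \<Longrightarrow> (\<And>s. s \<in> S \<Longrightarrow> ip y s = 0) \<Longrightarrow> ip y x = 0"
  by (induction rule: span_induct_alt) auto

text \<open>One Gram-Schmidt step per element: the induction hypothesis, used for \<open>x\<close>
  and for the new vector \<open>a\<close>, leaves only the component along the part
  \<open>a'\<close> of \<open>a\<close> orthogonal to \<open>S\<close>.\<close>

lemma orthogonal_projection_exists:
  assumes "finite S"
  shows "\<exists>w\<in>span S. \<forall>s\<in>S. ip (x - w) s = 0"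
  using assms
proof (induction S arbitrary: x rule: finite_induct)
  case empty
  then show ?case by simp
next
  case (insert a S)
  obtain wa where wa: "wa \<in> span S" "\<forall>s\<in>S. ip (a - wa) s = 0" using insert.IH by blast
  obtain wx where wx: "wx \<in> span S" "\<forall>s\<in>S. ip (x - wx) s = 0" using insert.IH by blast
  define a' where "a' = a - wa"
  define t where "t = ip (x - wx) a' / ip a' a'"
  \<comment> \<open>If \<open>a'\<close> vanishes, division by zero makes \<open>t\<close> zero and
    both sides are 0.\<close>
  have t: "ip (x - wx) a' = t * ip a' a'" by (cases "a' = 0") (auto simp: t_def)
  have sub: "span S \<subseteq> span (insert a S)" by (simp add: span_mono subset_insertI)
  have "a' \<in> span (insert a S)"
    unfolding a'_def using wa(1) sub by (meson insertI1 span_base span_diff subsetD)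
  then have mem: "wx + t *\<^sub>R a' \<in> span (insert a S)"
    using wx(1) sub by (meson span_add span_scale subsetD)
  have orth: "\<forall>s\<in>S. ip (x - (wx + t *\<^sub>R a')) s = 0"
    using wx(2) wa(2) unfolding a'_def by (simp add: algebra_simps)
  have "ip (x - (wx + t *\<^sub>R a')) wa = 0"
    using ip_span_eq_0[OF wa(1)] orth by blast
  moreover have "ip (x - (wx + t *\<^sub>R a')) a' = 0"
    using t by (simp add: algebra_simps)
  ultimately have "ip (x - (wx + t *\<^sub>R a')) a = 0" unfolding a'_def by (simp add: algebra_simps)
  then show ?case using mem orth by blast
qed

lemma orthogonal_decomposition:
  assumes "subspace W"
  obtains w z where "x = w + z" "w \<in> W" "\<And>s. s \<in> W \<Longrightarrow> ip z s = 0"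
proof -
  obtain B where B: "B \<subseteq> W" "independent B" "W \<subseteq> span B" by (rule basis_exists[of W]) blast
  have W: "W = span B" using B assms by (meson span_minimal subset_antisym)
  obtain w where w: "w \<in> span B" "\<forall>s\<in>B. ip (x - w) s = 0"
    using orthogonal_projection_exists[of B x] B(2) independent_imp_finite by blast
  have "ip (x - w) s = 0" if "s \<in> W" for s
    using ip_span_eq_0[of s B "x - w"] w(2) that W by blast
  then show thesis using that[of w "x - w"] w(1) W by auto
qed

lemma cauchy_schwarz: "(ip v u)\<^sup>2 \<le> ip v v * ip u u"
proof (cases "v = 0")
  case False
  have "0 \<le> ip (ip v v *\<^sub>R u - ip v u *\<^sub>R v) (ip v v *\<^sub>R u - ip v u *\<^sub>R v)"
    using ip_pos[of "ip v v *\<^sub>R u - ip v u *\<^sub>R v"] by (metis ip_self_eq_0 less_eq_real_def)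
  also have "\<dots> = ip v v * (ip v v * ip u u - (ip v u)\<^sup>2)"
    using ip_sym[of u v] by (simp add: algebra_simps power2_eq_square)
  finally show ?thesis using ip_pos[OF False] by (simp add: zero_le_mult_iff)
qed simp

lemma gram_pos:
  assumes "\<And>a b. a *\<^sub>R u + b *\<^sub>R v = 0 \<Longrightarrow> a = 0 \<and> b = 0"
  shows "ip v v * ip u u - (ip v u)\<^sup>2 > 0"
proof -
  have v: "v \<noteq> 0" using assms[of 0 1] by auto
  have "ip v v *\<^sub>R u + (- ip v u) *\<^sub>R v \<noteq> 0"
    using assms[of "ip v v" "- ip v u"] ip_self_eq_0[of v] v by blast
  then have "0 < ip (ip v v *\<^sub>R u - ip v u *\<^sub>R v) (ip v v *\<^sub>R u - ip v u *\<^sub>R v)"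
    by (intro ip_pos) simp
  also have "\<dots> = ip v v * (ip v v * ip u u - (ip v u)\<^sup>2)"
    using ip_sym[of u v] by (simp add: algebra_simps power2_eq_square)
  finally show ?thesis using ip_pos[OF v] by (simp add: zero_less_mult_iff)
qed

end

text \<open>These are the properties of Levi-Civita coefficients in a frame with constant inner
  products: torsion-free and skew. Bilinearity and antisymmetry of \<open>br\<close> come out of
  \<open>nab_torsion\<close>.\<close>

locale metric_lie_algebra = inner_space ip
  for ip :: "'v::euclidean_space \<Rightarrow> 'v \<Rightarrow> real" +
  fixes br nab :: "'v \<Rightarrow> 'v \<Rightarrow> 'v"
  assumes nab_bilinear: "bilinear nab"
    and nab_torsion: "nab u v - nab v u = br u v"
    and nab_metric: "ip (nab u v) w + ip v (nab u w) = 0"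
begin

lemmas nab_simps [simp] =
  bilinear_ladd[OF nab_bilinear] bilinear_radd[OF nab_bilinear]
  bilinear_lsub[OF nab_bilinear] bilinear_rsub[OF nab_bilinear]
  bilinear_lmul[OF nab_bilinear] bilinear_rmul[OF nab_bilinear]
  bilinear_lneg[OF nab_bilinear] bilinear_rneg[OF nab_bilinear]
  bilinear_lzero[OF nab_bilinear] bilinear_rzero[OF nab_bilinear]

lemma br_simps [simp]:
  "br (a + b) c = br a c + br b c" "br a (b + c) = br a b + br a c"
  "br (a - b) c = br a c - br b c" "br a (b - c) = br a b - br a c"
  "br (r *\<^sub>R a) c = r *\<^sub>R br a c" "br a (r *\<^sub>R c) = r *\<^sub>R br a c"
  "br (- a) c = - br a c" "br a (- c) = - br a c" "br 0 c = 0" "br a 0 = 0" "br a a = 0"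
  unfolding nab_torsion[symmetric] by (simp_all add: algebra_simps)

lemma br_anti: "br u v = - br v u"
  unfolding nab_torsion[symmetric] by simp

text \<open>The derivative terms of the usual formula are absent because inner products of frame
  fields are constant. Hence \<open>ip\<close> and \<open>br\<close> alone determine
  \<open>nab\<close>.\<close>

lemma koszul: "2 * ip (nab u v) w = ip (br u v) w - ip (br v w) u + ip (br w u) v"
  using nab_metric[of u v w] nab_metric[of v w u] nab_metric[of w u v]
    ip_sym[of v "nab u w"] ip_sym[of w "nab v u"] ip_sym[of u "nab w v"]
  unfolding nab_torsion[symmetric] by (simp add: algebra_simps)

definition curv :: "'v \<Rightarrow> 'v \<Rightarrow> 'v \<Rightarrow> 'v" where
  "curv u v w = nab u (nab v w) - nab v (nab u w) - nab (br u v) w"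

text \<open>Sectional curvature without the Gram determinant in the denominator; only its sign is of
  interest, and this form is a polynomial in \<open>u\<close> and \<open>v\<close>.\<close>

definition sect :: "'v \<Rightarrow> 'v \<Rightarrow> real" where
  "sect u v = ip (curv u v v) u"

lemma curv_simps [simp]:
  "curv (a + b) c d = curv a c d + curv b c d" "curv a (b + c) d = curv a b d + curv a c d"
  "curv a b (c + d) = curv a b c + curv a b d"
  "curv (r *\<^sub>R a) b c = r *\<^sub>R curv a b c" "curv a (r *\<^sub>R b) c = r *\<^sub>R curv a b c"
  "curv a b (r *\<^sub>R c) = r *\<^sub>R curv a b c" "curv a a b = 0"
  unfolding curv_def by (simp_all add: algebra_simps)

lemma curv_anti: "curv u v w = - curv v u w"
  unfolding curv_def using br_anti[of u v] by simp

text \<open>Every \<open>nab u\<close> is skew for \<open>ip\<close>, and a commutator of skew maps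
  is skew.\<close>

lemma curv_metric: "ip (curv u v w) z = - ip w (curv u v z)"
proof -
  have "ip (curv u v w) z + ip w (curv u v z) = 0"
    unfolding curv_def
    using nab_metric[of u "nab v w" z] nab_metric[of v "nab u w" z] nab_metric[of "br u v" w z]
      nab_metric[of v w "nab u z"] nab_metric[of u w "nab v z"] by simp
  then show ?thesis by simp
qed

lemma ip_curv_self [simp]: "ip (curv u v w) w = 0"
  using curv_metric[of u v w w] ip_sym[of w "curv u v w"] by simp

lemma sect_sym: "sect u v = sect v u"
  unfolding sect_def using curv_metric[of u v v u] curv_anti[of u v u] ip_sym[of v "curv v u u"] by simp

lemma sect_shift: "sect u (v + r *\<^sub>R u) = sect u v"
proof -
  have "ip (curv u v u) u = 0" by simp
  then show ?thesis unfolding sect_def by (simp add: algebra_simps)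
qed

lemma sect_scale: "sect u (r *\<^sub>R v) = r\<^sup>2 * sect u v"
  unfolding sect_def by (simp add: power2_eq_square)

lemma sect_line:
  "sect u (v + t *\<^sub>R w) = sect u v + t * (ip (curv u v w) u + ip (curv u w v) u) + t\<^sup>2 * sect u w"
  unfolding sect_def by (simp add: power2_eq_square algebra_simps)

definition indep2 :: "'v \<Rightarrow> 'v \<Rightarrow> bool" where
  "indep2 u v \<longleftrightarrow> (\<forall>a b. a *\<^sub>R u + b *\<^sub>R v = 0 \<longrightarrow> a = 0 \<and> b = 0)"

lemma indep2_sym: "indep2 u v \<longleftrightarrow> indep2 v u"
  unfolding indep2_def by (metis add.commute)

lemma indep2_iff: "indep2 u v \<longleftrightarrow> u \<noteq> 0 \<and> (\<forall>r. v \<noteq> r *\<^sub>R u)"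
proof
  assume L: "indep2 u v"
  have "u \<noteq> 0" using L[unfolded indep2_def, rule_format, of 1 0] by auto
  moreover have "v \<noteq> r *\<^sub>R u" for r
    using L[unfolded indep2_def, rule_format, of "-r" 1] by auto
  ultimately show "u \<noteq> 0 \<and> (\<forall>r. v \<noteq> r *\<^sub>R u)" by blast
next
  assume R: "u \<noteq> 0 \<and> (\<forall>r. v \<noteq> r *\<^sub>R u)"
  show "indep2 u v"
    unfolding indep2_def
  proof (intro allI impI)
    fix a b assume ab: "a *\<^sub>R u + b *\<^sub>R v = 0"
    have "b = 0"
    proof (rule ccontr)
      assume b: "b \<noteq> 0"
      have "b *\<^sub>R v = - a *\<^sub>R u" using ab by (simp add: add_eq_0_iff)
      then have "(1 / b) *\<^sub>R (b *\<^sub>R v) = (1 / b) *\<^sub>R (- a *\<^sub>R u)" by simp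
      then have "v = (1 / b * - a) *\<^sub>R u" using b by simp
      then show False using R by blast
    qed
    then show "a = 0 \<and> b = 0" using ab R by auto
  qed
qed

lemma indep2_sect_nz: "sect u v \<noteq> 0 \<Longrightarrow> indep2 u v"
  unfolding indep2_iff by (auto simp: sect_def)

lemma subspace_upper_central: "subspace (upper_central br j)"
  by (induction j) (auto simp: subspace_def)

lemma nilpotent_funpow:
  assumes "v \<in> upper_central br k"
  shows "((\<lambda>w. br b w) ^^ k) v = 0"
  using assms
proof (induction k arbitrary: v)
  case (Suc k)
  then show ?case by (simp add: funpow_swap1)
qed auto

text \<open>For central \<open>u\<close> torsion-freeness gives \<open>nab u v = nab v u\<close>,
  and Koszul gives \<open>nab u u = 0\<close>. Moving \<open>nab\<close> across \<open>ip\<close>,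
  the first curvature term dies, the bracket term is zero, and the middle one becomes a
  square.\<close>

lemma sect_central:
  assumes "\<And>w. br w u = 0"
  shows "sect u v = ip (nab v u) (nab v u)"
proof -
  have c: "br u w = 0" for w using assms[of w] br_anti[of u w] by simp
  have uv: "nab u w = nab w u" for w using nab_torsion[of u w] c by simp
  have "nab u u = 0" by (rule ip_eqI) (use koszul[of u u] c assms in simp)
  then have "ip (nab u (nab v v)) u = 0"
    using nab_metric[of u "nab v v" u] by simp
  moreover have "ip (nab v (nab u v)) u = - ip (nab v u) (nab v u)"
    using nab_metric[of v "nab u v" u] uv[of v] by simp
  ultimately show ?thesis unfolding sect_def curv_def by (simp add: c)
qed

text \<open>With \<open>z = br b v\<close>, the two orthogonality conditions reduce Koszul to
  \<open>nab b b = 0\<close>, \<open>nab v b = - z/2\<close>, \<open>nab b v = z/2\<close>. The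
  factor 3/4 is 1/4 from the product of the last two plus 1/2 from the bracket term
  \<open>nab z b\<close>.\<close>

lemma sect_neg_formula:
  assumes b: "\<And>u w. ip b (br u w) = 0" and v: "\<And>w. ip v (br b w) = 0"
  shows "sect v b = - (3/4) * ip (br b v) (br b v)"
proof -
  define z where "z = br b v"
  have vb: "br v b = - z" using br_anti[of v b] by (simp add: z_def)
  have b': "ip (br u w) b = 0" for u w using b ip_sym by metis
  have v': "ip (br b w) v = 0" for w using v ip_sym by metis
  have nb: "2 * ip (nab w b) y = - ip (br b w) y - ip (br b y) w" for w y
    using koszul[of w b y] b' br_anti[of w b] by simp
  have bb: "nab b b = 0"
  proof (rule ip_eqI)
    fix w show "ip (nab b b) w = ip 0 w" using nb[of b w] b' by simp
  qed
  have nvb: "nab v b = - (1/2) *\<^sub>R z"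
  proof (rule ip_eqI)
    fix w show "ip (nab v b) w = ip (- (1/2) *\<^sub>R z) w" using nb[of v w] v' by (simp add: z_def)
  qed
  have nbv: "nab b v = (1/2) *\<^sub>R z"
  proof (rule ip_eqI)
    fix w
    have "nab b v = z + nab v b" using nab_torsion[of b v] by (simp add: z_def algebra_simps)
    then show "ip (nab b v) w = ip ((1/2) *\<^sub>R z) w" by (simp add: nvb)
  qed
  have zz: "ip (nab z b) v = - (1/2) * ip z z"
    using nb[of z v] v' by (simp add: z_def)
  have "sect v b = - ip (nab b (nab v b)) v - ip (nab (br v b) b) v"
    unfolding sect_def curv_def by (simp add: bb)
  also have "\<dots> = ip (nab v b) (nab b v) + ip (nab z b) v"
    using nab_metric[of b "nab v b" v] vb by simp
  finally show ?thesis unfolding zz nvb nbv by (simp add: z_def)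
qed

end

section \<open>Existence of planes of each sign in the nilpotent case\<close>

locale nilpotent_metric_lie_algebra = metric_lie_algebra +
  assumes nilpotent: "\<exists>k. upper_central br k = UNIV"
    and nonabelian: "\<exists>u v. br u v \<noteq> 0"
begin

definition derived :: "'a set" where
  "derived = span {br u v | u v. True}"

lemma br_in_derived: "br u v \<in> derived"
  unfolding derived_def by (rule span_base) blast

lemma derived_subset: "subspace W \<Longrightarrow> (\<And>u v. br u v \<in> W) \<Longrightarrow> derived \<subseteq> W"
  unfolding derived_def by (rule span_minimal) auto

text \<open>A nonzero \<open>u\<close> in the derived algebra at the least level of the upper
  central series is central: its brackets lie in the derived algebra one level lower, hence vanish.
  As \<open>u\<close> is not orthogonal to all brackets, Koszul gives some
  \<open>nab v u \<noteq> 0\<close>, and \<open>sect_central\<close> applies.\<close>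

lemma sect_pos_exists: "\<exists>u v. sect u v > 0"
proof -
  obtain k where "upper_central br k = UNIV" using nilpotent by blast
  then have "\<exists>x. x \<in> upper_central br k \<inter> derived \<and> x \<noteq> 0"
    using nonabelian br_in_derived by blast
  then have ex: "\<exists>k. \<exists>x. x \<in> upper_central br k \<inter> derived \<and> x \<noteq> 0" by blast
  define j where "j = (LEAST k. \<exists>x. x \<in> upper_central br k \<inter> derived \<and> x \<noteq> 0)"
  obtain u where u: "u \<in> upper_central br j" "u \<in> derived" "u \<noteq> 0"
    using LeastI_ex[OF ex] unfolding j_def by blast
  then obtain i where j: "j = Suc i" by (cases j) auto
  have c: "br w u = 0" for w
  proof (rule ccontr)
    assume "br w u \<noteq> 0"
    moreover have "br w u \<in> upper_central br i" using u(1) j by simp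
    ultimately have "j \<le> i" unfolding j_def by (intro Least_le) (use br_in_derived in blast)
    then show False using j by simp
  qed
  have "\<exists>v w. ip u (br v w) \<noteq> 0"
  proof (rule ccontr)
    assume "\<not> ?thesis"
    then have "ip u u = 0"
      using ip_span_eq_0[of u "{br u v | u v. True}" u] u(2) unfolding derived_def by blast
    then show False using u(3) by simp
  qed
  then obtain v w where vw: "ip u (br w v) \<noteq> 0" by blast
  have "2 * ip (nab v u) w = ip (br w v) u"
    using koszul[of v u w] c br_anti[of u w] by simp
  then have "nab v u \<noteq> 0" using vw ip_sym by force
  then show ?thesis using sect_central[OF c] ip_pos by metis
qed

text \<open>Both vectors for \<open>sect_neg_formula\<close> exist by contradiction with nilpotency.
  If everything orthogonal to the derived algebra were central, brackets with the derived algebra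
  would already give all brackets, so the derived algebra would sink to 0. If \<open>ad b\<close>
  killed the orthogonal complement of its image, the image would equal that of its square, hence of
  every power.\<close>

lemma sect_neg_exists: "\<exists>u v. sect u v < 0"
proof -
  obtain k where k: "upper_central br k = UNIV" using nilpotent by blast
  have "\<exists>b. (\<forall>s\<in>derived. ip b s = 0) \<and> (\<exists>w. br b w \<noteq> 0)"
  proof (rule ccontr)
    assume "\<not> ?thesis"
    then have cen: "br b w = 0" if "\<And>s. s \<in> derived \<Longrightarrow> ip b s = 0" for b w using that by blast
    have sub: "subspace derived" unfolding derived_def by simp
    \<comment> \<open>Every bracket is \<open>br u v'\<close> with \<open>v'\<close> in the derived
      algebra, since the complement is central; so membership of the derived algebra improves by one
      level per step. Once the truncated difference reaches 0 it stays there.\<close>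
    have "derived \<subseteq> upper_central br (k - i)" for i
    proof (induction i)
      case 0
      then show ?case using k by simp
    next
      case (Suc i)
      show ?case
      proof (cases "k - i")
        case 0
        then show ?thesis using Suc by simp
      next
        case j: (Suc j)
        have "br u v \<in> upper_central br j" for u v
        proof -
          obtain v' z where v: "v = v' + z" "v' \<in> derived" "\<And>s. s \<in> derived \<Longrightarrow> ip z s = 0"
            using orthogonal_decomposition[OF sub] by blast
          have "br u z = 0" using cen[OF v(3)] br_anti[of u z] by simp
          then have "br u v = br u v'" using v(1) by simp
          then show ?thesis using Suc.IH v(2) j by auto
        qed
        moreover have "k - Suc i = j" using j by arith
        ultimately show ?thesis using derived_subset[OF subspace_upper_central] by metis
      qed
    qed
    from this[of k] show False using br_in_derived nonabelian by auto
  qed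
  then obtain b w0 where b: "\<And>s. s \<in> derived \<Longrightarrow> ip b s = 0" and w0: "br b w0 \<noteq> 0" by blast
  have b': "ip b (br u w) = 0" for u w using b br_in_derived by blast
  have "\<exists>v. (\<forall>w. ip v (br b w) = 0) \<and> br b v \<noteq> 0"
  proof (rule ccontr)
    assume "\<not> ?thesis"
    then have ker: "br b v = 0" if "\<And>w. ip v (br b w) = 0" for v using that by blast
    have sub: "subspace (range (br b))"
      by (rule linear_subspace_image) (auto intro!: linearI)
    have step: "\<exists>w'. br b w = br b (br b w')" for w
    proof -
      obtain w1 z where w: "w = w1 + z" "w1 \<in> range (br b)" "\<And>s. s \<in> range (br b) \<Longrightarrow> ip z s = 0"
        using orthogonal_decomposition[OF sub] by blast
      have "br b z = 0" using ker w(3) by blast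
      then show ?thesis using w(1,2) by auto
    qed
    have "\<exists>w'. br b w = ((\<lambda>w. br b w) ^^ i) (br b w')" for i w
    proof (induction i arbitrary: w)
      case (Suc i)
      obtain w' where "br b w = br b (br b w')" using step by blast
      moreover obtain w'' where "br b w' = ((\<lambda>w. br b w) ^^ i) (br b w'')" using Suc by blast
      ultimately show ?case by auto
    qed auto
    from this[of w0 k] show False using nilpotent_funpow[of _ k b] k w0 by auto
  qed
  then obtain v where v: "\<And>w. ip v (br b w) = 0" "br b v \<noteq> 0" by blast
  have "sect v b < 0" using sect_neg_formula[OF b' v(1)] ip_pos[OF v(2)] by simp
  then show ?thesis by blast
qed

text \<open>Along the segment from \<open>u\<close> to \<open>v\<close> the value is a quadratic
  polynomial with a sign change. At the zero the pair cannot degenerate: otherwise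
  \<open>(1 - t) u\<close> and \<open>- t v\<close> agree modulo \<open>w\<close>, so a nonnegative
  and a nonpositive multiple of the two values coincide, forcing both \<open>t = 0\<close> and
  \<open>t = 1\<close>.\<close>

lemma sect_zero_line:
  assumes "sect w u > 0" "sect w v < 0"
  shows "\<exists>z. indep2 w z \<and> sect w z = 0"
proof -
  define h where "h t = sect w (u + t *\<^sub>R (v - u))" for t
  have "continuous_on {0..1} h" unfolding h_def sect_line by (intro continuous_intros)
  moreover have "h 1 < 0" "h 0 > 0" using assms by (auto simp: h_def)
  ultimately obtain t where t: "h t = 0" using IVT2'[of h 1 0 0] by auto
  have wu: "indep2 w u" and wv: "indep2 w v" using assms indep2_sect_nz by auto
  have "indep2 w (u + t *\<^sub>R (v - u))"
  proof (rule ccontr)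
    assume "\<not> ?thesis"
    then obtain r where r: "u + t *\<^sub>R (v - u) = r *\<^sub>R w" using wu indep2_iff by blast
    have "(1 - t)\<^sup>2 * sect w u = t\<^sup>2 * sect w v"
    proof -
      have "(1 - t) *\<^sub>R u = (- t) *\<^sub>R v + r *\<^sub>R w" using r by (simp add: algebra_simps)
      then have "sect w ((1 - t) *\<^sub>R u) = sect w ((- t) *\<^sub>R v)" by (simp only: sect_shift)
      then show ?thesis by (simp only: sect_scale power2_minus)
    qed
    moreover have "(1 - t)\<^sup>2 * sect w u \<ge> 0" "t\<^sup>2 * sect w v \<le> 0"
      using assms by (auto simp: mult_nonneg_nonpos)
    ultimately have "(1 - t)\<^sup>2 * sect w u = 0" "t\<^sup>2 * sect w v = 0" by auto
    then show False using assms by auto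
  qed
  then show ?thesis using t h_def by auto
qed

text \<open>Without a zero, all planes through a common vector have the same sign. The plane of
  \<open>u1\<close> and \<open>u2\<close> then links a positive plane to a negative one; if these
  vectors are parallel, the two planes already share a line.\<close>

lemma sect_zero_exists: "\<exists>u v. indep2 u v \<and> sect u v = 0"
proof (rule ccontr)
  assume "\<not> ?thesis"
  then have nz: "sect u v \<noteq> 0" if "indep2 u v" for u v using that by blast
  obtain u1 v1 where 1: "sect u1 v1 > 0" using sect_pos_exists by blast
  obtain u2 v2 where 2: "sect u2 v2 < 0" using sect_neg_exists by blast
  have same: "sect w u > 0 \<longleftrightarrow> sect w v > 0" if "indep2 w u" "indep2 w v" for w u v
    using sect_zero_line nz[OF that(1)] nz[OF that(2)] nz by (meson linorder_neqE_linordered_idom)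
  have i1: "indep2 u1 v1" and i2: "indep2 u2 v2" using 1 2 indep2_sect_nz by auto
  show False
  proof (cases "indep2 u1 u2")
    case True
    then have "sect u1 u2 > 0" using same 1 i1 by blast
    moreover have "\<not> sect u2 u1 > 0" using same 2 i2 True indep2_sym by (metis order_less_asym)
    ultimately show ?thesis using sect_sym by simp
  next
    case False
    have "u1 \<noteq> 0" "u2 \<noteq> 0" using i1 i2 indep2_iff by auto
    then obtain r where r: "u2 = r *\<^sub>R u1" using False indep2_iff by blast
    then have "r \<noteq> 0" using \<open>u2 \<noteq> 0\<close> by auto
    have "sect u2 v1 = r\<^sup>2 * sect u1 v1" using sect_sym[of u2 v1] sect_sym[of u1 v1] r sect_scale by simp
    then have p: "sect u2 v1 > 0" using 1 \<open>r \<noteq> 0\<close> by simp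
    then show ?thesis using same[OF indep2_sect_nz i2] 2 by force
  qed
qed

text \<open>For parallel \<open>x\<close> torsion-freeness turns \<open>br x\<close> into
  \<open>nab x\<close>, which is skew. It is also nilpotent, and a skew map whose square kills
  \<open>y\<close> kills \<open>y\<close> itself, so the exponent can be lowered to 1.\<close>

lemma parallel_central:
  assumes "\<And>u. nab u x = 0"
  shows "br x v = 0"
proof -
  have sk: "ip (br x v) w = - ip v (br x w)" for v w
  proof -
    have "ip (nab x v) w = - ip v (nab x w)" using nab_metric[of x v w] by simp
    moreover have "nab x u = br x u" for u using nab_torsion[of x u] assms by simp
    ultimately show ?thesis by simp
  qed
  obtain k where k: "upper_central br k = UNIV" using nilpotent by blast
  have "((\<lambda>w. br x w) ^^ Suc i) v = 0 \<Longrightarrow> br x v = 0" for i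
  proof (induction i)
    case (Suc i)
    define y where "y = ((\<lambda>w. br x w) ^^ i) v"
    have "br x (br x y) = 0" using Suc.prems by (simp add: y_def)
    then have "ip (br x y) (br x y) = 0" using sk[of y "br x y"] by simp
    then show ?case using Suc.IH by (simp add: y_def)
  qed simp
  then show ?thesis using nilpotent_funpow[of v k x] k by (cases k) auto
qed

text \<open>Since \<open>x\<close> is parallel and central, \<open>nab x\<close> vanishes too, so
  the curvature is zero as soon as \<open>x\<close> enters any of its slots used here.\<close>

lemma sect_parallel_shift:
  assumes "\<And>u. nab u x = 0"
  shows "sect u (v + r *\<^sub>R x) = sect u v"
proof -
  have br: "br x w = 0" "br w x = 0" for w
    using parallel_central[OF assms] br_anti[of w x] by auto
  have "nab x w = 0" for w using nab_torsion[of x w] br assms by simp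
  then have "curv u x w = 0" "curv u w x = 0" for w unfolding curv_def using br assms by auto
  then show ?thesis unfolding sect_def by simp
qed

text \<open>From the threshold \<open>e\<close> on, \<open>v + s x\<close> lies in the cone. Two
  admissible multiples are tried, \<open>e\<close> and \<open>e + 1\<close>: if both were dependent
  on \<open>u\<close>, their difference \<open>x\<close> and then \<open>v\<close> would be
  multiples of \<open>u\<close>.\<close>

lemma indep2_in_cone:
  assumes par: "\<And>u. nab u x = 0" and uv: "indep2 u v"
  shows "\<exists>v'. indep2 u v' \<and> (x \<noteq> 0 \<longrightarrow> ip x v' > 0) \<and> sect u v' = sect u v"
proof (cases "x = 0")
  case True
  then show ?thesis using uv by blast
next
  case False
  define e where "e = (\<bar>ip x v\<bar> + 1) / ip x x"
  have pos: "ip x (v + s *\<^sub>R x) > 0" if "s \<ge> e" for s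
  proof -
    have "s * ip x x \<ge> \<bar>ip x v\<bar> + 1"
      using that ip_pos[OF False] unfolding e_def by (simp add: pos_divide_le_eq)
    then show ?thesis by simp
  qed
  have "indep2 u (v + e *\<^sub>R x) \<or> indep2 u (v + (e + 1) *\<^sub>R x)"
  proof (rule ccontr)
    assume "\<not> ?thesis"
    moreover have "u \<noteq> 0" using uv indep2_iff by blast
    ultimately obtain r s where r: "v + e *\<^sub>R x = r *\<^sub>R u" "v + (e + 1) *\<^sub>R x = s *\<^sub>R u"
      unfolding indep2_iff by blast
    have "x = (v + (e + 1) *\<^sub>R x) - (v + e *\<^sub>R x)" by (simp add: algebra_simps)
    also have "\<dots> = (s - r) *\<^sub>R u" unfolding r by (simp add: scaleR_diff_left)
    finally have x: "x = (s - r) *\<^sub>R u" .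
    have "v = (v + e *\<^sub>R x) - e *\<^sub>R x" by simp
    also have "\<dots> = (r - e * (s - r)) *\<^sub>R u" unfolding r by (subst x) (simp add: algebra_simps)
    finally have "v = (r - e * (s - r)) *\<^sub>R u" .
    then show False using uv indep2_iff by blast
  qed
  then obtain s where "s \<ge> e" "indep2 u (v + s *\<^sub>R x)"
    by (metis order_refl le_add_same_cancel1 zero_le_one)
  then show ?thesis using pos[of s] sect_parallel_shift[OF par] by blast
qed

theorem sect_signs:
  assumes par: "\<And>u. nab u x = 0"
  shows "\<exists>u v. indep2 u v \<and> (x \<noteq> 0 \<longrightarrow> ip x v > 0) \<and> sect u v > 0"
    and "\<exists>u v. indep2 u v \<and> (x \<noteq> 0 \<longrightarrow> ip x v > 0) \<and> sect u v < 0"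
    and "\<exists>u v. indep2 u v \<and> (x \<noteq> 0 \<longrightarrow> ip x v > 0) \<and> sect u v = 0"
proof -
  have *: "\<exists>u v. indep2 u v \<and> (x \<noteq> 0 \<longrightarrow> ip x v > 0) \<and> Q (sect u v)"
    if "indep2 u v" "Q (sect u v)" for Q u v
    using indep2_in_cone[OF par that(1)] that(2) by metis
  obtain u v where "sect u v > 0" using sect_pos_exists by blast
  then show "\<exists>u v. indep2 u v \<and> (x \<noteq> 0 \<longrightarrow> ip x v > 0) \<and> sect u v > 0"
    using *[of u v "\<lambda>r. r > 0"] indep2_sect_nz[of u v] by simp
  obtain u v where "sect u v < 0" using sect_neg_exists by blast
  then show "\<exists>u v. indep2 u v \<and> (x \<noteq> 0 \<longrightarrow> ip x v > 0) \<and> sect u v < 0"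
    using *[of u v "\<lambda>r. r < 0"] indep2_sect_nz[of u v] by simp
  obtain u v where "indep2 u v" "sect u v = 0" using sect_zero_exists by blast
  then show "\<exists>u v. indep2 u v \<and> (x \<noteq> 0 \<longrightarrow> ip x v > 0) \<and> sect u v = 0"
    using *[of u v "\<lambda>r. r = 0"] by simp
qed

end

section \<open>Smooth maps and their second derivatives\<close>

abbreviation fd :: "('a::real_normed_vector \<Rightarrow> 'b::real_normed_vector) \<Rightarrow> 'a \<Rightarrow> 'a \<Rightarrow> 'b" where
  "fd f x \<equiv> frechet_derivative f (at x)"

lemma has_frechet_derivative:
  "f differentiable (at x) \<Longrightarrow> (f has_derivative fd f x) (at x)"
  using frechet_derivative_works by blast

lemma has_derivative_transform_open:
  assumes "open S" "x \<in> S" "\<And>y. y \<in> S \<Longrightarrow> f y = g y" "(f has_derivative D) (at x)"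
  shows "(g has_derivative D) (at x)"
  using has_derivative_transform_within_open[OF assms(4,1,2,3)] by simp

lemma Ck_on_cong:
  assumes "open S" "\<And>x. x \<in> S \<Longrightarrow> f x = g x" "Ck_on k S f"
  shows "Ck_on k S g"
  using assms(2,3)
proof (induction k arbitrary: f g)
  case 0
  then show ?case by (simp cong: continuous_on_cong)
next
  case (Suc k)
  have d: "(g has_derivative fd f x) (at x)" if "x \<in> S" for x
    by (rule has_derivative_transform_open[OF assms(1) that Suc.prems(1) has_frechet_derivative])
      (use Suc.prems(2) that in auto)
  have "fd f x = fd g x" if "x \<in> S" for x
    using d[OF that] by (rule frechet_derivative_at)
  then have "Ck_on k S (\<lambda>x. fd g x v)" for v
    using Suc.IH[of "\<lambda>x. fd f x v" "\<lambda>x. fd g x v"]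
      Suc.prems(2) by auto
  moreover have "g differentiable (at x)" if "x \<in> S" for x
    using d[OF that] by (auto simp: differentiable_def)
  ultimately show ?case by simp
qed

lemma Ck_on_affine:
  assumes "open T" "bounded_linear L" "\<And>x. x \<in> T \<Longrightarrow> a + L x \<in> S" "Ck_on k S f"
  shows "Ck_on k T (\<lambda>x. f (a + L x))"
  using assms(4)
proof (induction k arbitrary: f)
  case 0
  have "continuous_on T (\<lambda>x. a + L x)"
    by (intro continuous_intros linear_continuous_on assms(2))
  moreover have "(\<lambda>x. a + L x) ` T \<subseteq> S" using assms(3) by auto
  ultimately show ?case using 0 by (auto intro: continuous_on_compose2)
next
  case (Suc k)
  have d: "((\<lambda>x. f (a + L x)) has_derivative (\<lambda>v. fd f (a + L x) (L v))) (at x)"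
    if "x \<in> T" for x
  proof -
    have "((\<lambda>x. a + L x) has_derivative L) (at x)"
      using has_derivative_add[OF has_derivative_const bounded_linear_imp_has_derivative[OF assms(2)]]
      by simp
    moreover have "(f has_derivative fd f (a + L x)) (at (a + L x))"
      using Suc.prems assms(3)[OF that] has_frechet_derivative by auto
    ultimately show ?thesis by (rule has_derivative_compose)
  qed
  have "Ck_on k T (\<lambda>x. fd (\<lambda>x. f (a + L x)) x v)" for v
  proof (rule Ck_on_cong[OF assms(1)])
    show "Ck_on k T (\<lambda>x. fd f (a + L x) (L v))"
      using Suc.IH[of "\<lambda>z. fd f z (L v)"] Suc.prems by auto
    show "fd f (a + L x) (L v) = fd (\<lambda>x. f (a + L x)) x v"
      if "x \<in> T" for x using frechet_derivative_at[OF d[OF that]] by metis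
  qed
  moreover have "(\<lambda>x. f (a + L x)) differentiable (at x)" if "x \<in> T" for x
    using d[OF that] by (auto simp: differentiable_def)
  ultimately show ?case by simp
qed

lemma Ck_on_linear_image:
  assumes "open S" "bounded_linear L" "Ck_on k S f"
  shows "Ck_on k S (\<lambda>x. L (f x))"
  using assms(3)
proof (induction k arbitrary: f)
  case 0
  then show ?case using bounded_linear.continuous_on[OF assms(2)] by auto
next
  case (Suc k)
  have d: "((\<lambda>x. L (f x)) has_derivative (\<lambda>v. L (fd f x v))) (at x)"
    if "x \<in> S" for x
    by (rule bounded_linear.has_derivative[OF assms(2) has_frechet_derivative])
      (use Suc.prems that in auto)
  have "Ck_on k S (\<lambda>x. fd (\<lambda>x. L (f x)) x v)" for v
  proof (rule Ck_on_cong[OF assms(1)])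
    show "Ck_on k S (\<lambda>x. L (fd f x v))"
      using Suc.IH[of "\<lambda>z. fd f z v"] Suc.prems by auto
    show "L (fd f x v) = fd (\<lambda>x. L (f x)) x v"
      if "x \<in> S" for x using frechet_derivative_at[OF d[OF that]] by metis
  qed
  moreover have "(\<lambda>x. L (f x)) differentiable (at x)" if "x \<in> S" for x
    using d[OF that] by (auto simp: differentiable_def)
  ultimately show ?case by simp
qed

lemma smooth_on_cong:
  "open S \<Longrightarrow> (\<And>x. x \<in> S \<Longrightarrow> f x = g x) \<Longrightarrow> smooth_on S f \<Longrightarrow> smooth_on S g"
  unfolding smooth_on_def using Ck_on_cong by blast

lemma smooth_on_affine:
  "open T \<Longrightarrow> bounded_linear L \<Longrightarrow> (\<And>x. x \<in> T \<Longrightarrow> a + L x \<in> S) \<Longrightarrow> smooth_on S f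
    \<Longrightarrow> smooth_on T (\<lambda>x. f (a + L x))"
  unfolding smooth_on_def using Ck_on_affine by blast

lemma smooth_on_linear_image:
  "open S \<Longrightarrow> bounded_linear L \<Longrightarrow> smooth_on S f \<Longrightarrow> smooth_on S (\<lambda>x. L (f x))"
  unfolding smooth_on_def using Ck_on_linear_image by blast

lemma smooth_on_differentiable: "smooth_on S f \<Longrightarrow> x \<in> S \<Longrightarrow> f differentiable (at x)"
  unfolding smooth_on_def using Ck_on.simps(2) by blast

lemma smooth_on_continuous: "smooth_on S f \<Longrightarrow> continuous_on S f"
  unfolding smooth_on_def using Ck_on.simps(1) by blast

lemma smooth_on_derivative: "smooth_on S f \<Longrightarrow> smooth_on S (\<lambda>x. fd f x v)"
  unfolding smooth_on_def using Ck_on.simps(2) by blast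

lemma smooth_on_has_derivative:
  "smooth_on S f \<Longrightarrow> x \<in> S \<Longrightarrow> (f has_derivative fd f x) (at x)"
  using smooth_on_differentiable has_frechet_derivative by blast

lemma smooth_on_directional:
  assumes "smooth_on S f" "x + t *\<^sub>R v \<in> S"
  shows "((\<lambda>t. f (x + t *\<^sub>R v)) has_derivative
      (\<lambda>r. r *\<^sub>R fd f (x + t *\<^sub>R v) v)) (at t)"
proof -
  let ?D = "fd f (x + t *\<^sub>R v)"
  have f: "(f has_derivative ?D) (at (x + t *\<^sub>R v))"
    using smooth_on_has_derivative assms by blast
  have "((\<lambda>t. x + t *\<^sub>R v) has_derivative (\<lambda>r. r *\<^sub>R v)) (at t)"
    by (auto intro!: derivative_eq_intros)
  from has_derivative_compose[OF this f]
  show ?thesis using linear_cmul[OF has_derivative_linear[OF f]] by simp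
qed

text \<open>The mean value theorem is applied in direction \<open>u\<close> to the increment over
  \<open>r v\<close>, then in direction \<open>v\<close> to the derivative. The left side is
  symmetric in \<open>u\<close> and \<open>v\<close>, which is what Schwarz's theorem
  exploits.\<close>

lemma second_difference_mean_value:
  fixes f :: "'a::real_normed_vector \<Rightarrow> real"
  assumes f: "smooth_on S f" and r: "r > 0"
    and S: "\<And>s t. \<lbrakk>0 \<le> s; s \<le> r; 0 \<le> t; t \<le> r\<rbrakk> \<Longrightarrow> p + s *\<^sub>R u + t *\<^sub>R v \<in> S"
  shows "\<exists>s t. 0 \<le> s \<and> s \<le> r \<and> 0 \<le> t \<and> t \<le> r \<and>
    f (p + r *\<^sub>R u + r *\<^sub>R v) - f (p + r *\<^sub>R u) - f (p + r *\<^sub>R v) + f p =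
      r\<^sup>2 * fd (\<lambda>x. fd f x u) (p + s *\<^sub>R u + t *\<^sub>R v) v"
proof -
  let ?Du = "\<lambda>x. fd f x u"
  define \<phi> where "\<phi> s = f ((p + r *\<^sub>R v) + s *\<^sub>R u) - f (p + s *\<^sub>R u)" for s
  have D: "DERIV \<phi> s :> ?Du ((p + r *\<^sub>R v) + s *\<^sub>R u) - ?Du (p + s *\<^sub>R u)"
    if "0 \<le> s" "s \<le> r" for s
  proof -
    have "((\<lambda>s. f ((p + r *\<^sub>R v) + s *\<^sub>R u)) has_derivative
        (\<lambda>h. h *\<^sub>R ?Du ((p + r *\<^sub>R v) + s *\<^sub>R u))) (at s)"
      using S[of s r] that r by (intro smooth_on_directional[OF f]) (simp add: algebra_simps)
    moreover have "((\<lambda>s. f (p + s *\<^sub>R u)) has_derivative (\<lambda>h. h *\<^sub>R ?Du (p + s *\<^sub>R u))) (at s)"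
      using S[of s 0] that r by (intro smooth_on_directional[OF f]) simp
    ultimately have "((\<lambda>s. f ((p + r *\<^sub>R v) + s *\<^sub>R u) - f (p + s *\<^sub>R u)) has_derivative
        (\<lambda>h. h *\<^sub>R ?Du ((p + r *\<^sub>R v) + s *\<^sub>R u) - h *\<^sub>R ?Du (p + s *\<^sub>R u))) (at s)"
      by (rule has_derivative_diff)
    moreover have "(\<lambda>h. h *\<^sub>R ?Du ((p + r *\<^sub>R v) + s *\<^sub>R u) - h *\<^sub>R ?Du (p + s *\<^sub>R u)) =
        (*) (?Du ((p + r *\<^sub>R v) + s *\<^sub>R u) - ?Du (p + s *\<^sub>R u))"
      by (simp add: fun_eq_iff algebra_simps)
    ultimately show ?thesis unfolding \<phi>_def has_field_derivative_def by simp
  qed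
  obtain s where s: "0 < s" "s < r"
      "\<phi> r - \<phi> 0 = (r - 0) * (?Du ((p + r *\<^sub>R v) + s *\<^sub>R u) - ?Du (p + s *\<^sub>R u))"
    using MVT2[OF r D] by metis
  have D2: "DERIV (\<lambda>t. ?Du (p + s *\<^sub>R u + t *\<^sub>R v)) t :>
      fd ?Du (p + s *\<^sub>R u + t *\<^sub>R v) v" if "0 \<le> t" "t \<le> r" for t
    using smooth_on_directional[OF smooth_on_derivative[OF f], of "p + s *\<^sub>R u" t v u] S[of s t] that s
    unfolding has_field_derivative_def by (simp add: algebra_simps mult_commute_abs)
  obtain t where "0 < t" "t < r"
      "?Du (p + s *\<^sub>R u + r *\<^sub>R v) - ?Du (p + s *\<^sub>R u + 0 *\<^sub>R v) =
        (r - 0) * fd ?Du (p + s *\<^sub>R u + t *\<^sub>R v) v"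
    using MVT2[OF r D2] by metis
  then show ?thesis
    using s by (intro exI[of _ s] exI[of _ t]) (simp add: \<phi>_def power2_eq_square add_ac)
qed

text \<open>The same second difference, evaluated in both orders, makes the two mixed derivatives
  agree at two points near \<open>p\<close>; continuity compares each with its value at
  \<open>p\<close> up to \<open>e/2\<close>.\<close>

lemma symmetric_second_derivative_real:
  fixes f :: "'a::real_normed_vector \<Rightarrow> real"
  assumes "open S" "smooth_on S f" "p \<in> S"
  shows "fd (\<lambda>x. fd f x u) p v =
    fd (\<lambda>x. fd f x v) p u"
proof -
  let ?D = "\<lambda>u v x. fd (\<lambda>x. fd f x u) x v"
  have "\<bar>?D u v p - ?D v u p\<bar> < e" if "e > 0" for e
  proof -
    have ev: "eventually (\<lambda>x. x \<in> S \<and> \<bar>?D u v x - ?D u v p\<bar> < e/2 \<and> \<bar>?D v u x - ?D v u p\<bar> < e/2) (nhds p)"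
    proof (intro eventually_conj)
      show "eventually (\<lambda>x. x \<in> S) (nhds p)" using assms eventually_nhds_in_open by blast
      have "eventually (\<lambda>x. \<bar>?D u v x - ?D u v p\<bar> < e/2) (nhds p)" for u v
      proof -
        have "isCont (?D u v) p"
          using smooth_on_continuous[OF smooth_on_derivative[OF smooth_on_derivative[OF assms(2)]]]
            assms(1,3) continuous_on_eq_continuous_at by blast
        then have "((?D u v) \<longlongrightarrow> ?D u v p) (nhds p)"
          unfolding isCont_def using tendsto_at_iff_tendsto_nhds by blast
        then have "eventually (\<lambda>x. dist (?D u v x) (?D u v p) < e/2) (nhds p)"
          using that by (intro tendstoD) auto
        then show ?thesis by (simp add: dist_real_def)
      qed
      then show "eventually (\<lambda>x. \<bar>?D u v x - ?D u v p\<bar> < e/2) (nhds p)"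
        "eventually (\<lambda>x. \<bar>?D v u x - ?D v u p\<bar> < e/2) (nhds p)" by blast+
    qed
    then obtain d where d: "d > 0" "\<And>x. dist x p < d \<Longrightarrow>
        x \<in> S \<and> \<bar>?D u v x - ?D u v p\<bar> < e/2 \<and> \<bar>?D v u x - ?D v u p\<bar> < e/2"
      unfolding eventually_nhds_metric by blast
    \<comment> \<open>The summand 1 keeps \<open>K\<close> positive when \<open>u = v = 0\<close>;
      \<open>r * K = d/2\<close> then puts the whole parallelogram inside the ball of radius
      \<open>d\<close>.\<close>
    define K where "K = norm u + norm v + 1"
    have K: "K > 0" unfolding K_def by (simp add: add_nonneg_pos)
    define r where "r = d / (2 * K)"
    have r: "r > 0" unfolding r_def using d(1) K by simp
    have rd: "r * norm u + r * norm v < d"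
    proof -
      have "r * K = d / 2" unfolding r_def using K by simp
      then show ?thesis using r d(1) unfolding K_def by (simp add: algebra_simps)
    qed
    have near: "dist (p + s *\<^sub>R a + t *\<^sub>R b) p < d"
      if "0 \<le> s" "s \<le> r" "0 \<le> t" "t \<le> r" "(a, b) = (u, v) \<or> (a, b) = (v, u)" for s t a b
    proof -
      have "dist (p + s *\<^sub>R a + t *\<^sub>R b) p = norm (s *\<^sub>R a + t *\<^sub>R b)"
        by (simp add: dist_norm algebra_simps)
      also have "\<dots> \<le> s * norm a + t * norm b"
        using norm_triangle_ineq[of "s *\<^sub>R a" "t *\<^sub>R b"] that by simp
      also have "\<dots> \<le> r * norm a + r * norm b"
        by (intro add_mono mult_right_mono) (use that in auto)
      finally show ?thesis using rd that(5) by auto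
    qed
    obtain s t where st: "0 \<le> s" "s \<le> r" "0 \<le> t" "t \<le> r"
        "f (p + r *\<^sub>R u + r *\<^sub>R v) - f (p + r *\<^sub>R u) - f (p + r *\<^sub>R v) + f p =
          r\<^sup>2 * ?D u v (p + s *\<^sub>R u + t *\<^sub>R v)"
      using second_difference_mean_value[OF assms(2) r, of p u v] near d(2) by blast
    obtain s' t' where st': "0 \<le> s'" "s' \<le> r" "0 \<le> t'" "t' \<le> r"
        "f (p + r *\<^sub>R v + r *\<^sub>R u) - f (p + r *\<^sub>R v) - f (p + r *\<^sub>R u) + f p =
          r\<^sup>2 * ?D v u (p + s' *\<^sub>R v + t' *\<^sub>R u)"
      using second_difference_mean_value[OF assms(2) r, of p v u] near d(2) by blast
    have "r\<^sup>2 * ?D u v (p + s *\<^sub>R u + t *\<^sub>R v) = r\<^sup>2 * ?D v u (p + s' *\<^sub>R v + t' *\<^sub>R u)"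
      using st(5) st'(5) by (simp add: algebra_simps)
    then have "?D u v (p + s *\<^sub>R u + t *\<^sub>R v) = ?D v u (p + s' *\<^sub>R v + t' *\<^sub>R u)" using r by simp
    moreover have "\<bar>?D u v (p + s *\<^sub>R u + t *\<^sub>R v) - ?D u v p\<bar> < e/2"
      using d(2) near[OF st(1-4)] by blast
    moreover have "\<bar>?D v u (p + s' *\<^sub>R v + t' *\<^sub>R u) - ?D v u p\<bar> < e/2"
      using d(2) near[OF st'(1-4)] by blast
    ultimately show ?thesis by linarith
  qed
  \<comment> \<open>Taking the difference itself as \<open>e\<close> would make it smaller than
    itself unless it is 0.\<close>
  from this[of "\<bar>?D u v p - ?D v u p\<bar>"] show ?thesis by fastforce
qed

lemma symmetric_second_derivative:
  fixes f :: "'a::real_normed_vector \<Rightarrow> 'b::euclidean_space"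
  assumes "open S" "smooth_on S f" "p \<in> S"
  shows "fd (\<lambda>x. fd f x u) p v =
    fd (\<lambda>x. fd f x v) p u"
proof (rule euclidean_eqI)
  fix b :: 'b assume "b \<in> Basis"
  have bl: "bounded_linear (\<lambda>z. z \<bullet> b)" by (rule bounded_linear_inner_left)
  have c: "fd (\<lambda>x. h x \<bullet> b) x w = fd h x w \<bullet> b"
    if "h differentiable (at x)" for h :: "'a \<Rightarrow> 'b" and x w
    using frechet_derivative_at[OF bounded_linear.has_derivative[OF bl has_frechet_derivative[OF that]]]
    by metis
  have d1: "fd (\<lambda>x. f x \<bullet> b) x w = fd f x w \<bullet> b"
    if "x \<in> S" for x w using c smooth_on_differentiable[OF assms(2) that] by blast
  have d2: "fd (\<lambda>x. fd (\<lambda>x. f x \<bullet> b) x w) p z =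
      fd (\<lambda>x. fd f x w) p z \<bullet> b" for w z
  proof -
    have df: "(\<lambda>x. fd f x w) differentiable (at p)"
      using smooth_on_differentiable[OF smooth_on_derivative[OF assms(2)] assms(3)] .
    have "((\<lambda>x. fd (\<lambda>x. f x \<bullet> b) x w) has_derivative
        (\<lambda>z. fd (\<lambda>x. fd f x w) p z \<bullet> b)) (at p)"
      by (rule has_derivative_transform_open[OF assms(1,3) _
            bounded_linear.has_derivative[OF bl has_frechet_derivative[OF df]]]) (simp add: d1)
    then show ?thesis using frechet_derivative_at by metis
  qed
  show "fd (\<lambda>x. fd f x u) p v \<bullet> b =
    fd (\<lambda>x. fd f x v) p u \<bullet> b"
    using symmetric_second_derivative_real[OF assms(1) smooth_on_linear_image[OF assms(1) bl assms(2)] assms(3), of u v]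
    unfolding d2 .
qed

section \<open>Solutions of linear systems with differentiable coefficients\<close>

lemma differentiable_vec:
  fixes f :: "'a::real_normed_vector \<Rightarrow> real^'n"
  assumes "\<And>i. (\<lambda>x. f x $ i) differentiable (at x within s)"
  shows "f differentiable (at x within s)"
proof -
  have "(\<lambda>x. f x $ i *\<^sub>R axis i (1::real)) differentiable (at x within s)" for i
  proof -
    obtain D where "((\<lambda>x. f x $ i) has_derivative D) (at x within s)"
      using assms unfolding differentiable_def by blast
    from has_derivative_scaleR_left[OF this] show ?thesis unfolding differentiable_def by blast
  qed
  then have "(\<lambda>x. \<Sum>i\<in>UNIV. f x $ i *\<^sub>R axis i (1::real)) differentiable (at x within s)"
    by (intro differentiable_sum) auto
  moreover have "(\<Sum>i\<in>UNIV. f x $ i *\<^sub>R axis i (1::real)) = f x" for x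
    using basis_expansion[of "f x"] by (simp add: scalar_mult_eq_scaleR)
  ultimately show ?thesis by simp
qed

lemma differentiable_vec_nth: "f differentiable F \<Longrightarrow> (\<lambda>x. f x $ i) differentiable F"
  unfolding differentiable_def
  using bounded_linear.has_derivative[OF bounded_linear_vec_nth] by blast

lemma differentiable_prod_real:
  fixes f :: "'i \<Rightarrow> 'a::real_normed_vector \<Rightarrow> real"
  assumes "\<And>i. i \<in> I \<Longrightarrow> f i differentiable (at x)"
  shows "(\<lambda>x. \<Prod>i\<in>I. f i x) differentiable (at x)"
  using assms by (induction I rule: infinite_finite_induct) (auto intro!: differentiable_mult)

lemma differentiable_det:
  fixes A :: "'a::real_normed_vector \<Rightarrow> real^'n^'n"
  assumes "\<And>i j. (\<lambda>x. A x $ i $ j) differentiable (at x)"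
  shows "(\<lambda>x. det (A x)) differentiable (at x)"
  unfolding det_def
  by (intro differentiable_sum differentiable_mult differentiable_const)
    (auto intro!: differentiable_prod_real assms)

text \<open>By Cramer's rule the solution is a quotient of determinants. This serves twice: for the
  Christoffel symbols, which involve an inverse matrix, and for \<open>Ad\<close>, obtained by
  inverting the right invariant frame.\<close>

lemma differentiable_linear_solution:
  fixes A :: "'a::real_normed_vector \<Rightarrow> real^'n^'n"
  assumes A: "\<And>i j. (\<lambda>x. A x $ i $ j) differentiable (at p)"
    and b: "b differentiable (at p)"
    and S: "open S" "p \<in> S" "\<And>x. x \<in> S \<Longrightarrow> invertible (A x)" "\<And>x. x \<in> S \<Longrightarrow> A x *v z x = b x"
  shows "z differentiable (at p)"
proof -
  define N where "N k x = (\<chi> i j. if j = k then b x $ i else A x $ i $ j)" for k x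
  have z: "(\<chi> k. det (N k x) / det (A x)) = z x" if "x \<in> S" for x
  proof -
    have "det (A x) \<noteq> 0" using S(3)[OF that] invertible_det_nz by blast
    from cramer[OF this, of "z x" "b x"] show ?thesis
      unfolding N_def using S(4)[OF that] by simp
  qed
  have "(\<lambda>x. det (N k x)) differentiable (at p)" for k
  proof (rule differentiable_det)
    fix i j show "(\<lambda>x. N k x $ i $ j) differentiable (at p)"
      using A differentiable_vec_nth[OF b] by (cases "j = k") (simp_all add: N_def)
  qed
  moreover have "(\<lambda>x. det (A x)) differentiable (at p)" by (rule differentiable_det[OF A])
  moreover have "det (A p) \<noteq> 0" using S invertible_det_nz by blast
  ultimately have "(\<lambda>x. \<chi> k. det (N k x) / det (A x)) differentiable (at p)"
    by (intro differentiable_vec) simp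
  then show ?thesis
    unfolding differentiable_def using has_derivative_transform_open[OF S(1,2) z] by fast
qed

section \<open>The Levi-Civita connection in a frame with constant metric coefficients\<close>

lemma linear_axis_expansion:
  fixes f :: "real^'n \<Rightarrow> 'b::real_vector"
  assumes "linear f"
  shows "f x = (\<Sum>k\<in>UNIV. (x $ k) *\<^sub>R f (axis k 1))"
proof -
  have "f x = f (\<Sum>k\<in>UNIV. x $ k *\<^sub>R axis k 1)"
    using basis_expansion[of x] by (simp add: scalar_mult_eq_scaleR)
  also have "\<dots> = (\<Sum>k\<in>UNIV. (x $ k) *\<^sub>R f (axis k 1))"
    by (simp add: linear_sum[OF assms] linear_cmul[OF assms])
  finally show ?thesis .
qed

text \<open>The product rule from differentiability of \<open>f p x\<close> at each fixed
  \<open>x\<close> only: in finite dimension \<open>x p\<close> is expanded in the axes. That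
  \<open>D\<close> is linear in its vector follows from uniqueness of derivatives.\<close>

lemma has_derivative_linear_family:
  fixes f :: "'a::real_normed_vector \<Rightarrow> real^'n \<Rightarrow> 'b::real_normed_vector"
  assumes S: "open S" "q \<in> S" and lin: "\<And>p. p \<in> S \<Longrightarrow> linear (f p)"
    and D: "\<And>x. ((\<lambda>p. f p x) has_derivative D x) (at q)"
    and x: "(x has_derivative x') (at q)"
  shows "((\<lambda>p. f p (x p)) has_derivative (\<lambda>a. D (x q) a + f q (x' a))) (at q)"
proof -
  have xk: "((\<lambda>p. x p $ k) has_derivative (\<lambda>a. x' a $ k)) (at q)" for k
    using bounded_linear.has_derivative[OF bounded_linear_vec_nth x] .
  have "((\<lambda>p. \<Sum>k\<in>UNIV. (x p $ k) *\<^sub>R f p (axis k 1)) has_derivative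
     (\<lambda>a. \<Sum>k\<in>UNIV. (x q $ k) *\<^sub>R D (axis k 1) a + (x' a $ k) *\<^sub>R f q (axis k 1))) (at q)"
    by (intro has_derivative_sum has_derivative_scaleR xk D)
  moreover have "(\<Sum>k\<in>UNIV. (x q $ k) *\<^sub>R D (axis k 1) a + (x' a $ k) *\<^sub>R f q (axis k 1)) =
      D (x q) a + f q (x' a)" for a
  proof -
    have "((\<lambda>p. \<Sum>k\<in>UNIV. (x q $ k) *\<^sub>R f p (axis k 1)) has_derivative
        (\<lambda>a. \<Sum>k\<in>UNIV. (x q $ k) *\<^sub>R D (axis k 1) a)) (at q)"
      by (intro has_derivative_sum has_derivative_scaleR_right D)
    then have "((\<lambda>p. f p (x q)) has_derivative (\<lambda>a. \<Sum>k\<in>UNIV. (x q $ k) *\<^sub>R D (axis k 1) a)) (at q)"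
      by (rule has_derivative_transform_open[OF S, rotated])
        (simp add: linear_axis_expansion[OF lin, symmetric])
    then have "(\<Sum>k\<in>UNIV. (x q $ k) *\<^sub>R D (axis k 1) a) = D (x q) a"
      using has_derivative_unique[OF D] by metis
    then show ?thesis
      using linear_axis_expansion[OF lin[OF S(2)], of "x' a"] by (simp add: sum.distrib)
  qed
  ultimately have "((\<lambda>p. \<Sum>k\<in>UNIV. (x p $ k) *\<^sub>R f p (axis k 1)) has_derivative
      (\<lambda>a. D (x q) a + f q (x' a))) (at q)" by simp
  then show ?thesis
    by (rule has_derivative_transform_open[OF S, rotated])
      (simp add: linear_axis_expansion[OF lin, symmetric])
qed

lemma has_derivative_bilinear_family:
  fixes f :: "'a::real_normed_vector \<Rightarrow> real^'n \<Rightarrow> real^'m \<Rightarrow> 'b::real_normed_vector"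
  assumes S: "open S" "q \<in> S" and lin: "\<And>p. p \<in> S \<Longrightarrow> bilinear (f p)"
    and D: "\<And>x y. ((\<lambda>p. f p x y) has_derivative D x y) (at q)"
    and x: "(x has_derivative x') (at q)" and y: "(y has_derivative y') (at q)"
  shows "((\<lambda>p. f p (x p) (y p)) has_derivative
      (\<lambda>a. D (x q) (y q) a + f q (x' a) (y q) + f q (x q) (y' a))) (at q)"
proof -
  have "((\<lambda>p. f p (x p) z) has_derivative (\<lambda>a. D (x q) z a + f q (x' a) z)) (at q)" for z
    by (rule has_derivative_linear_family[OF S, where f = "\<lambda>p x. f p x z"])
      (use lin D x in \<open>auto simp: bilinear_def\<close>)
  then have "((\<lambda>p. f p (x p) (y p)) has_derivative
      (\<lambda>a. (D (x q) (y q) a + f q (x' a) (y q)) + f q (x q) (y' a))) (at q)"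
    by (rule has_derivative_linear_family[OF S, where f = "\<lambda>p. f p (x p)", rotated])
      (use lin y in \<open>auto simp: bilinear_def\<close>)
  then show ?thesis .
qed

lemma deriv_line:
  assumes "(h has_derivative D) (at p)"
  shows "deriv (\<lambda>t. h (p + t *\<^sub>R v)) 0 = (D v :: real)"
proof -
  have d: "((\<lambda>t::real. p + t *\<^sub>R v) has_derivative (\<lambda>r. r *\<^sub>R v)) (at 0)"
    by (auto intro!: derivative_eq_intros)
  have "((\<lambda>t. h (p + t *\<^sub>R v)) has_derivative (\<lambda>r. D (r *\<^sub>R v))) (at 0)"
    using has_derivative_compose[OF d, of h D] assms by simp
  moreover have "(\<lambda>r. D (r *\<^sub>R v)) = (*) (D v)"
    using linear_cmul[OF has_derivative_linear[OF assms]] by (simp add: fun_eq_iff)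
  ultimately have "((\<lambda>t. h (p + t *\<^sub>R v)) has_field_derivative D v) (at 0)"
    unfolding has_field_derivative_def by simp
  then show ?thesis by (rule DERIV_imp_deriv)
qed

lemma partial_eq_frechet: "(h has_derivative D) (at p) \<Longrightarrow> partial k h p = D (axis k 1)"
  unfolding partial_def by (rule deriv_line)

lemma invertible_posdef:
  fixes A :: "real^'n^'n"
  assumes "\<And>v. v \<noteq> 0 \<Longrightarrow> v \<bullet> (A *v v) > 0"
  shows "invertible A"
proof -
  have "A *v x = 0 \<Longrightarrow> x = 0" for x using assms[of x] by force
  then show ?thesis using matrix_left_invertible_ker invertible_left_inverse by blast
qed

lemma matrix_inv_mult_vec:
  fixes A :: "real^'n^'n"
  assumes "invertible A"
  shows "A *v (matrix_inv A *v x) = x"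
proof -
  have "A ** matrix_inv A = mat 1"
    using someI_ex[OF assms[unfolded invertible_def]] unfolding matrix_inv_def by blast
  then show ?thesis by (simp add: matrix_vector_mul_assoc)
qed

section \<open>Christoffel symbols of a metric in coordinates\<close>

locale local_metric_tensor =
  fixes S :: "(real^'n) set" and M :: "real^'n \<Rightarrow> real^'n^'n"
  assumes open_S: "open S"
    and M_smooth: "smooth_on S (\<lambda>q. M q $ i $ j)"
    and M_sym: "q \<in> S \<Longrightarrow> M q $ i $ j = M q $ j $ i"
    and M_pos: "q \<in> S \<Longrightarrow> v \<noteq> 0 \<Longrightarrow> v \<bullet> (M q *v v) > 0"
begin

definition m :: "real^'n \<Rightarrow> real^'n \<Rightarrow> real^'n \<Rightarrow> real" where
  "m q u v = u \<bullet> (M q *v v)"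

definition dM :: "real^'n \<Rightarrow> real^'n \<Rightarrow> real^'n^'n" where
  "dM q a = (\<chi> i j. fd (\<lambda>q. M q $ i $ j) q a)"

definition dm :: "real^'n \<Rightarrow> real^'n \<Rightarrow> real^'n \<Rightarrow> real^'n \<Rightarrow> real" where
  "dm q a u v = u \<bullet> (dM q a *v v)"

definition LC :: "real^'n \<Rightarrow> 'n \<Rightarrow> 'n \<Rightarrow> 'n \<Rightarrow> real" where
  "LC q i j k = 1/2 * (\<Sum>l\<in>UNIV. matrix_inv (M q) $ i $ l *
     (partial k (\<lambda>q. M q $ l $ j) q + partial j (\<lambda>q. M q $ l $ k) q
      - partial l (\<lambda>q. M q $ j $ k) q))"

definition \<Gamma> :: "real^'n \<Rightarrow> real^'n \<Rightarrow> real^'n \<Rightarrow> real^'n" where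
  "\<Gamma> q u v = (\<chi> i. \<Sum>j\<in>UNIV. \<Sum>k\<in>UNIV. LC q i j k * u $ j * v $ k)"

definition d\<Gamma> :: "real^'n \<Rightarrow> real^'n \<Rightarrow> real^'n \<Rightarrow> real^'n \<Rightarrow> real^'n" where
  "d\<Gamma> q a u v = fd (\<lambda>q. \<Gamma> q u v) q a"

text \<open>The curvature \<open>R(u, v)w\<close> for fields with constant coordinate components, so
  there is no bracket term. The last argument of \<open>\<Gamma>\<close> is the direction of
  differentiation.\<close>

definition Rm :: "real^'n \<Rightarrow> real^'n \<Rightarrow> real^'n \<Rightarrow> real^'n \<Rightarrow> real^'n" where
  "Rm q u v w = d\<Gamma> q u w v - d\<Gamma> q v w u + \<Gamma> q (\<Gamma> q w v) u - \<Gamma> q (\<Gamma> q w u) v"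

lemma m_bilinear: "bilinear (m q)"
  unfolding bilinear_def m_def
  by (auto intro!: linearI simp: inner_add_left matrix_vector_right_distrib inner_add_right
      matrix_vector_mult_scaleR)

lemma m_sum: "m q u v = (\<Sum>i\<in>UNIV. \<Sum>j\<in>UNIV. u $ i * M q $ i $ j * v $ j)"
  unfolding m_def inner_vec_def matrix_vector_mult_def by (simp add: sum_distrib_left mult.assoc)

lemma dm_sum: "dm q a u v = (\<Sum>i\<in>UNIV. \<Sum>j\<in>UNIV. u $ i * dM q a $ i $ j * v $ j)"
  unfolding dm_def inner_vec_def matrix_vector_mult_def by (simp add: sum_distrib_left mult.assoc)

lemma m_sym: "q \<in> S \<Longrightarrow> m q u v = m q v u"
  unfolding m_sum using M_sym[of q] by (subst sum.swap) (simp add: mult.commute mult.left_commute)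

lemma inner_space_m: "q \<in> S \<Longrightarrow> inner_space (m q)"
  by unfold_locales (use m_bilinear m_sym M_pos in \<open>auto simp: m_def[symmetric]\<close>)

lemma M_has_derivative:
  "q \<in> S \<Longrightarrow> ((\<lambda>q. M q $ i $ j) has_derivative (\<lambda>a. dM q a $ i $ j)) (at q)"
  unfolding dM_def using smooth_on_has_derivative[OF M_smooth] by simp

lemma dM_linear: "q \<in> S \<Longrightarrow> linear (\<lambda>a. dM q a $ i $ j)"
  using M_has_derivative has_derivative_linear by blast

lemma dM_sym:
  assumes "q \<in> S" shows "dM q a $ i $ j = dM q a $ j $ i"
proof -
  have "((\<lambda>q. M q $ j $ i) has_derivative (\<lambda>a. dM q a $ i $ j)) (at q)"
    by (rule has_derivative_transform_open[OF open_S assms M_sym M_has_derivative[OF assms]])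
  then show ?thesis using has_derivative_unique[OF M_has_derivative[OF assms]] by metis
qed

lemma m_has_derivative: "q \<in> S \<Longrightarrow> ((\<lambda>q. m q u v) has_derivative (\<lambda>a. dm q a u v)) (at q)"
  unfolding m_sum dm_sum
  by (intro has_derivative_sum has_derivative_mult_left has_derivative_mult_right M_has_derivative)

lemma partial_M: "q \<in> S \<Longrightarrow> partial k (\<lambda>q. M q $ i $ j) q = dM q (axis k 1) $ i $ j"
  by (rule partial_eq_frechet[OF M_has_derivative])

lemma invertible_M: "q \<in> S \<Longrightarrow> invertible (M q)"
  by (rule invertible_posdef[OF M_pos])

text \<open>The Christoffel symbols of the first kind.\<close>

definition cof :: "real^'n \<Rightarrow> 'n \<Rightarrow> 'n \<Rightarrow> 'n \<Rightarrow> real" where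
  "cof q l j k = 1/2 * (dM q (axis k 1) $ l $ j + dM q (axis j 1) $ l $ k - dM q (axis l 1) $ j $ k)"

lemma LC_cof: "q \<in> S \<Longrightarrow> LC q i j k = (\<Sum>l\<in>UNIV. matrix_inv (M q) $ i $ l * cof q l j k)"
  unfolding LC_def cof_def by (simp add: partial_M sum_distrib_left mult.left_commute)

lemma LC_sym: "q \<in> S \<Longrightarrow> LC q i j k = LC q i k j"
  by (simp add: LC_cof cof_def dM_sym[of q _ j k] add.commute)

text \<open>Lowering the index removes the inverse matrix. This exhibits \<open>\<Gamma>\<close> as
  the solution of a linear system, as \<open>differentiable_linear_solution\<close> requires, and
  gives the Koszul formula \<open>m_\<Gamma>\<close>.\<close>

lemma M_\<Gamma>: 
  assumes "q \<in> S"
  shows "M q *v \<Gamma> q u v = (\<chi> l. \<Sum>j\<in>UNIV. \<Sum>k\<in>UNIV. cof q l j k * u $ j * v $ k)" (is "_ = ?b")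
proof -
  have "\<Gamma> q u v = matrix_inv (M q) *v ?b"
  proof (rule vec_eq_iff[THEN iffD2], rule allI)
    fix i
    have "\<Gamma> q u v $ i = (\<Sum>j\<in>UNIV. \<Sum>k\<in>UNIV. \<Sum>l\<in>UNIV. matrix_inv (M q) $ i $ l * (cof q l j k * u $ j * v $ k))"
      unfolding \<Gamma>_def by (simp add: LC_cof[OF assms] sum_distrib_right mult.assoc)
    also have "\<dots> = (\<Sum>l\<in>UNIV. \<Sum>j\<in>UNIV. \<Sum>k\<in>UNIV. matrix_inv (M q) $ i $ l * (cof q l j k * u $ j * v $ k))"
      by (subst (2) sum.swap, subst sum.swap) simp
    also have "\<dots> = (matrix_inv (M q) *v ?b) $ i"
      by (simp add: matrix_vector_mult_def sum_distrib_left)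
    finally show "\<Gamma> q u v $ i = (matrix_inv (M q) *v ?b) $ i" .
  qed
  then show ?thesis using matrix_inv_mult_vec[OF invertible_M[OF assms]] by simp
qed

lemma dm_triple:
  assumes "q \<in> S"
  shows "dm q a u v = (\<Sum>i\<in>UNIV. \<Sum>j\<in>UNIV. \<Sum>k\<in>UNIV. dM q (axis k 1) $ i $ j * u $ i * v $ j * a $ k)"
proof -
  have "dM q a $ i $ j = (\<Sum>k\<in>UNIV. a $ k * dM q (axis k 1) $ i $ j)" for i j
    using linear_axis_expansion[OF dM_linear[OF assms], of a i j] by simp
  then show ?thesis unfolding dm_sum
    by (simp add: sum_distrib_left sum_distrib_right mult_ac)
qed

lemma m_\<Gamma>:
  assumes "q \<in> S"
  shows "m q w (\<Gamma> q u v) = 1/2 * (dm q v w u + dm q u w v - dm q w u v)"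
proof -
  let ?T = "\<lambda>X. \<Sum>l\<in>UNIV. \<Sum>j\<in>UNIV. \<Sum>k\<in>UNIV. X l j k * w $ l * u $ j * v $ k"
  let ?d = "\<lambda>k i j. dM q (axis k 1) $ i $ j"
  have "m q w (\<Gamma> q u v) = ?T (\<lambda>l j k. cof q l j k)"
    unfolding m_def M_\<Gamma>[OF assms] by (simp add: inner_vec_def sum_distrib_left mult_ac)
  also have "\<dots> = 1/2 * (?T (\<lambda>l j k. ?d k l j)
      + ?T (\<lambda>l j k. ?d j l k)
      - ?T (\<lambda>l j k. ?d l j k))"
    unfolding cof_def sum_distrib_left sum.distrib[symmetric] sum_subtractf[symmetric]
    by (intro sum.cong refl) (simp add: algebra_simps)
  also have "?T (\<lambda>l j k. ?d k l j) = dm q v w u"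
    unfolding dm_triple[OF assms] ..
  also have "?T (\<lambda>l j k. ?d j l k) = dm q u w v"
    unfolding dm_triple[OF assms] by (subst (2) sum.swap) (simp add: mult_ac)
  also have "?T (\<lambda>l j k. ?d l j k) = dm q w u v"
    unfolding dm_triple[OF assms] by (subst sum.swap, subst (2) sum.swap) (simp add: mult_ac)
  finally show ?thesis .
qed

lemma \<Gamma>_sym: "q \<in> S \<Longrightarrow> \<Gamma> q u v = \<Gamma> q v u"
  unfolding \<Gamma>_def by (subst sum.swap) (simp add: LC_sym[of q] mult_ac)

lemma \<Gamma>_bilinear: "bilinear (\<Gamma> q)"
  unfolding bilinear_def \<Gamma>_def
  by (auto intro!: linearI simp: vec_eq_iff algebra_simps sum.distrib sum_distrib_left)

lemma dm_sym: "q \<in> S \<Longrightarrow> dm q a u v = dm q a v u"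
  unfolding dm_sum using dM_sym[of q] by (subst sum.swap) (simp add: mult.commute mult.left_commute)

lemma metric_compatible: "q \<in> S \<Longrightarrow> dm q a u v = m q (\<Gamma> q u a) v + m q u (\<Gamma> q v a)"
  using m_\<Gamma>[of q v u a] m_\<Gamma>[of q u v a] m_sym[of q v] dm_sym[of q] by simp

lemma \<Gamma>_differentiable:
  assumes "q \<in> S"
  shows "(\<lambda>q. \<Gamma> q u v) differentiable (at q)"
proof (rule differentiable_linear_solution[OF _ _ open_S assms invertible_M M_\<Gamma>])
  show "(\<lambda>q. M q $ i $ j) differentiable (at q)" for i j
    by (rule smooth_on_differentiable[OF M_smooth assms])
  have d: "(\<lambda>q. dM q a $ i $ j) differentiable (at q)" for i j a
    unfolding dM_def using smooth_on_differentiable[OF smooth_on_derivative[OF M_smooth] assms] by simp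
  show "(\<lambda>q. \<chi> l. \<Sum>j\<in>UNIV. \<Sum>k\<in>UNIV. cof q l j k * u $ j * v $ k) differentiable (at q)"
    unfolding cof_def by (intro differentiable_vec) (simp add: d)
qed

lemma \<Gamma>_has_derivative: "q \<in> S \<Longrightarrow> ((\<lambda>q. \<Gamma> q u v) has_derivative (\<lambda>a. d\<Gamma> q a u v)) (at q)"
  unfolding d\<Gamma>_def by (rule has_frechet_derivative[OF \<Gamma>_differentiable])

end

text \<open>\<open>E q v\<close> is the value at \<open>q\<close> of the frame field with constant
  coefficients \<open>v\<close>. Metric and brackets are constant in this frame, as they are for
  left invariant fields.\<close>

locale local_frame = local_metric_tensor S M for S :: "(real^'n) set" and M +
  fixes E :: "real^'n \<Rightarrow> real^'n \<Rightarrow> real^'n" and ip :: "real^'n \<Rightarrow> real^'n \<Rightarrow> real"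
    and br :: "real^'n \<Rightarrow> real^'n \<Rightarrow> real^'n"
  assumes E_linear: "q \<in> S \<Longrightarrow> linear (E q)"
    and E_bij: "q \<in> S \<Longrightarrow> bij (E q)"
    and E_smooth: "smooth_on S (\<lambda>q. E q v)"
    and E_metric: "q \<in> S \<Longrightarrow> m q (E q u) (E q v) = ip u v"
    and E_bracket: "q \<in> S \<Longrightarrow> fd (\<lambda>q. E q v) q (E q u)
      - fd (\<lambda>q. E q u) q (E q v) = E q (br u v)"
begin

definition DE :: "real^'n \<Rightarrow> real^'n \<Rightarrow> real^'n \<Rightarrow> real^'n" where
  "DE q v a = fd (\<lambda>q. E q v) q a"

definition covd :: "real^'n \<Rightarrow> real^'n \<Rightarrow> real^'n \<Rightarrow> real^'n" where
  "covd q u v = DE q v (E q u) + \<Gamma> q (E q v) (E q u)"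

text \<open>The Levi-Civita derivative read in the frame at one point. Independence of
  \<open>q\<close> is not visible here; it comes from
  \<open>metric_lie_algebra_unique\<close>.\<close>

definition nab_at :: "real^'n \<Rightarrow> real^'n \<Rightarrow> real^'n \<Rightarrow> real^'n" where
  "nab_at q u v = inv_into UNIV (E q) (covd q u v)"

lemma E_nab_at: "q \<in> S \<Longrightarrow> E q (nab_at q u v) = covd q u v"
  unfolding nab_at_def using E_bij by (simp add: bij_is_surj surj_f_inv_f)

lemma E_has_derivative: "q \<in> S \<Longrightarrow> ((\<lambda>q. E q v) has_derivative DE q v) (at q)"
  unfolding DE_def using smooth_on_has_derivative[OF E_smooth] by simp

lemma DE_linear: "q \<in> S \<Longrightarrow> linear (DE q v)"
  using E_has_derivative has_derivative_linear by blast

lemma DE_linear_left: assumes "q \<in> S" shows "linear (\<lambda>v. DE q v a)"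
proof (rule linearI)
  fix u v
  have "((\<lambda>q. E q (u + v)) has_derivative (\<lambda>a. DE q u a + DE q v a)) (at q)"
    by (rule has_derivative_transform_open[OF open_S assms _
          has_derivative_add[OF E_has_derivative[OF assms] E_has_derivative[OF assms]]])
      (simp add: linear_add[OF E_linear])
  then show "DE q (u + v) a = DE q u a + DE q v a"
    using has_derivative_unique[OF E_has_derivative[OF assms]] by metis
next
  fix r v
  have "((\<lambda>q. E q (r *\<^sub>R v)) has_derivative (\<lambda>a. r *\<^sub>R DE q v a)) (at q)"
    by (rule has_derivative_transform_open[OF open_S assms _
          has_derivative_scaleR_right[OF E_has_derivative[OF assms]]])
      (simp add: linear_cmul[OF E_linear])
  then show "DE q (r *\<^sub>R v) a = r *\<^sub>R DE q v a"
    using has_derivative_unique[OF E_has_derivative[OF assms]] by metis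
qed

lemma covd_bilinear: assumes "q \<in> S" shows "bilinear (covd q)"
  unfolding bilinear_def covd_def
  by (auto intro!: linearI simp: linear_add[OF DE_linear[OF assms]] linear_add[OF E_linear[OF assms]]
      linear_add[OF DE_linear_left[OF assms]] linear_cmul[OF DE_linear[OF assms]]
      linear_cmul[OF E_linear[OF assms]] linear_cmul[OF DE_linear_left[OF assms]]
      bilinear_ladd[OF \<Gamma>_bilinear] bilinear_radd[OF \<Gamma>_bilinear]
      bilinear_lmul[OF \<Gamma>_bilinear] bilinear_rmul[OF \<Gamma>_bilinear] algebra_simps)

lemma inner_space_ip: assumes "q \<in> S" shows "inner_space ip"
proof -
  interpret I: inner_space "m q" by (rule inner_space_m[OF assms])
  have E0: "E q v = 0 \<Longrightarrow> v = 0" for v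
    using E_bij[OF assms] linear_0[OF E_linear[OF assms]] by (metis bij_is_inj injD)
  show ?thesis
  proof
    show "bilinear ip"
      unfolding bilinear_def E_metric[OF assms, symmetric]
      by (auto intro!: linearI simp: linear_add[OF E_linear[OF assms]] linear_cmul[OF E_linear[OF assms]])
    show "ip u v = ip v u" for u v
      unfolding E_metric[OF assms, symmetric] by (rule m_sym[OF assms])
    show "0 < ip v v" if "v \<noteq> 0" for v
      unfolding E_metric[OF assms, symmetric] using that E0 I.ip_pos by blast
  qed
qed

text \<open>Torsion-freeness is symmetry of \<open>\<Gamma>\<close> combined with
  \<open>E_bracket\<close>; skewness results from differentiating the constant inner product of two
  frame fields.\<close>

lemma metric_lie_algebra_nab_at: assumes q: "q \<in> S" shows "metric_lie_algebra ip br (nab_at q)"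
proof -
  interpret inner_space ip by (rule inner_space_ip[OF q])
  interpret I: inner_space "m q" by (rule inner_space_m[OF q])
  have inj: "E q u = E q v \<Longrightarrow> u = v" for u v using E_bij[OF q] by (meson bij_is_inj injD)
  note lin = linear_add[OF E_linear[OF q]] linear_cmul[OF E_linear[OF q]] linear_diff[OF E_linear[OF q]]
  show ?thesis
  proof
    show "bilinear (nab_at q)"
      unfolding bilinear_def
      by (intro conjI allI linearI; rule inj) (simp_all add: lin E_nab_at[OF q]
          bilinear_ladd[OF covd_bilinear[OF q]] bilinear_radd[OF covd_bilinear[OF q]]
          bilinear_lmul[OF covd_bilinear[OF q]] bilinear_rmul[OF covd_bilinear[OF q]])
    show "nab_at q u v - nab_at q v u = br u v" for u v
      by (rule inj) (use E_bracket[OF q, of v u] \<Gamma>_sym[OF q, of "E q u" "E q v"] in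
          \<open>simp add: lin E_nab_at[OF q] covd_def DE_def\<close>)
    show "ip (nab_at q u v) w + ip v (nab_at q u w) = 0" for u v w
    proof -
      have "((\<lambda>p. m p (E p v) (E p w)) has_derivative
          (\<lambda>a. dm q a (E q v) (E q w) + m q (DE q v a) (E q w) + m q (E q v) (DE q w a))) (at q)"
        by (rule has_derivative_bilinear_family[OF open_S q m_bilinear m_has_derivative[OF q]
              E_has_derivative[OF q] E_has_derivative[OF q]])
      moreover have "((\<lambda>p. m p (E p v) (E p w)) has_derivative (\<lambda>a. 0)) (at q)"
        by (rule has_derivative_transform_open[OF open_S q _ has_derivative_const[of "ip v w"]])
          (simp add: E_metric)
      ultimately have "(\<lambda>a. dm q a (E q v) (E q w) + m q (DE q v a) (E q w) + m q (E q v) (DE q w a)) = (\<lambda>a. 0)"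
        by (rule has_derivative_unique)
      from fun_cong[OF this, of "E q u"] show ?thesis
        unfolding E_metric[OF q, symmetric] E_nab_at[OF q] covd_def metric_compatible[OF q] by simp
    qed
  qed
qed

end

locale local_frame_connection = local_frame S M E ip br + metric_lie_algebra ip br nab
  for S :: "(real^'n) set" and M E ip br nab +
  assumes E_nab: "q \<in> S \<Longrightarrow> E q (nab u v) = covd q u v"
begin

lemma DDE_sym:
  assumes "q \<in> S"
  shows "fd (\<lambda>q. DE q w a) q b = fd (\<lambda>q. DE q w b) q a"
  unfolding DE_def by (rule symmetric_second_derivative[OF open_S E_smooth assms])

text \<open>Identifies the coordinate curvature with the algebraic one. After expanding iterated
  covariant derivatives of frame fields, second derivatives of \<open>E\<close> cancel by Schwarz,
  the terms symmetric in \<open>u\<close> and \<open>v\<close> cancel, and the derivatives of the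
  direction fields are absorbed by the bracket term.\<close>

lemma Rm_frame:
  assumes q: "q \<in> S"
  shows "Rm q (E q u) (E q v) (E q w) = E q (curv u v w)"
proof -
  define H where "H w a b = fd (\<lambda>q. DE q w a) q b" for w a b
  let ?C = "\<lambda>v w a. H w (E q v) a + DE q w (DE q v a)
      + (d\<Gamma> q a (E q w) (E q v) + \<Gamma> q (DE q w a) (E q v) + \<Gamma> q (E q w) (DE q v a))"
  have H: "((\<lambda>q. DE q w a) has_derivative H w a) (at q)" for w a
    unfolding H_def DE_def using smooth_on_has_derivative[OF smooth_on_derivative[OF E_smooth] q] by simp
  have H_sym: "H w a b = H w b a" for w a b unfolding H_def by (rule DDE_sym[OF q])
  have covd': "((\<lambda>q. covd q v w) has_derivative (\<lambda>a. ?C v w a)) (at q)" for v w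
    unfolding covd_def
    by (intro has_derivative_add
        has_derivative_linear_family[OF open_S q DE_linear H E_has_derivative[OF q]]
        has_derivative_bilinear_family[OF open_S q \<Gamma>_bilinear \<Gamma>_has_derivative[OF q]
          E_has_derivative[OF q] E_has_derivative[OF q]])
  \<comment> \<open>\<open>nab v w\<close> is a constant vector, so the identity
    \<open>E_nab\<close> can be differentiated along \<open>S\<close>.\<close>
  have DE_nab: "DE q (nab v w) a = ?C v w a" for v w a
  proof -
    have "((\<lambda>q. E q (nab v w)) has_derivative (\<lambda>a. ?C v w a)) (at q)"
      by (rule has_derivative_transform_open[OF open_S q _ covd']) (simp add: E_nab)
    from has_derivative_unique[OF E_has_derivative[OF q] this] show ?thesis by (rule fun_cong)
  qed
  have EE: "E q (nab u (nab v w)) = H w (E q v) (E q u) + DE q w (DE q v (E q u))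
      + d\<Gamma> q (E q u) (E q w) (E q v) + \<Gamma> q (DE q w (E q u)) (E q v) + \<Gamma> q (E q w) (DE q v (E q u))
      + \<Gamma> q (DE q w (E q v)) (E q u) + \<Gamma> q (\<Gamma> q (E q w) (E q v)) (E q u)" for u v w
    unfolding E_nab[OF q, of u] covd_def DE_nab E_nab[OF q, of v]
    by (simp add: bilinear_ladd[OF \<Gamma>_bilinear])
  have EB: "E q (nab (br u v) w) = DE q w (DE q v (E q u)) - DE q w (DE q u (E q v))
      + \<Gamma> q (E q w) (DE q v (E q u)) - \<Gamma> q (E q w) (DE q u (E q v))"
    unfolding E_nab[OF q] covd_def E_bracket[OF q, symmetric] DE_def[symmetric]
    by (simp add: linear_diff[OF DE_linear[OF q]] bilinear_rsub[OF \<Gamma>_bilinear])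
  show ?thesis
    unfolding curv_def Rm_def linear_diff[OF E_linear[OF q]] EE EB
    using H_sym[of w "E q u" "E q v"] by (simp add: algebra_simps)
qed

end

text \<open>Uniqueness by Koszul is the reason why the frame coefficients of the connection agree at
  all points and in all charts.\<close>

lemma metric_lie_algebra_unique:
  assumes "metric_lie_algebra ip br nab" "metric_lie_algebra ip br nab'"
  shows "nab = nab'"
proof (intro ext)
  fix u v
  interpret A: metric_lie_algebra ip br nab by fact
  interpret B: metric_lie_algebra ip br nab' by fact
  show "nab u v = nab' u v" by (rule A.ip_eqI) (use A.koszul B.koszul in \<open>smt (verit)\<close>)
qed

section \<open>Metrics that are functions of a Riemannian metric and a one-form\<close>

lemma eventually_line_in_open:
  fixes w :: "'a::real_normed_vector"
  assumes "open T" "w \<in> T"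
  shows "eventually (\<lambda>s::real. w + s *\<^sub>R u \<in> T) (nhds 0)"
proof -
  have "open ((\<lambda>s::real. w + s *\<^sub>R u) -` T)"
    by (rule open_vimage[OF assms(1)]) (intro continuous_intros)
  then show ?thesis using assms(2) eventually_nhds_in_open[of _ "0::real"] by fastforce
qed

lemma bilinear_axis_expansion:
  fixes f :: "real^'n \<Rightarrow> real^'m \<Rightarrow> real"
  assumes "bilinear f"
  shows "f x y = (\<Sum>i\<in>UNIV. \<Sum>j\<in>UNIV. x $ i * y $ j * f (axis i 1) (axis j 1))"
proof -
  have l: "linear (\<lambda>x. f x y)" "linear (f x)" for x y using assms unfolding bilinear_def by auto
  have "f x y = (\<Sum>i\<in>UNIV. x $ i * f (axis i 1) y)"
    by (subst linear_axis_expansion[OF l(1)]) simp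
  also have "\<dots> = (\<Sum>i\<in>UNIV. x $ i * (\<Sum>j\<in>UNIV. y $ j * f (axis i 1) (axis j 1)))"
    by (rule sum.cong[OF refl], subst linear_axis_expansion[OF l(2)]) simp
  finally show ?thesis by (simp add: sum_distrib_left mult.assoc)
qed

text \<open>Common frame for both metrics: the squared metric is
  \<open>L(\<alpha>\<^sup>2, \<beta>)\<close>, with partial derivatives \<open>L1\<close>,
  \<open>L2\<close> and so on. \<open>hom0\<close>, \<open>hom1\<close>, \<open>hom2\<close> are the
  Euler relations for \<open>L\<close>, \<open>L1\<close>, \<open>L2\<close> of weights 2, 0, 1,
  where the first argument has weight 2 and the second weight 1.\<close>

locale local_alpha_beta_base = local_frame_connection S M E ip br nab
  for S :: "(real^'n) set" and M E ip br nab +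
  fixes f :: "real^'n \<Rightarrow> real^'n \<Rightarrow> real" and \<xi> :: "real^'n" and V :: "(real \<times> real) set"
    and L L1 L2 L11 L12 L22 :: "real \<times> real \<Rightarrow> real"
  assumes V_open: "open V"
    and f_sq: "q \<in> S \<Longrightarrow> (m q w w, m q (E q \<xi>) w) \<in> V \<Longrightarrow> (f q w)\<^sup>2 = L (m q w w, m q (E q \<xi>) w)"
    and L_D: "x \<in> V \<Longrightarrow> (L has_derivative (\<lambda>h. L1 x * fst h + L2 x * snd h)) (at x)"
    and L1_D: "x \<in> V \<Longrightarrow> (L1 has_derivative (\<lambda>h. L11 x * fst h + L12 x * snd h)) (at x)"
    and L2_D: "x \<in> V \<Longrightarrow> (L2 has_derivative (\<lambda>h. L12 x * fst h + L22 x * snd h)) (at x)"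
    and L11_d: "x \<in> V \<Longrightarrow> L11 differentiable (at x)"
    and L12_d: "x \<in> V \<Longrightarrow> L12 differentiable (at x)"
    and L22_d: "x \<in> V \<Longrightarrow> L22 differentiable (at x)"
    and hom0: "x \<in> V \<Longrightarrow> 2 * fst x * L1 x + snd x * L2 x = 2 * L x"
    and hom1: "x \<in> V \<Longrightarrow> 2 * fst x * L11 x + snd x * L12 x = 0"
    and hom2: "x \<in> V \<Longrightarrow> 2 * fst x * L12 x + snd x * L22 x = L2 x"
    and L2_nz: "x \<in> V \<Longrightarrow> L2 x \<noteq> 0"
begin

definition B :: "real^'n \<Rightarrow> real^'n \<Rightarrow> real" where "B q w = m q (E q \<xi>) w"

definition AB :: "real^'n \<Rightarrow> real^'n \<Rightarrow> real \<times> real" where "AB q w = (m q w w, B q w)"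

text \<open>Half the second fibre derivative of \<open>L (AB q w)\<close>, expanded by the chain
  rule.\<close>

definition gt :: "real^'n \<Rightarrow> real^'n \<Rightarrow> real^'n \<Rightarrow> real^'n \<Rightarrow> real" where
  "gt q w u v = L1 (AB q w) * m q u v + 2 * L11 (AB q w) * (m q w u * m q w v)
     + L12 (AB q w) * (B q u * m q w v + m q w u * B q v) + 1/2 * L22 (AB q w) * (B q u * B q v)"

lemmas m_simps = bilinear_ladd[OF m_bilinear] bilinear_radd[OF m_bilinear]
  bilinear_lmul[OF m_bilinear] bilinear_rmul[OF m_bilinear]

lemma B_simps: "B q (u + v) = B q u + B q v" "B q (r *\<^sub>R u) = r * B q u"
  unfolding B_def by (simp_all add: m_simps)

lemma gt_bilinear: "bilinear (gt q w)"
  unfolding bilinear_def gt_def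
  by (auto intro!: linearI simp: m_simps B_simps algebra_simps)

lemma gt_sym: "q \<in> S \<Longrightarrow> gt q w u v = gt q w v u"
  unfolding gt_def using m_sym[of q u v] by (simp add: algebra_simps)

lemma m_fibre_D: "((\<lambda>w. m q (x w) (y w)) has_derivative (\<lambda>a. m q (x' a) (y w) + m q (x w) (y' a))) (at w)"
  if "(x has_derivative x') (at w)" "(y has_derivative y') (at w)" for x y :: "real^'n \<Rightarrow> real^'n"
proof -
  have "((\<lambda>w. m q (x w) (y w)) has_derivative (\<lambda>a. 0 + m q (x' a) (y w) + m q (x w) (y' a))) (at w)"
    by (rule has_derivative_bilinear_family[OF open_UNIV UNIV_I m_bilinear has_derivative_const that])
  then show ?thesis by simp
qed

lemma m_self_fibre_D: assumes "q \<in> S" shows "((\<lambda>w. m q w w) has_derivative (\<lambda>a. 2 * m q w a)) (at w)"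
  using m_fibre_D[OF has_derivative_ident has_derivative_ident, of q w] m_sym[OF assms, of _ w] by simp

lemma B_fibre_D: "((\<lambda>w. B q w) has_derivative B q) (at w)"
  unfolding B_def using m_fibre_D[OF has_derivative_const has_derivative_ident, of q _ w]
  by (simp add: bilinear_lzero[OF m_bilinear])

lemma m_left_fibre_D: "((\<lambda>w. m q w v) has_derivative (\<lambda>a. m q a v)) (at w)"
  using m_fibre_D[OF has_derivative_ident has_derivative_const, of q v w]
  by (simp add: bilinear_rzero[OF m_bilinear])

lemma AB_fibre_D: "q \<in> S \<Longrightarrow> ((\<lambda>w. AB q w) has_derivative (\<lambda>a. (2 * m q w a, B q a))) (at w)"
  unfolding AB_def by (intro has_derivative_Pair m_self_fibre_D B_fibre_D)

lemma chain_fibre: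
  assumes "q \<in> S" "(K has_derivative (\<lambda>h. K1 * fst h + K2 * snd h)) (at (AB q w))"
  shows "((\<lambda>w. K (AB q w)) has_derivative (\<lambda>a. K1 * (2 * m q w a) + K2 * B q a)) (at w)"
  using has_derivative_compose[OF AB_fibre_D[OF assms(1)] assms(2)] by simp

definition fibre :: "real^'n \<Rightarrow> (real^'n) set" where
  "fibre q = {w. AB q w \<in> V}"

definition base :: "real^'n \<Rightarrow> (real^'n) set" where
  "base w = {q \<in> S. AB q w \<in> V}"

lemma fibre_open: assumes "q \<in> S" shows "open (fibre q)"
proof -
  have "continuous_on UNIV (\<lambda>w. AB q w)"
    using AB_fibre_D[OF assms] by (meson continuous_at_imp_continuous_on has_derivative_continuous)
  then have "open ((\<lambda>w. AB q w) -` V)" using V_open open_vimage by blast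
  then show ?thesis unfolding fibre_def vimage_def .
qed

lemma B_base_D:
  assumes "q \<in> S"
  shows "((\<lambda>q. B q w) has_derivative (\<lambda>a. dm q a (E q \<xi>) w + m q (DE q \<xi> a) w)) (at q)"
  unfolding B_def
  using has_derivative_bilinear_family[OF open_S assms m_bilinear m_has_derivative[OF assms]
      E_has_derivative[OF assms] has_derivative_const, of \<xi> w]
  by (simp add: bilinear_rzero[OF m_bilinear])

lemma AB_base_D:
  "q \<in> S \<Longrightarrow> ((\<lambda>q. AB q w) has_derivative (\<lambda>a. (dm q a w w, dm q a (E q \<xi>) w + m q (DE q \<xi> a) w))) (at q)"
  unfolding AB_def by (intro has_derivative_Pair m_has_derivative B_base_D)

lemma base_open: "open (base w)"
proof -
  have "continuous_on S (\<lambda>q. AB q w)"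
    using AB_base_D by (meson continuous_at_imp_continuous_on has_derivative_continuous)
  then have "open (S \<inter> (\<lambda>q. AB q w) -` V)" using V_open open_S continuous_open_preimage by blast
  moreover have "base w = S \<inter> (\<lambda>q. AB q w) -` V" unfolding base_def by blast
  ultimately show ?thesis by simp
qed

lemma f_sq': "q \<in> S \<Longrightarrow> w \<in> fibre q \<Longrightarrow> (f q w)\<^sup>2 = L (AB q w)"
  unfolding fibre_def AB_def B_def using f_sq by simp

lemma f_sq_fibre_D:
  assumes "q \<in> S" "w \<in> fibre q"
  shows "((\<lambda>w. (f q w)\<^sup>2) has_derivative (\<lambda>a. L1 (AB q w) * (2 * m q w a) + L2 (AB q w) * B q a)) (at w)"
  by (rule has_derivative_transform_open[OF fibre_open[OF assms(1)] assms(2) f_sq'[OF assms(1), symmetric]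
        chain_fibre[OF assms(1) L_D]])
    (use assms in \<open>auto simp: fibre_def\<close>)

lemma fundamental_tensor_eq:
  assumes q: "q \<in> S" and w: "w \<in> fibre q"
  shows "fundamental_tensor f q w u v = gt q w u v"
proof -
  define \<Phi> where "\<Phi> z = L1 (AB q z) * (2 * m q z v) + L2 (AB q z) * B q v" for z
  \<comment> \<open>The inner derivative has its closed form only where \<open>w + s u\<close> stays
    in the open set \<open>fibre q\<close>; near \<open>s = 0\<close> is enough for the outer
    derivative.\<close>
  have "eventually (\<lambda>s. deriv (\<lambda>t. (f q (w + s *\<^sub>R u + t *\<^sub>R v))\<^sup>2) 0 = \<Phi> (w + s *\<^sub>R u)) (nhds 0)"
    by (rule eventually_mono[OF eventually_line_in_open[OF fibre_open[OF q] w, of u]])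
      (simp add: \<Phi>_def deriv_line[OF f_sq_fibre_D[OF q]])
  then have "deriv (\<lambda>s. deriv (\<lambda>t. (f q (w + s *\<^sub>R u + t *\<^sub>R v))\<^sup>2) 0) 0 = deriv (\<lambda>s. \<Phi> (w + s *\<^sub>R u)) 0"
    by (rule deriv_cong_ev) simp
  moreover have "(\<Phi> has_derivative (\<lambda>a.
      (L1 (AB q w) * (2 * m q a v) + (L11 (AB q w) * (2 * m q w a) + L12 (AB q w) * B q a) * (2 * m q w v))
      + (L12 (AB q w) * (2 * m q w a) + L22 (AB q w) * B q a) * B q v)) (at w)"
    unfolding \<Phi>_def
    by (intro has_derivative_add has_derivative_mult has_derivative_mult_left has_derivative_mult_right
        chain_fibre[OF q] L1_D L2_D m_left_fibre_D) (use w in \<open>auto simp: fibre_def\<close>)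
  ultimately show ?thesis
    unfolding fundamental_tensor_def gt_def by (simp add: deriv_line algebra_simps)
qed

lemma fundamental_matrix_eq:
  "q \<in> S \<Longrightarrow> w \<in> fibre q \<Longrightarrow> fundamental_matrix f q w $ i $ j = gt q w (axis i 1) (axis j 1)"
  unfolding fundamental_matrix_def by (simp add: fundamental_tensor_eq)

lemma fundamental_matrix_mult:
  assumes "q \<in> S" "w \<in> fibre q"
  shows "(fundamental_matrix f q w *v v) $ i = gt q w (axis i 1) v"
  using linear_axis_expansion[of "gt q w (axis i 1)" v] gt_bilinear[of q w]
  by (simp add: matrix_vector_mult_def fundamental_matrix_eq[OF assms] bilinear_def mult.commute)

lemma fundamental_matrix_quadratic:
  assumes "q \<in> S" "w \<in> fibre q"
  shows "v \<bullet> (fundamental_matrix f q w *v v) = gt q w v v"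
proof -
  have "v \<bullet> (fundamental_matrix f q w *v v) = (\<Sum>i\<in>UNIV. v $ i * gt q w (axis i 1) v)"
    by (simp add: inner_vec_def fundamental_matrix_mult[OF assms])
  also have "\<dots> = gt q w v v"
    using linear_axis_expansion[of "\<lambda>u. gt q w u v" v] gt_bilinear[of q w] by (simp add: bilinear_def)
  finally show ?thesis .
qed

end

section \<open>Consequences of equality with the Levi-Civita connection\<close>

locale local_alpha_beta = local_alpha_beta_base S M E ip br nab f \<xi> V L L1 L2 L11 L12 L22
  for S :: "(real^'n) set" and M E ip br nab f \<xi> V L L1 L2 L11 L12 L22 +
  assumes gt_pos: "q \<in> S \<Longrightarrow> w \<in> fibre q \<Longrightarrow> u \<noteq> 0 \<Longrightarrow> gt q w u u > 0"
    and chern: "q \<in> S \<Longrightarrow> w \<in> fibre q \<Longrightarrow> chern_coeff f q w i j k = LC q i j k"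
begin

lemma fundamental_matrix_invertible:
  assumes "q \<in> S" "w \<in> fibre q"
  shows "invertible (fundamental_matrix f q w)"
  by (rule invertible_posdef) (simp add: fundamental_matrix_quadratic[OF assms] gt_pos[OF assms])

text \<open>With one argument equal to the base vector, the second derivatives of \<open>L\<close>
  appear exactly in the combinations evaluated by \<open>hom1\<close> and
  \<open>hom2\<close>.\<close>

lemma gt_left_self:
  assumes "q \<in> S" "w \<in> fibre q"
  shows "gt q w w v = L1 (AB q w) * m q w v + 1/2 * L2 (AB q w) * B q v"
proof -
  let ?x = "AB q w"
  have x: "?x \<in> V" using assms by (simp add: fibre_def)
  have "gt q w w v = L1 ?x * m q w v + (2 * fst ?x * L11 ?x + snd ?x * L12 ?x) * m q w v
      + 1/2 * (2 * fst ?x * L12 ?x + snd ?x * L22 ?x) * B q v"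
    unfolding gt_def by (simp add: AB_def algebra_simps)
  then show ?thesis unfolding hom1[OF x] hom2[OF x] by simp
qed

lemma gt_self_self:
  assumes "q \<in> S" "w \<in> fibre q"
  shows "gt q w w w = (f q w)\<^sup>2"
  using hom0[of "AB q w"] assms
  by (simp add: gt_left_self[OF assms] f_sq'[OF assms] fibre_def) (simp add: AB_def algebra_simps)

lemma gt_fibre_differentiable:
  assumes "q \<in> S" "w \<in> fibre q"
  shows "(\<lambda>w. gt q w u v) differentiable (at w)"
proof -
  have K: "(\<lambda>w. K (AB q w)) differentiable (at w)" if "K differentiable (at (AB q w))"
    for K :: "real \<times> real \<Rightarrow> real"
    using has_derivative_compose[OF AB_fibre_D[OF assms(1)]] that unfolding differentiable_def by blast
  have x: "AB q w \<in> V" using assms by (simp add: fibre_def)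
  have L1: "L1 differentiable (at (AB q w))" using L1_D[OF x] unfolding differentiable_def by blast
  have mm: "(\<lambda>w. m q w v) differentiable (at w)" for v
    using m_left_fibre_D unfolding differentiable_def by blast
  show ?thesis
    unfolding gt_def by (simp add: K L1 L11_d[OF x] L12_d[OF x] L22_d[OF x] mm)
qed

lemma gt_base_differentiable:
  assumes "q \<in> base w"
  shows "(\<lambda>q. gt q w u v) differentiable (at q)"
proof -
  have q: "q \<in> S" and x: "AB q w \<in> V" using assms by (auto simp: base_def)
  have K: "(\<lambda>q. K (AB q w)) differentiable (at q)" if "K differentiable (at (AB q w))"
    for K :: "real \<times> real \<Rightarrow> real"
    using has_derivative_compose[OF AB_base_D[OF q]] that unfolding differentiable_def by blast
  have L1: "L1 differentiable (at (AB q w))" using L1_D[OF x] unfolding differentiable_def by blast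
  have mm: "(\<lambda>q. m q u v) differentiable (at q)" "(\<lambda>q. B q v) differentiable (at q)" for u v
    using m_has_derivative[OF q] B_base_D[OF q] unfolding differentiable_def by blast+
  show ?thesis
    unfolding gt_def by (simp add: K L1 L11_d[OF x] L12_d[OF x] L22_d[OF x] mm)
qed

text \<open>Contracting with \<open>y\<close> twice kills the vertical derivatives of the fundamental tensor, so the
  nonlinear connection drops out of the defining equation of the Chern connection.\<close>

lemma gt_vertical_self:
  assumes q: "q \<in> S" and w: "w \<in> fibre q"
  shows "fd (\<lambda>z. gt q z w w) w a = 0"
proof -
  define D where "D u v = fd (\<lambda>z. gt q z u v) w" for u v
  have D: "((\<lambda>z. gt q z u v) has_derivative D u v) (at w)" for u v
    unfolding D_def by (rule has_frechet_derivative[OF gt_fibre_differentiable[OF q w]])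
  \<comment> \<open>In the product rule for \<open>gt q z z z\<close>, the two terms differentiating
    the arguments already account for the whole derivative of the squared metric, by
    \<open>gt_left_self\<close>; nothing remains for the vertical derivative.\<close>
  have "((\<lambda>z. gt q z z z) has_derivative (\<lambda>a. D w w a + gt q w a w + gt q w w a)) (at w)"
    by (rule has_derivative_bilinear_family[OF fibre_open[OF q] w gt_bilinear D
          has_derivative_ident has_derivative_ident])
  then have "((\<lambda>z. (f q z)\<^sup>2) has_derivative (\<lambda>a. D w w a + gt q w a w + gt q w w a)) (at w)"
    by (rule has_derivative_transform_open[OF fibre_open[OF q] w, rotated]) (rule gt_self_self[OF q])
  from fun_cong[OF has_derivative_unique[OF this f_sq_fibre_D[OF q w]], of a]
  show ?thesis unfolding gt_sym[OF q, of w a w] gt_left_self[OF q w] D_def by simp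
qed

text \<open>Says that the squared metric is constant along Levi-Civita horizontal directions.
  Lowering an index in \<open>chern\<close> expresses the horizontal derivative of the fundamental
  tensor through \<open>LC\<close>; contracting twice with \<open>y\<close> turns it into the plain
  derivative of the squared metric.\<close>

lemma partial_f_sq:
  assumes q: "q \<in> base y"
  shows "partial k (\<lambda>q. (f q y)\<^sup>2) q = 2 * gt q y y (\<Gamma> q y (axis k 1))"
proof -
  have S: "q \<in> S" and y: "y \<in> fibre q" using q by (auto simp: base_def fibre_def)
  let ?Q = "\<lambda>T. \<Sum>h\<in>UNIV. \<Sum>j\<in>UNIV. y $ h * y $ j * T h j"
  define P where "P k l j = horizontal_partial f k (\<lambda>q w. fundamental_matrix f q w $ l $ j) q y" for k l j
  define Gq where "Gq u v = fd (\<lambda>q. gt q y u v) q" for u v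
  define Gy where "Gy u v = fd (\<lambda>w. gt q w u v) y" for u v
  have Gq: "((\<lambda>q. gt q y u v) has_derivative Gq u v) (at q)" for u v
    unfolding Gq_def by (rule has_frechet_derivative[OF gt_base_differentiable[OF q]])
  have Gy: "((\<lambda>w. gt q w u v) has_derivative Gy u v) (at y)" for u v
    unfolding Gy_def by (rule has_frechet_derivative[OF gt_fibre_differentiable[OF S y]])
  let ?e = "\<lambda>i. axis i 1 :: real^'n"
  have P: "P k l j = Gq (?e l) (?e j) (?e k)
      - (\<Sum>i\<in>UNIV. nonlinear_connection f q y i k * Gy (?e l) (?e j) (?e i))" for k l j
  proof -
    have "((\<lambda>q. fundamental_matrix f q y $ l $ j) has_derivative Gq (?e l) (?e j)) (at q)"
      by (rule has_derivative_transform_open[OF base_open q _ Gq])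
        (auto simp: base_def fibre_def fundamental_matrix_eq)
    moreover have "((\<lambda>w. fundamental_matrix f q w $ l $ j) has_derivative Gy (?e l) (?e j)) (at y)"
      by (rule has_derivative_transform_open[OF fibre_open[OF S] y _ Gy])
        (auto simp: fundamental_matrix_eq[OF S])
    ultimately show ?thesis
      unfolding P_def horizontal_partial_def by (simp add: partial_eq_frechet)
  qed
  have Gq_sym: "Gq u v = Gq v u" for u v
  proof -
    have "((\<lambda>q. gt q y u v) has_derivative Gq v u) (at q)"
      by (rule has_derivative_transform_open[OF base_open q _ Gq]) (auto simp: base_def gt_sym)
    then show ?thesis using has_derivative_unique[OF Gq] by blast
  qed
  have Gy_sym: "Gy u v = Gy v u" for u v
    unfolding Gy_def using gt_sym[OF S] by simp
  have P_sym: "P k l j = P k j l" for k l j unfolding P using Gq_sym Gy_sym by simp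
  \<comment> \<open>The Chern coefficients with lowered index.\<close>
  define c where "c j k = (\<chi> l. 1/2 * (P k l j + P j l k - P l j k))" for j k
  have c: "c j k = fundamental_matrix f q y *v (\<chi> i. LC q i j k)" for j k
  proof -
    have "(\<chi> i. LC q i j k) = matrix_inv (fundamental_matrix f q y) *v c j k"
      using chern[OF S, of y] y
      unfolding chern_coeff_def c_def P_def
      by (simp add: vec_eq_iff matrix_vector_mult_def sum_distrib_left mult.left_commute)
    then show ?thesis
      using matrix_inv_mult_vec[OF fundamental_matrix_invertible[OF S y]] by simp
  qed
  have c': "c j k $ h = gt q y (?e h) (\<chi> i. LC q i j k)" for j k h
    unfolding c fundamental_matrix_mult[OF S y] ..
  \<comment> \<open>Metric compatibility recovered from the coefficients of the first kind: adding
    the two with \<open>h\<close> and \<open>j\<close> exchanged cancels all terms except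
    \<open>P k h j\<close>.\<close>
  have PC: "P k h j = gt q y (?e h) (\<chi> i. LC q i j k) + gt q y (?e j) (\<chi> i. LC q i h k)" for h j
    unfolding c'[symmetric] c_def using P_sym[of k h j] P_sym[of h j k] P_sym[of j h k] by (simp add: field_simps)
  have lin: "linear (\<lambda>u. gt q y u v)" "linear (gt q y u)" for u v using gt_bilinear[of q y] unfolding bilinear_def by auto
  have \<Gamma>y: "\<Gamma> q y (?e k) = (\<Sum>j\<in>UNIV. y $ j *\<^sub>R (\<chi> i. LC q i j k))"
    unfolding \<Gamma>_def by (simp add: vec_eq_iff axis_def if_distrib cong: if_cong) (simp add: mult.commute)
  have one: "?Q (\<lambda>h j. gt q y (?e h) (\<chi> i. LC q i j k)) = gt q y y (\<Gamma> q y (?e k))"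
  proof -
    have "gt q y y (\<Gamma> q y (?e k)) = (\<Sum>h\<in>UNIV. y $ h * gt q y (?e h) (\<Gamma> q y (?e k)))"
      by (subst linear_axis_expansion[OF lin(1)]) simp
    also have "\<dots> = (\<Sum>h\<in>UNIV. y $ h * (\<Sum>j\<in>UNIV. y $ j * gt q y (?e h) (\<chi> i. LC q i j k)))"
      unfolding \<Gamma>y by (simp add: linear_sum[OF lin(2)] linear_cmul[OF lin(2)])
    finally show ?thesis by (simp add: sum_distrib_left mult.assoc)
  qed
  have "?Q (P k) =
      ?Q (\<lambda>h j. gt q y (?e h) (\<chi> i. LC q i j k))
      + ?Q (\<lambda>h j. gt q y (?e j) (\<chi> i. LC q i h k))"
    unfolding PC by (simp add: distrib_left sum.distrib)
  also have "?Q (\<lambda>h j. gt q y (?e j) (\<chi> i. LC q i h k)) =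
      ?Q (\<lambda>h j. gt q y (?e h) (\<chi> i. LC q i j k))"
    by (subst sum.swap) (simp add: mult.commute mult.left_commute)
  finally have rhs: "?Q (P k) = 2 * gt q y y (\<Gamma> q y (?e k))"
    unfolding one by simp
  have Gqyy: "?Q (\<lambda>h j. Gq (?e h) (?e j) a) = Gq y y a" for a
  proof -
    have "((\<lambda>q. \<Sum>h\<in>UNIV. \<Sum>j\<in>UNIV. y $ h * y $ j * gt q y (?e h) (?e j)) has_derivative
        (\<lambda>a. \<Sum>h\<in>UNIV. \<Sum>j\<in>UNIV. y $ h * y $ j * Gq (?e h) (?e j) a)) (at q)"
      by (intro has_derivative_sum has_derivative_mult_right Gq)
    then have "((\<lambda>q. gt q y y y) has_derivative
        (\<lambda>a. \<Sum>h\<in>UNIV. \<Sum>j\<in>UNIV. y $ h * y $ j * Gq (?e h) (?e j) a)) (at q)"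
      unfolding bilinear_axis_expansion[OF gt_bilinear, symmetric] .
    from has_derivative_unique[OF this Gq] show ?thesis by (rule fun_cong)
  qed
  have Gyyy: "?Q (\<lambda>h j. Gy (?e h) (?e j) a) = Gy y y a" for a
  proof -
    have "((\<lambda>w. \<Sum>h\<in>UNIV. \<Sum>j\<in>UNIV. y $ h * y $ j * gt q w (?e h) (?e j)) has_derivative
        (\<lambda>a. \<Sum>h\<in>UNIV. \<Sum>j\<in>UNIV. y $ h * y $ j * Gy (?e h) (?e j) a)) (at y)"
      by (intro has_derivative_sum has_derivative_mult_right Gy)
    then have "((\<lambda>w. gt q w y y) has_derivative
        (\<lambda>a. \<Sum>h\<in>UNIV. \<Sum>j\<in>UNIV. y $ h * y $ j * Gy (?e h) (?e j) a)) (at y)"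
      unfolding bilinear_axis_expansion[OF gt_bilinear, symmetric] .
    from has_derivative_unique[OF this Gy] show ?thesis by (rule fun_cong)
  qed
  have "?Q (P k) = Gq y y (?e k)
      - (\<Sum>h\<in>UNIV. \<Sum>j\<in>UNIV. \<Sum>i\<in>UNIV. nonlinear_connection f q y i k * (y $ h * y $ j * Gy (?e h) (?e j) (?e i)))"
    unfolding P Gqyy[symmetric]
    by (simp add: right_diff_distrib sum_subtractf sum_distrib_left mult.left_commute)
  also have "(\<Sum>h\<in>UNIV. \<Sum>j\<in>UNIV. \<Sum>i\<in>UNIV. nonlinear_connection f q y i k * (y $ h * y $ j * Gy (?e h) (?e j) (?e i)))
    = (\<Sum>i\<in>UNIV. nonlinear_connection f q y i k * Gy y y (?e i))"
    unfolding Gyyy[symmetric] sum_distrib_left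
    by (subst (2) sum.swap, subst sum.swap) simp
  also have "\<dots> = 0" unfolding Gy_def by (simp add: gt_vertical_self[OF S y])
  finally have lhs: "?Q (P k) = Gq y y (?e k)" by simp
  have "((\<lambda>q. (f q y)\<^sup>2) has_derivative Gq y y) (at q)"
    by (rule has_derivative_transform_open[OF base_open q _ Gq])
      (auto simp: base_def fibre_def gt_self_self)
  then show ?thesis using partial_eq_frechet lhs rhs by metis
qed

text \<open>The derivative of \<open>L(\<alpha>\<^sup>2, \<beta>)\<close> is computed directly and
  by \<open>partial_f_sq\<close>. Metric compatibility cancels the \<open>\<alpha>\<close> terms,
  and \<open>L2 \<noteq> 0\<close> leaves the covariant derivative of the field, paired with
  \<open>y\<close>.\<close>

lemma field_parallel_at:
  assumes q: "q \<in> base y"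
  shows "m q (DE q \<xi> (axis k 1) + \<Gamma> q (E q \<xi>) (axis k 1)) y = 0"
proof -
  have S: "q \<in> S" and y: "y \<in> fibre q" and x: "AB q y \<in> V" using q by (auto simp: base_def fibre_def)
  let ?a = "axis k 1 :: real^'n"
  have "((\<lambda>q. L (AB q y)) has_derivative (\<lambda>a. L1 (AB q y) * dm q a y y
      + L2 (AB q y) * (dm q a (E q \<xi>) y + m q (DE q \<xi> a) y))) (at q)"
    using has_derivative_compose[OF AB_base_D[OF S] L_D[OF x]] by simp
  then have "((\<lambda>q. (f q y)\<^sup>2) has_derivative (\<lambda>a. L1 (AB q y) * dm q a y y
      + L2 (AB q y) * (dm q a (E q \<xi>) y + m q (DE q \<xi> a) y))) (at q)"
    by (rule has_derivative_transform_open[OF base_open q, rotated])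
      (auto simp: base_def fibre_def f_sq')
  from partial_eq_frechet[OF this, of k] partial_f_sq[OF q, of k]
  have "2 * (L1 (AB q y) * m q y (\<Gamma> q y ?a) + 1/2 * L2 (AB q y) * B q (\<Gamma> q y ?a)) =
      L1 (AB q y) * dm q ?a y y + L2 (AB q y) * (dm q ?a (E q \<xi>) y + m q (DE q \<xi> ?a) y)"
    unfolding gt_left_self[OF S y] by simp
  then have "L2 (AB q y) * (m q (DE q \<xi> ?a) y + m q (\<Gamma> q (E q \<xi>) ?a) y) = 0"
    unfolding metric_compatible[OF S] B_def m_sym[OF S, of "\<Gamma> q y ?a" y] by (simp add: algebra_simps)
  then show ?thesis using L2_nz[OF x] by (simp add: m_simps)
qed

text \<open>\<open>field_parallel_at\<close> holds for all \<open>y\<close> in a nonempty open set.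
  If \<open>z\<close> is the covariant derivative, \<open>y\<close> and \<open>y + (d/2) z\<close>
  are both orthogonal to \<open>z\<close>, hence so is \<open>z\<close>.\<close>

lemma field_parallel:
  assumes "q \<in> S" "y \<in> fibre q"
  shows "nab u \<xi> = 0"
proof -
  interpret I: inner_space "m q" by (rule inner_space_m[OF assms(1)])
  have z: "DE q \<xi> (axis k 1) + \<Gamma> q (E q \<xi>) (axis k 1) = 0" (is "?z = 0") for k
  proof -
    have base: "m q ?z w = 0" if "w \<in> fibre q" for w
      by (rule field_parallel_at) (use that assms(1) in \<open>simp add: base_def fibre_def\<close>)
    have "eventually (\<lambda>s. y + s *\<^sub>R ?z \<in> fibre q) (nhds 0)"
      by (rule eventually_line_in_open[OF fibre_open[OF assms(1)] assms(2)])
    then obtain d where "d > 0" "\<And>s. dist s 0 < d \<Longrightarrow> y + s *\<^sub>R ?z \<in> fibre q"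
      unfolding eventually_nhds_metric by blast
    then have "y + (d/2) *\<^sub>R ?z \<in> fibre q" by simp
    then have "m q ?z (y + (d/2) *\<^sub>R ?z) = 0" by (rule base)
    then have "(d/2) * m q ?z ?z = 0"
      using base[OF assms(2)] bilinear_radd[OF m_bilinear, of q ?z] bilinear_rmul[OF m_bilinear, of q ?z]
      by (metis add_0 real_scaleR_def)
    then have "m q ?z ?z = 0" using \<open>d > 0\<close> by (metis half_gt_zero less_numeral_extra(3) mult_eq_0_iff)
    then show ?thesis using I.ip_self_eq_0 by blast
  qed
  have "covd q u \<xi> = 0"
  proof -
    have "linear (\<lambda>a. DE q \<xi> a + \<Gamma> q (E q \<xi>) a)"
      using \<Gamma>_bilinear[of q] by (intro linear_compose_add DE_linear assms) (simp add: bilinear_def)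
    from linear_axis_expansion[OF this, of "E q u"] show ?thesis unfolding covd_def z by simp
  qed
  then have "E q (nab u \<xi>) = E q 0"
    using E_nab[OF assms(1)] linear_0[OF E_linear[OF assms(1)]] by simp
  then show ?thesis using E_bij[OF assms(1)] by (meson bij_is_inj injD)
qed

text \<open>The Chern coefficients equal \<open>LC\<close> on an open set and so do not depend on
  the fibre variable there. Horizontal derivatives become ordinary ones, and what remains is
  reordering of index sums.\<close>

lemma riemann_curvature_eq:
  assumes q: "q \<in> base y"
  shows "riemann_curvature f q y u = Rm q u y y"
proof -
  have S: "q \<in> S" and y: "y \<in> fibre q" using q by (auto simp: base_def fibre_def)
  let ?T = "\<lambda>X. \<Sum>j\<in>UNIV. \<Sum>k\<in>UNIV. \<Sum>l\<in>UNIV. X j k l :: real"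
  let ?e = "\<lambda>i. axis i 1 :: real^'n"
  have LC_\<Gamma>: "LC p i j l = \<Gamma> p (?e j) (?e l) $ i" for p i j l
  proof -
    have "\<Gamma> p (?e j) (?e l) $ i =
        (\<Sum>a\<in>UNIV. \<Sum>b\<in>UNIV. if b = l then if a = j then LC p i a b else 0 else 0)"
      unfolding \<Gamma>_def vec_lambda_beta by (intro sum.cong refl) (simp add: axis_def)
    then show ?thesis by simp
  qed
  have LC_D: "((\<lambda>q. LC q i j l) has_derivative (\<lambda>a. d\<Gamma> q a (?e j) (?e l) $ i)) (at q)" for i j l
    unfolding LC_\<Gamma> by (rule bounded_linear.has_derivative[OF bounded_linear_vec_nth \<Gamma>_has_derivative[OF S]])
  have hp: "horizontal_partial f k (\<lambda>q w. chern_coeff f q w i j l) q y = d\<Gamma> q (?e k) (?e j) (?e l) $ i" for i j k l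
  proof -
    have "((\<lambda>q. chern_coeff f q y i j l) has_derivative (\<lambda>a. d\<Gamma> q a (?e j) (?e l) $ i)) (at q)"
      by (rule has_derivative_transform_open[OF base_open q _ LC_D])
        (auto simp: base_def fibre_def chern)
    moreover have "((\<lambda>w. chern_coeff f q w i j l) has_derivative (\<lambda>a. 0)) (at y)"
      by (rule has_derivative_transform_open[OF fibre_open[OF S] y _ has_derivative_const[of "LC q i j l"]])
        (auto simp: chern[OF S])
    ultimately show ?thesis unfolding horizontal_partial_def by (simp add: partial_eq_frechet)
  qed
  have cc: "chern_coeff f q y i j l = LC q i j l" for i j l
    by (rule chern[OF S y])
  have d\<Gamma>: "d\<Gamma> q a u v $ i = (\<Sum>j\<in>UNIV. \<Sum>l\<in>UNIV. u $ j * v $ l * d\<Gamma> q a (?e j) (?e l) $ i)" for a u v i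
  proof -
    have "((\<lambda>q. \<Sum>j\<in>UNIV. \<Sum>l\<in>UNIV. u $ j * v $ l * LC q i j l) has_derivative
        (\<lambda>a. \<Sum>j\<in>UNIV. \<Sum>l\<in>UNIV. u $ j * v $ l * d\<Gamma> q a (?e j) (?e l) $ i)) (at q)"
      by (intro has_derivative_sum has_derivative_mult_right LC_D)
    moreover have "(\<lambda>q. \<Sum>j\<in>UNIV. \<Sum>l\<in>UNIV. u $ j * v $ l * LC q i j l) = (\<lambda>q. \<Gamma> q u v $ i)"
      unfolding \<Gamma>_def by (simp add: mult_ac)
    ultimately have "((\<lambda>q. \<Gamma> q u v $ i) has_derivative
        (\<lambda>a. \<Sum>j\<in>UNIV. \<Sum>l\<in>UNIV. u $ j * v $ l * d\<Gamma> q a (?e j) (?e l) $ i)) (at q)" by simp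
    from has_derivative_unique[OF bounded_linear.has_derivative[OF bounded_linear_vec_nth \<Gamma>_has_derivative[OF S]] this]
    show ?thesis by (rule fun_cong)
  qed
  have lin_a: "linear (\<lambda>a. d\<Gamma> q a u v $ i)" for u v i
    using bounded_linear.has_derivative[OF bounded_linear_vec_nth \<Gamma>_has_derivative[OF S]]
    by (rule has_derivative_linear)
  have d\<Gamma>3: "d\<Gamma> q a u v $ i = ?T (\<lambda>j k l. a $ k * u $ j * v $ l * d\<Gamma> q (?e k) (?e j) (?e l) $ i)" for a u v i
  proof -
    have "d\<Gamma> q a u v $ i = (\<Sum>k\<in>UNIV. a $ k * d\<Gamma> q (?e k) u v $ i)"
      by (subst linear_axis_expansion[OF lin_a]) simp
    also have "\<dots> = (\<Sum>k\<in>UNIV. \<Sum>j\<in>UNIV. \<Sum>l\<in>UNIV. a $ k * u $ j * v $ l * d\<Gamma> q (?e k) (?e j) (?e l) $ i)"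
      by (subst d\<Gamma>) (simp add: sum_distrib_left mult.assoc)
    finally show ?thesis by (subst sum.swap)
  qed
  have \<Gamma>\<Gamma>: "\<Gamma> q (\<Gamma> q y v) w $ i = ?T (\<lambda>j k l. (\<Sum>h\<in>UNIV. LC q i h k * LC q h j l) * y $ j * w $ k * v $ l)" for v w i
  proof -
    let ?X = "\<lambda>h j k l. LC q i h k * LC q h j l * y $ j * w $ k * v $ l"
    have "\<Gamma> q (\<Gamma> q y v) w $ i = (\<Sum>h\<in>UNIV. \<Sum>k\<in>UNIV. \<Sum>j\<in>UNIV. \<Sum>l\<in>UNIV. ?X h j k l)"
      unfolding \<Gamma>_def by (simp add: sum_distrib_left sum_distrib_right mult_ac)
    also have "\<dots> = (\<Sum>k\<in>UNIV. \<Sum>h\<in>UNIV. \<Sum>j\<in>UNIV. \<Sum>l\<in>UNIV. ?X h j k l)"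
      by (rule sum.swap)
    also have "\<dots> = (\<Sum>k\<in>UNIV. \<Sum>j\<in>UNIV. \<Sum>h\<in>UNIV. \<Sum>l\<in>UNIV. ?X h j k l)"
      by (rule sum.cong[OF refl], rule sum.swap)
    also have "\<dots> = (\<Sum>j\<in>UNIV. \<Sum>k\<in>UNIV. \<Sum>h\<in>UNIV. \<Sum>l\<in>UNIV. ?X h j k l)"
      by (rule sum.swap)
    also have "\<dots> = ?T (\<lambda>j k l. \<Sum>h\<in>UNIV. ?X h j k l)"
      by (rule sum.cong[OF refl], rule sum.cong[OF refl], rule sum.swap)
    finally show ?thesis by (simp add: sum_distrib_right)
  qed
  show ?thesis
  proof (rule vec_eq_iff[THEN iffD2], rule allI)
    fix i
    have "riemann_curvature f q y u $ i = ?T (\<lambda>j k l. u $ k * y $ j * y $ l * d\<Gamma> q (?e k) (?e j) (?e l) $ i)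
      - ?T (\<lambda>j k l. u $ k * y $ j * y $ l * d\<Gamma> q (?e l) (?e j) (?e k) $ i)
      + ?T (\<lambda>j k l. (\<Sum>h\<in>UNIV. LC q i h k * LC q h j l) * y $ j * u $ k * y $ l)
      - ?T (\<lambda>j k l. (\<Sum>h\<in>UNIV. LC q i h l * LC q h j k) * y $ j * u $ k * y $ l)"
      unfolding riemann_curvature_def chern_curvature_def hp cc sum_subtractf[symmetric] sum.distrib[symmetric]
      by (simp add: algebra_simps sum_subtractf)
    also have "?T (\<lambda>j k l. u $ k * y $ j * y $ l * d\<Gamma> q (?e k) (?e j) (?e l) $ i) = d\<Gamma> q u y y $ i"
      by (rule d\<Gamma>3[symmetric])
    also have "?T (\<lambda>j k l. u $ k * y $ j * y $ l * d\<Gamma> q (?e l) (?e j) (?e k) $ i) = d\<Gamma> q y y u $ i"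
      unfolding d\<Gamma>3[of y y u] by (rule sum.cong[OF refl], subst sum.swap) (simp add: mult_ac)
    also have "?T (\<lambda>j k l. (\<Sum>h\<in>UNIV. LC q i h k * LC q h j l) * y $ j * u $ k * y $ l) = \<Gamma> q (\<Gamma> q y y) u $ i"
      by (rule \<Gamma>\<Gamma>[symmetric])
    also have "?T (\<lambda>j k l. (\<Sum>h\<in>UNIV. LC q i h l * LC q h j k) * y $ j * u $ k * y $ l) = \<Gamma> q (\<Gamma> q y u) y $ i"
      unfolding \<Gamma>\<Gamma> by (rule sum.cong[OF refl], subst sum.swap) (simp add: mult_ac)
    finally show "riemann_curvature f q y u $ i = Rm q u y y $ i"
      unfolding Rm_def by simp
  qed
qed

text \<open>The partner is left general, since \<open>flag_curvature\<close> selects it by choice.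
  The curvature vector \<open>w\<close> is orthogonal to \<open>v\<close> by skewness and to
  \<open>\<xi>\<close> because \<open>\<xi>\<close> is parallel, so in \<open>gt\<close> every term
  but the one with \<open>L1\<close> vanishes. The numerator is
  \<open>a\<^sup>2 L1 sect u v\<close>, the denominator a positive Gram determinant.\<close>

theorem flag_quotient_sgn:
  fixes a b :: real
  assumes q: "q \<in> S" and y: "E q v \<in> fibre q" and uv: "indep2 u v" and a: "a \<noteq> 0"
  defines "\<eta> \<equiv> E q v" and "\<mu> \<equiv> a *\<^sub>R E q u + b *\<^sub>R E q v"
  defines "gy \<equiv> fundamental_tensor f q \<eta>"
  shows "sgn (gy (riemann_curvature f q \<eta> \<mu>) \<mu> / (gy \<eta> \<eta> * gy \<mu> \<mu> - (gy \<eta> \<mu>)\<^sup>2)) = sgn (sect u v)"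
proof -
  note lin = linear_add[OF E_linear[OF q]] linear_cmul[OF E_linear[OF q]]
  have gy: "gy = gt q \<eta>" unfolding gy_def \<eta>_def using fundamental_tensor_eq[OF q y] by (intro ext)
  interpret g: inner_space "gt q \<eta>"
    by unfold_locales (use gt_bilinear gt_sym[OF q] gt_pos[OF q y] in \<open>auto simp: \<eta>_def\<close>)
  have \<mu>: "\<mu> = E q (a *\<^sub>R u + b *\<^sub>R v)" unfolding \<mu>_def by (simp add: lin)
  define w where "w = curv u v v"
  have R: "riemann_curvature f q \<eta> \<mu> = E q (a *\<^sub>R w)"
    using riemann_curvature_eq[of q \<eta> \<mu>] y q Rm_frame[OF q, of "a *\<^sub>R u + b *\<^sub>R v" v v]
    unfolding \<mu> \<eta>_def w_def by (simp add: base_def fibre_def)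
  have wv: "ip v w = 0" unfolding w_def using ip_sym[of v] by simp
  have wx: "ip \<xi> w = 0"
  proof -
    have "curv u v \<xi> = 0" unfolding curv_def by (simp add: field_parallel[OF q y])
    then show ?thesis using curv_metric[of u v \<xi> v] unfolding w_def by simp
  qed
  have gw: "gt q \<eta> (E q w) (E q x) = L1 (AB q \<eta>) * ip w x" for x
    unfolding gt_def \<eta>_def B_def E_metric[OF q] using wv wx ip_sym[of v] by simp
  have num: "gy (riemann_curvature f q \<eta> \<mu>) \<mu> = a\<^sup>2 * L1 (AB q \<eta>) * sect u v"
  proof -
    have "ip w v = 0" using wv ip_sym by simp
    then have "gt q \<eta> (E q w) \<mu> = a * L1 (AB q \<eta>) * sect u v"
      unfolding \<mu> gw sect_def w_def[symmetric] by simp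
    then show ?thesis unfolding gy R lin by (simp add: power2_eq_square)
  qed
  have den: "gy \<eta> \<eta> * gy \<mu> \<mu> - (gy \<eta> \<mu>)\<^sup>2 > 0"
    unfolding gy
  proof (rule g.gram_pos)
    fix c d :: real assume "c *\<^sub>R \<mu> + d *\<^sub>R \<eta> = 0"
    then have "E q ((c * a) *\<^sub>R u + (c * b + d) *\<^sub>R v) = E q 0"
      unfolding \<mu>_def \<eta>_def linear_0[OF E_linear[OF q]] by (simp add: lin algebra_simps)
    then have "(c * a) *\<^sub>R u + (c * b + d) *\<^sub>R v = 0" using E_bij[OF q] by (meson bij_is_inj injD)
    then have "c * a = 0 \<and> c * b + d = 0" using uv unfolding indep2_def by blast
    then show "c = 0 \<and> d = 0" using a by auto
  qed
  \<comment> \<open>Positive definiteness at \<open>E q w\<close> itself reads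
    \<open>L1 * ip w w > 0\<close>. For zero \<open>sect\<close> the numerator vanishes whatever the
    sign of \<open>L1\<close>.\<close>
  have "L1 (AB q \<eta>) > 0" if "sect u v \<noteq> 0"
  proof -
    have w: "w \<noteq> 0" using that unfolding sect_def w_def[symmetric] by auto
    then have "E q w \<noteq> 0" using E_bij[OF q] linear_0[OF E_linear[OF q]] by (metis bij_is_inj injD)
    then have "L1 (AB q \<eta>) * ip w w > 0" using g.ip_pos[of "E q w"] gw by simp
    then show ?thesis using ip_pos[OF w] by (simp add: zero_less_mult_iff)
  qed
  then have L1: "a\<^sup>2 * L1 (AB q \<eta>) > 0" if "sect u v \<noteq> 0" using that a by simp
  have "sgn (c * s / d) = sgn s" if "s \<noteq> 0 \<Longrightarrow> c > 0" "d > 0" for c s d :: real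
    using that by (cases "s = 0") (simp_all add: sgn_mult)
  from this[OF L1 den] show ?thesis unfolding num .
qed

end

section \<open>Left invariant fields and the adjoint representation\<close>

context smooth_manifold
begin

lemma chart_open: "c \<in> A \<Longrightarrow> open (chart_dom c)" "c \<in> A \<Longrightarrow> open (chart_img c)"
  using charts unfolding is_chart_def by auto

lemma chart_continuous: "c \<in> A \<Longrightarrow> continuous_on (chart_dom c) (chart_map c)"
  "c \<in> A \<Longrightarrow> continuous_on (chart_img c) (chart_inv c)"
  using charts unfolding is_chart_def by auto

lemma chart_inv_map [simp]: "c \<in> A \<Longrightarrow> x \<in> chart_dom c \<Longrightarrow> chart_inv c (chart_map c x) = x"
  using charts unfolding is_chart_def chart_inv_def by (simp add: inv_into_f_f)

lemma chart_map_inv [simp]: "p \<in> chart_img c \<Longrightarrow> chart_map c (chart_inv c p) = p"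
  unfolding chart_img_def chart_inv_def by (simp add: f_inv_into_f)

lemma chart_inv_in_dom [simp]: "p \<in> chart_img c \<Longrightarrow> chart_inv c p \<in> chart_dom c"
  unfolding chart_img_def chart_inv_def by (simp add: inv_into_into)

lemma chart_map_in_img [simp]: "x \<in> chart_dom c \<Longrightarrow> chart_map c x \<in> chart_img c"
  unfolding chart_img_def by simp

lemma chart_exists: "\<exists>c\<in>A. x \<in> chart_dom c"
  using cover by blast

text \<open>\<open>mder c c' f x T\<close>: in the charts \<open>c\<close> and \<open>c'\<close>, the differential of \<open>f\<close> at \<open>x\<close> is \<open>T\<close>.\<close>

definition mder :: "('a, 'n) chart \<Rightarrow> ('a, 'n) chart \<Rightarrow> ('a \<Rightarrow> 'a) \<Rightarrow> 'a \<Rightarrow> (real^'n \<Rightarrow> real^'n) \<Rightarrow> bool" where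
  "mder c c' f x T \<longleftrightarrow> c \<in> A \<and> c' \<in> A \<and> x \<in> chart_dom c \<and> f x \<in> chart_dom c' \<and>
     continuous_on UNIV f \<and>
     ((\<lambda>p. chart_map c' (f (chart_inv c p))) has_derivative T) (at (chart_map c x))"

lemma chart_preimage_open:
  assumes "c \<in> A" "continuous_on UNIV f" "open W"
  shows "open {p \<in> chart_img c. f (chart_inv c p) \<in> W}"
proof -
  have "continuous_on (chart_img c) (\<lambda>p. f (chart_inv c p))"
    using continuous_on_compose2[OF assms(2) chart_continuous(2)[OF assms(1)]] by simp
  then have "open (chart_img c \<inter> (\<lambda>p. f (chart_inv c p)) -` W)"
    using chart_open(2)[OF assms(1)] assms(3) continuous_open_preimage by blast
  moreover have "chart_img c \<inter> (\<lambda>p. f (chart_inv c p)) -` W = {p \<in> chart_img c. f (chart_inv c p) \<in> W}"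
    by auto
  ultimately show ?thesis by simp
qed

lemma mder_pull:
  assumes f: "mder c c' f x T"
    and h: "((\<lambda>p. h (chart_inv c' p)) has_derivative K) (at (chart_map c' (f x)))"
  shows "((\<lambda>p. h (f (chart_inv c p))) has_derivative (\<lambda>v. K (T v))) (at (chart_map c x))"
proof -
  have c: "c \<in> A" "c' \<in> A" "x \<in> chart_dom c" "f x \<in> chart_dom c'" "continuous_on UNIV f"
    and d: "((\<lambda>p. chart_map c' (f (chart_inv c p))) has_derivative T) (at (chart_map c x))"
    using f unfolding mder_def by auto
  let ?U = "{p \<in> chart_img c. f (chart_inv c p) \<in> chart_dom c'}"
  have "((\<lambda>p. h (chart_inv c' (chart_map c' (f (chart_inv c p))))) has_derivative (\<lambda>v. K (T v)))
      (at (chart_map c x))"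
    by (rule has_derivative_compose[OF d]) (use h c in simp)
  then show ?thesis
    by (rule has_derivative_transform_open[OF chart_preimage_open[OF c(1,5) chart_open(1)[OF c(2)]], rotated 2])
      (use c in auto)
qed

lemma mder_comp:
  assumes f: "mder c c' f x T" and g: "mder c' c'' g (f x) S"
  shows "mder c c'' (\<lambda>y. g (f y)) x (\<lambda>v. S (T v))"
proof -
  have "continuous_on UNIV (\<lambda>y. g (f y))"
    using f g unfolding mder_def by (auto intro: continuous_on_compose2)
  moreover have "((\<lambda>p. chart_map c'' (g (f (chart_inv c p)))) has_derivative (\<lambda>v. S (T v))) (at (chart_map c x))"
    by (rule mder_pull[OF f]) (use g in \<open>simp add: mder_def\<close>)
  ultimately show ?thesis using f g unfolding mder_def by simp
qed

lemma mder_unique: "mder c c' f x T \<Longrightarrow> mder c c' f x S \<Longrightarrow> T = S"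
  unfolding mder_def using has_derivative_unique by blast

lemma mder_linear: "mder c c' f x T \<Longrightarrow> linear T"
  unfolding mder_def using has_derivative_linear by blast

lemma mder_id:
  assumes "c \<in> A" "x \<in> chart_dom c" shows "mder c c (\<lambda>y. y) x (\<lambda>v. v)"
proof -
  have "((\<lambda>p. chart_map c (chart_inv c p)) has_derivative (\<lambda>v. v)) (at (chart_map c x))"
    by (rule has_derivative_transform_open[OF chart_open(2)[OF assms(1)] _ _ has_derivative_ident])
      (use assms in auto)
  then show ?thesis using assms unfolding mder_def by simp
qed

lemma mder_const:
  assumes "c \<in> A" "c' \<in> A" "x \<in> chart_dom c" "a \<in> chart_dom c'"
  shows "mder c c' (\<lambda>y. a) x (\<lambda>v. 0)"
  using assms unfolding mder_def by simp

text \<open>A zero derivative is integrated over a ball in the chart. The conclusion retains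
  membership in \<open>U\<close>, which lets a chart-valued \<open>F\<close> be inverted
  afterwards.\<close>

lemma chart_locally_constant:
  fixes F :: "'a \<Rightarrow> real^'m"
  assumes "c \<in> A" "x \<in> chart_dom c" "open U" "U \<subseteq> chart_img c" "chart_map c x \<in> U"
    and D: "\<And>p. p \<in> U \<Longrightarrow> ((\<lambda>p. F (chart_inv c p)) has_derivative (\<lambda>a. 0)) (at p)"
  shows "\<exists>T. open T \<and> x \<in> T \<and> (\<forall>y\<in>T. y \<in> chart_dom c \<and> chart_map c y \<in> U \<and> F y = F x)"
proof -
  obtain e where e: "e > 0" "ball (chart_map c x) e \<subseteq> U"
    using assms(3,5) open_contains_ball by blast
  let ?T = "chart_dom c \<inter> chart_map c -` ball (chart_map c x) e"
  have "open ?T"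
    using chart_continuous(1)[OF assms(1)] chart_open(1)[OF assms(1)] continuous_open_preimage by blast
  moreover have "F y = F x" if "y \<in> ?T" for y
  proof -
    obtain k where k: "\<And>p. p \<in> ball (chart_map c x) e \<Longrightarrow> F (chart_inv c p) = k"
      using has_derivative_zero_constant[of "ball (chart_map c x) e" "\<lambda>p. F (chart_inv c p)"]
        D e(2) has_derivative_at_withinI by (metis convex_ball subsetD)
    have "F (chart_inv c (chart_map c y)) = F (chart_inv c (chart_map c x))"
      using k[of "chart_map c y"] k[of "chart_map c x"] that e(1) by simp
    then show ?thesis using that assms(1,2) by simp
  qed
  moreover have "x \<in> ?T" using assms(2) e(1) by simp
  moreover have "y \<in> chart_dom c \<and> chart_map c y \<in> U" if "y \<in> ?T" for y using e(2) that by blast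
  ultimately show ?thesis by meson
qed

lemma tvec_eq:
  assumes "((\<lambda>p. h (chart_inv c p)) has_derivative K) (at (chart_map c x))"
  shows "tvec c x v h = K v"
proof -
  have "(\<lambda>p. h (chart_inv c p)) differentiable (at (chart_map c x))"
    using assms unfolding differentiable_def by blast
  then show ?thesis unfolding tvec_def using frechet_derivative_at[OF assms] by simp
qed

lemma coords_tvec [simp]:
  assumes "c \<in> A" "x \<in> chart_dom c" shows "coords c (tvec c x v) = v"
proof -
  have "((\<lambda>p. chart_map c (chart_inv c p) $ i) has_derivative (\<lambda>v. v $ i)) (at (chart_map c x))" for i
    using bounded_linear.has_derivative[OF bounded_linear_vec_nth] mder_id[OF assms]
    unfolding mder_def by blast
  then have "tvec c x v (\<lambda>q. chart_map c q $ i) = v $ i" for i by (rule tvec_eq)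
  then show ?thesis unfolding coords_def by (simp add: vec_eq_iff)
qed

lemma tcomb_tvec: "tcomb a (tvec c x u) b (tvec c x v) = tvec c x (a *\<^sub>R u + b *\<^sub>R v)"
  unfolding tcomb_def tvec_def
  by (auto simp: fun_eq_iff linear_add[OF linear_frechet_derivative] linear_cmul[OF linear_frechet_derivative])

lemma tvec_zero: "tvec c x 0 = tzero"
  unfolding tzero_def tvec_def by (auto simp: fun_eq_iff linear_0[OF linear_frechet_derivative])

text \<open>Tangent vectors take the dummy value 0 on functions that are not differentiable. The
  inverse map \<open>g\<close> shows that \<open>h\<close> and its pullback along \<open>f\<close>
  are differentiable together, so the dummy values match.\<close>

lemma tvec_push:
  assumes f: "mder c c' f x T" and g: "mder c' c g (f x) T'"
    and gf: "\<And>y. f (g y) = y" "g (f x) = x"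
  shows "(\<lambda>h. tvec c x v (\<lambda>q. h (f q))) = tvec c' (f x) (T v)"
proof
  fix h :: "'a \<Rightarrow> real"
  show "tvec c x v (\<lambda>q. h (f q)) = tvec c' (f x) (T v) h"
  proof (cases "(\<lambda>p. h (chart_inv c' p)) differentiable (at (chart_map c' (f x)))")
    case True
    then obtain K where K: "((\<lambda>p. h (chart_inv c' p)) has_derivative K) (at (chart_map c' (f x)))"
      unfolding differentiable_def by blast
    show ?thesis using tvec_eq[OF K] tvec_eq[OF mder_pull[OF f K]] by simp
  next
    case False
    have "\<not> (\<lambda>p. h (f (chart_inv c p))) differentiable (at (chart_map c x))"
    proof
      assume "(\<lambda>p. h (f (chart_inv c p))) differentiable (at (chart_map c x))"
      then obtain K where "((\<lambda>p. h (f (chart_inv c p))) has_derivative K) (at (chart_map c x))"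
        unfolding differentiable_def by blast
      then have "((\<lambda>p. h (f (g (chart_inv c' p)))) has_derivative (\<lambda>v. K (T' v))) (at (chart_map c' (f x)))"
        using mder_pull[OF g, of "\<lambda>y. h (f y)" K] gf(2) by simp
      then show False using False gf(1) unfolding differentiable_def by auto
    qed
    then show ?thesis using False by (simp add: tvec_def)
  qed
qed

end

section \<open>Differentials of the group operations\<close>

context lie_group
begin

abbreviation gmult (infixl "\<cdot>" 70) where "x \<cdot> y \<equiv> x \<otimes>\<^bsub>G\<^esub> y"

abbreviation gone ("\<epsilon>") where "\<epsilon> \<equiv> \<one>\<^bsub>G\<^esub>"

abbreviation ginv ("\<iota> _" [81] 80) where "\<iota> x \<equiv> inv\<^bsub>G\<^esub> x"


lemma in_carrier [simp]: "x \<in> carrier G"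
  using carrier_UNIV by simp

lemma mult_inv_cancel [simp]: "\<iota> x \<cdot> (x \<cdot> y) = y" "x \<cdot> (\<iota> x \<cdot> y) = y"
  by (simp_all add: m_assoc[symmetric])

definition mu :: "('a, 'n) chart \<Rightarrow> ('a, 'n) chart \<Rightarrow> ('a, 'n) chart \<Rightarrow> (real^'n) \<times> (real^'n) \<Rightarrow> real^'n" where
  "mu c1 c2 c3 = (\<lambda>(p, q). chart_map c3 (chart_inv c1 p \<cdot> chart_inv c2 q))"

definition mu_dom :: "('a, 'n) chart \<Rightarrow> ('a, 'n) chart \<Rightarrow> ('a, 'n) chart \<Rightarrow> ((real^'n) \<times> (real^'n)) set" where
  "mu_dom c1 c2 c3 = {(p, q). p \<in> chart_img c1 \<and> q \<in> chart_img c2 \<and>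
     chart_inv c1 p \<cdot> chart_inv c2 q \<in> chart_dom c3}"

lemma mu_smooth: "\<lbrakk>c1 \<in> A; c2 \<in> A; c3 \<in> A\<rbrakk> \<Longrightarrow> smooth_on (mu_dom c1 c2 c3) (mu c1 c2 c3)"
  unfolding mu_def mu_dom_def by (rule smooth_mult)

lemma continuous_mult': 
  assumes "continuous_on S f" "continuous_on S h"
  shows "continuous_on S (\<lambda>y. f y \<cdot> h y)"
  using continuous_on_compose2[OF continuous_mult continuous_on_Pair[OF assms]] by simp

lemma mu_dom_open: 
  assumes "c1 \<in> A" "c2 \<in> A" "c3 \<in> A" shows "open (mu_dom c1 c2 c3)"
proof -
  let ?U = "chart_img c1 \<times> chart_img c2"
  have "continuous_on ?U (\<lambda>z. chart_inv c1 (fst z) \<cdot> chart_inv c2 (snd z))"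
    by (intro continuous_mult' continuous_on_compose2[OF chart_continuous(2)[OF assms(1)]]
        continuous_on_compose2[OF chart_continuous(2)[OF assms(2)]] continuous_on_fst continuous_on_snd
        continuous_on_id) auto
  moreover have "open ?U" by (intro open_Times chart_open assms)
  ultimately have "open (?U \<inter> (\<lambda>z. chart_inv c1 (fst z) \<cdot> chart_inv c2 (snd z)) -` chart_dom c3)"
    using chart_open(1)[OF assms(3)] continuous_open_preimage by blast
  moreover have "?U \<inter> (\<lambda>z. chart_inv c1 (fst z) \<cdot> chart_inv c2 (snd z)) -` chart_dom c3 = mu_dom c1 c2 c3"
    unfolding mu_dom_def by auto
  ultimately show ?thesis by simp
qed

lemma mder_mult:
  assumes f: "mder c c1 f x T" and h: "mder c c2 h x S" and c3: "c3 \<in> A" "f x \<cdot> h x \<in> chart_dom c3"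
  shows "mder c c3 (\<lambda>y. f y \<cdot> h y) x
    (\<lambda>v. fd (mu c1 c2 c3) (chart_map c1 (f x), chart_map c2 (h x)) (T v, S v))"
proof -
  have c: "c \<in> A" "c1 \<in> A" "c2 \<in> A" "x \<in> chart_dom c" "f x \<in> chart_dom c1" "h x \<in> chart_dom c2"
    "continuous_on UNIV f" "continuous_on UNIV h"
    and df: "((\<lambda>p. chart_map c1 (f (chart_inv c p))) has_derivative T) (at (chart_map c x))"
    and dh: "((\<lambda>p. chart_map c2 (h (chart_inv c p))) has_derivative S) (at (chart_map c x))"
    using f h unfolding mder_def by auto
  let ?z = "(chart_map c1 (f x), chart_map c2 (h x))"
  have z: "?z \<in> mu_dom c1 c2 c3" unfolding mu_dom_def using c c3 by simp
  have "(mu c1 c2 c3 has_derivative fd (mu c1 c2 c3) ?z) (at ?z)"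
    by (rule smooth_on_has_derivative[OF mu_smooth[OF c(2,3) c3(1)] z])
  then have d: "((\<lambda>p. mu c1 c2 c3 (chart_map c1 (f (chart_inv c p)), chart_map c2 (h (chart_inv c p))))
      has_derivative (\<lambda>v. fd (mu c1 c2 c3) ?z (T v, S v))) (at (chart_map c x))"
    using has_derivative_compose[OF has_derivative_Pair[OF df dh]] c by simp
  let ?U = "{p \<in> chart_img c. f (chart_inv c p) \<in> chart_dom c1} \<inter> {p \<in> chart_img c. h (chart_inv c p) \<in> chart_dom c2}"
  have "open ?U" by (intro open_Int chart_preimage_open chart_open c)
  from has_derivative_transform_open[OF this _ _ d]
  have "((\<lambda>p. chart_map c3 (f (chart_inv c p) \<cdot> h (chart_inv c p))) has_derivative
      (\<lambda>v. fd (mu c1 c2 c3) ?z (T v, S v))) (at (chart_map c x))"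
    using c by (auto simp: mu_def)
  then show ?thesis unfolding mder_def using c c3 by (auto intro: continuous_mult')
qed

lemma mder_left:
  assumes "c \<in> A" "c' \<in> A" "x \<in> chart_dom c" "a \<cdot> x \<in> chart_dom c'"
  shows "\<exists>T. mder c c' (\<lambda>y. a \<cdot> y) x T"
proof -
  obtain c1 where "c1 \<in> A" "a \<in> chart_dom c1" using chart_exists by blast
  then show ?thesis using mder_mult[OF mder_const mder_id] assms by blast
qed

lemma mder_right:
  assumes "c \<in> A" "c' \<in> A" "x \<in> chart_dom c" "x \<cdot> a \<in> chart_dom c'"
  shows "\<exists>T. mder c c' (\<lambda>y. y \<cdot> a) x T"
proof -
  obtain c1 where "c1 \<in> A" "a \<in> chart_dom c1" using chart_exists by blast
  then show ?thesis using mder_mult[OF mder_id mder_const] assms by blast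
qed

lemma mder_inv:
  assumes "c \<in> A" "c' \<in> A" "x \<in> chart_dom c" "\<iota> x \<in> chart_dom c'"
  shows "\<exists>T. mder c c' (\<lambda>y. \<iota> y) x T"
proof -
  have "(\<lambda>p. chart_map c' (\<iota> (chart_inv c p))) differentiable (at (chart_map c x))"
    by (rule smooth_on_differentiable[OF smooth_inverse[OF assms(1,2)]]) (use assms in auto)
  then show ?thesis unfolding mder_def differentiable_def using assms continuous_inverse by blast
qed

end

section \<open>Left invariant fields and their bracket\<close>

locale lie_group_chart = lie_group G A
  for G :: "'a::{t2_space, second_countable_topology} monoid" and A :: "('a, 'n::finite) chart set" +
  fixes c0
  assumes c0: "c0 \<in> A" "\<epsilon> \<in> chart_dom c0"
begin

definition q0 :: "real^'n" where "q0 = chart_map c0 \<epsilon>"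

lemma q0 [simp]: "q0 \<in> chart_img c0" "chart_inv c0 q0 = \<epsilon>"
  unfolding q0_def using c0 by auto

text \<open>The left invariant vector field with value \<open>v\<close> at the identity, in the chart \<open>c\<close>.\<close>

definition Ev :: "('a, 'n) chart \<Rightarrow> real^'n \<Rightarrow> real^'n \<Rightarrow> real^'n" where
  "Ev c p v = fd (mu c c0 c) (p, q0) (0, v)"

lemma Ev_mder:
  assumes "c \<in> A" "x \<in> chart_dom c"
  shows "mder c0 c (\<lambda>y. x \<cdot> y) \<epsilon> (Ev c (chart_map c x))"
  using mder_mult[OF mder_const[OF c0(1) assms(1) c0(2) assms(2)] mder_id[OF c0] assms(1)] assms(2)
  unfolding Ev_def q0_def by simp

lemma mu_dom_q0: "p \<in> chart_img c \<Longrightarrow> (p, q0) \<in> mu_dom c c0 c"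
  unfolding mu_dom_def by simp

lemma bounded_linear_pairs: "bounded_linear (\<lambda>p. (p, 0))" "bounded_linear (\<lambda>p. (0, p))"
  by (intro bounded_linear_Pair bounded_linear_ident bounded_linear_zero)+

lemma Ev_smooth: "c \<in> A \<Longrightarrow> smooth_on (chart_img c) (\<lambda>p. Ev c p v)"
  using smooth_on_affine[OF chart_open(2) bounded_linear_pairs(1), of c "(0, q0)" "mu_dom c c0 c"
      "\<lambda>z. fd (mu c c0 c) z (0, v)"]
    smooth_on_derivative[OF mu_smooth] c0 mu_dom_q0 unfolding Ev_def by simp

lemma Ev_linear: "c \<in> A \<Longrightarrow> p \<in> chart_img c \<Longrightarrow> linear (Ev c p)"
  using mder_linear[OF Ev_mder[of c "chart_inv c p"]] by simp

lemma Ev_trans: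
  assumes "mder c c' (\<lambda>y. a \<cdot> y) x T"
  shows "Ev c' (chart_map c' (a \<cdot> x)) v = T (Ev c (chart_map c x) v)"
proof -
  have c: "c \<in> A" "c' \<in> A" "x \<in> chart_dom c" "a \<cdot> x \<in> chart_dom c'"
    using assms unfolding mder_def by auto
  have "mder c0 c' (\<lambda>y. a \<cdot> (x \<cdot> y)) \<epsilon> (\<lambda>v. T (Ev c (chart_map c x) v))"
    by (rule mder_comp[OF Ev_mder[OF c(1,3)]]) (use assms in simp)
  moreover have "mder c0 c' (\<lambda>y. a \<cdot> (x \<cdot> y)) \<epsilon> (Ev c' (chart_map c' (a \<cdot> x)))"
    using Ev_mder[OF c(2,4)] by (simp add: m_assoc)
  ultimately show ?thesis using mder_unique by (metis (no_types, lifting))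
qed

lemma Ev_q0: "Ev c0 q0 v = v"
  using mder_unique[OF Ev_mder[OF c0]] mder_id[OF c0] unfolding q0_def by simp

lemma mder_inverse_bij:
  assumes f: "mder c c' f x T" and g: "mder c' c g (f x) S"
    and "\<And>y. g (f y) = y" "\<And>y. f (g y) = y"
  shows "bij T"
proof -
  have gx: "g (f x) = x" by (rule assms)
  have c: "c \<in> A" "c' \<in> A" "x \<in> chart_dom c" "f x \<in> chart_dom c'" using f unfolding mder_def by auto
  have "(\<lambda>v. S (T v)) = (\<lambda>v. v)"
    using mder_unique[OF mder_comp[OF f g]] mder_id[OF c(1,3)] assms(3) by simp
  moreover have "(\<lambda>v. T (S v)) = (\<lambda>v. v)"
    using mder_unique[OF mder_comp[OF g]] f mder_id[OF c(2,4)] assms(4) gx by simp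
  ultimately show ?thesis by (intro o_bij[of S]) (auto simp: fun_eq_iff)
qed

lemma Ev_bij: assumes "c \<in> A" "p \<in> chart_img c" shows "bij (Ev c p)"
proof -
  let ?x = "chart_inv c p"
  have E: "mder c0 c (\<lambda>y. ?x \<cdot> y) \<epsilon> (Ev c p)" using Ev_mder[of c ?x] assms by simp
  obtain S where "mder c c0 (\<lambda>y. \<iota> ?x \<cdot> y) ?x S"
    using mder_left[OF assms(1) c0(1), of ?x "\<iota> ?x"] assms c0 by auto
  then show ?thesis by (intro mder_inverse_bij[OF E]) auto
qed

text \<open>The commutator of two left invariant fields, evaluated at the identity in the chart
  \<open>c0\<close>.\<close>

definition br :: "real^'n \<Rightarrow> real^'n \<Rightarrow> real^'n" where
  "br u v = fd (\<lambda>p. Ev c0 p v) q0 u - fd (\<lambda>p. Ev c0 p u) q0 v"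

text \<open>Left translation carries the fields near the identity to those near \<open>p\<close>.
  Differentiating this relation at \<open>q0\<close> gives the bracket at the identity plus a second
  derivative of the translation, which is symmetric and cancels.\<close>

lemma Ev_bracket:
  assumes "c \<in> A" "p \<in> chart_img c"
  shows "fd (\<lambda>p. Ev c p v) p (Ev c p u)
    - fd (\<lambda>p. Ev c p u) p (Ev c p v) = Ev c p (br u v)"
proof -
  define x where "x = chart_inv c p"
  have x: "x \<in> chart_dom c" "chart_map c x = p" unfolding x_def using assms by auto
  define l where "l q = chart_map c (x \<cdot> chart_inv c0 q)" for q
  let ?U = "{q \<in> chart_img c0. x \<cdot> chart_inv c0 q \<in> chart_dom c}"
  have U: "open ?U"
    by (intro chart_preimage_open chart_open c0 assms continuous_mult' continuous_intros)
  have q0U: "q0 \<in> ?U" using x by simp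
  have l_smooth: "smooth_on ?U l"
  proof (rule smooth_on_cong[OF U])
    show "smooth_on ?U (\<lambda>q. mu c c0 c ((p, 0) + (0, q)))"
      by (rule smooth_on_affine[OF U bounded_linear_pairs(2) _ mu_smooth[OF assms(1) c0(1) assms(1)]])
        (use assms in \<open>auto simp: mu_dom_def x_def\<close>)
  qed (auto simp: mu_def l_def x_def)
  define Dl where "Dl q = fd l q" for q
  have Dl: "(l has_derivative Dl q) (at q)" if "q \<in> ?U" for q
    unfolding Dl_def by (rule smooth_on_has_derivative[OF l_smooth that])
  have Dl_mder: "mder c0 c (\<lambda>y. x \<cdot> y) (chart_inv c0 q) (Dl q)" if "q \<in> ?U" for q
    using Dl[OF that] that c0 assms unfolding mder_def l_def
    by (auto intro!: continuous_mult' continuous_intros)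
  have l0: "l q0 = p" unfolding l_def using x by simp
  have E: "Ev c (l q) v = Dl q (Ev c0 q v)" if "q \<in> ?U" for q v
    using Ev_trans[OF Dl_mder[OF that], of v] that unfolding l_def by simp
  have Dl0: "Dl q0 = Ev c p"
    using E[OF q0U] l0 Ev_q0 by (simp add: fun_eq_iff)
  have DEv: "((\<lambda>q. Ev c q v) has_derivative fd (\<lambda>p. Ev c p v) q) (at q)"
    if "c \<in> A" "q \<in> chart_img c" for c q v
    by (rule smooth_on_has_derivative[OF Ev_smooth[OF that(1)] that(2)])
  define H where "H a b = fd (\<lambda>q. Dl q a) q0 b" for a b
  have H: "((\<lambda>q. Dl q a) has_derivative H a) (at q0)" for a
    unfolding H_def Dl_def by (rule smooth_on_has_derivative[OF smooth_on_derivative[OF l_smooth] q0U])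
  have H_sym: "H a b = H b a" for a b
    unfolding H_def Dl_def by (rule symmetric_second_derivative[OF U l_smooth q0U])
  have key: "fd (\<lambda>p. Ev c p v) p (Ev c p u) =
      H v u + Ev c p (fd (\<lambda>p. Ev c0 p v) q0 u)" for u v
  proof -
    have lhs: "((\<lambda>q. Ev c (l q) v) has_derivative
        (\<lambda>a. fd (\<lambda>p. Ev c p v) p (Ev c p a))) (at q0)"
      using has_derivative_compose[OF Dl[OF q0U], of "\<lambda>q. Ev c q v"] DEv[OF assms]
      unfolding l0 Dl0 by blast
    have "((\<lambda>q. Dl q (Ev c0 q v)) has_derivative
        (\<lambda>a. H (Ev c0 q0 v) a + Dl q0 (fd (\<lambda>p. Ev c0 p v) q0 a))) (at q0)"
      by (rule has_derivative_linear_family[OF U q0U _ H DEv[OF c0(1)]])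
        (use Dl has_derivative_linear in auto)
    then have rhs: "((\<lambda>q. Ev c (l q) v) has_derivative
        (\<lambda>a. H v a + Ev c p (fd (\<lambda>p. Ev c0 p v) q0 a))) (at q0)"
      unfolding Ev_q0 Dl0
      by (rule has_derivative_transform_open[OF U q0U, rotated]) (simp add: E)
    from fun_cong[OF has_derivative_unique[OF lhs rhs]] show ?thesis .
  qed
  show ?thesis unfolding key br_def linear_diff[OF Ev_linear[OF assms]] using H_sym[of u v] by simp
qed

section \<open>The adjoint representation and its differential\<close>

definition conj :: "'a \<Rightarrow> 'a \<Rightarrow> 'a" where
  "conj a y = a \<cdot> y \<cdot> \<iota> a"

definition Ad :: "'a \<Rightarrow> real^'n \<Rightarrow> real^'n" where
  "Ad a = (THE T. mder c0 c0 (conj a) \<epsilon> T)"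

lemma conj_one [simp]: "conj a \<epsilon> = \<epsilon>"
  unfolding conj_def by simp

lemma Ad_mder: "mder c0 c0 (conj a) \<epsilon> (Ad a)"
proof -
  obtain c where c: "c \<in> A" "a \<in> chart_dom c" using chart_exists by blast
  obtain T where T: "mder c0 c (\<lambda>y. a \<cdot> y) \<epsilon> T"
    using mder_left[OF c0(1) c(1) c0(2), of a] c by auto
  obtain S where S: "mder c c0 (\<lambda>y. y \<cdot> \<iota> a) (a \<cdot> \<epsilon>) S"
    using mder_right[OF c(1) c0(1), of a "\<iota> a"] c c0 by auto
  have ST: "mder c0 c0 (conj a) \<epsilon> (\<lambda>v. S (T v))"
    using mder_comp[OF T S] by (simp add: conj_def[abs_def])
  show ?thesis unfolding Ad_def
    by (rule theI[where P = "mder c0 c0 (conj a) \<epsilon>", OF ST]) (erule mder_unique[OF _ ST])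
qed

lemma Ad_linear: "linear (Ad a)"
  by (rule mder_linear[OF Ad_mder])

lemma Ad_eqI: "mder c0 c0 (conj a) \<epsilon> T \<Longrightarrow> Ad a = T"
  using mder_unique[OF Ad_mder] by blast

lemma Ad_one: "Ad \<epsilon> = (\<lambda>v. v)"
  by (rule Ad_eqI) (use mder_id[OF c0] in \<open>simp add: conj_def[abs_def]\<close>)

lemma Ad_mult: "Ad (a \<cdot> b) = (\<lambda>v. Ad a (Ad b v))"
proof (rule Ad_eqI)
  have "mder c0 c0 (\<lambda>y. conj a (conj b y)) \<epsilon> (\<lambda>v. Ad a (Ad b v))"
    by (rule mder_comp[OF Ad_mder]) (simp add: Ad_mder)
  then show "mder c0 c0 (conj (a \<cdot> b)) \<epsilon> (\<lambda>v. Ad a (Ad b v))"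
    by (simp add: conj_def[abs_def] m_assoc inv_mult_group)
qed

text \<open>The right invariant vector fields in the chart \<open>c0\<close>.\<close>

definition Er :: "real^'n \<Rightarrow> real^'n \<Rightarrow> real^'n" where
  "Er p v = fd (mu c0 c0 c0) (q0, p) (v, 0)"

lemma Er_mder:
  assumes "x \<in> chart_dom c0"
  shows "mder c0 c0 (\<lambda>y. y \<cdot> x) \<epsilon> (Er (chart_map c0 x))"
  using mder_mult[OF mder_id[OF c0] mder_const[OF c0(1) c0(1) c0(2) assms] c0(1)] assms
  unfolding Er_def q0_def by simp

lemma Er_linear: "p \<in> chart_img c0 \<Longrightarrow> linear (Er p)"
  using mder_linear[OF Er_mder[of "chart_inv c0 p"]] by simp

lemma Er_smooth: "smooth_on (chart_img c0) (\<lambda>p. Er p v)"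
proof -
  have "(q0, p) \<in> mu_dom c0 c0 c0" if "p \<in> chart_img c0" for p using that by (simp add: mu_dom_def)
  then show ?thesis
    using smooth_on_affine[OF chart_open(2)[OF c0(1)] bounded_linear_pairs(2), of "(q0, 0)" "mu_dom c0 c0 c0"
        "\<lambda>z. fd (mu c0 c0 c0) z (v, 0)"]
      smooth_on_derivative[OF mu_smooth] c0 unfolding Er_def by simp
qed

lemma Er_bij: assumes "p \<in> chart_img c0" shows "bij (Er p)"
proof -
  let ?x = "chart_inv c0 p"
  have E: "mder c0 c0 (\<lambda>y. y \<cdot> ?x) \<epsilon> (Er p)" using Er_mder[of ?x] assms by simp
  obtain S where "mder c0 c0 (\<lambda>y. y \<cdot> \<iota> ?x) ?x S"
    using mder_right[OF c0(1) c0(1), of ?x "\<iota> ?x"] assms c0 by auto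
  then show ?thesis by (intro mder_inverse_bij[OF E]) (auto simp: m_assoc)
qed

lemma Er_q0: "Er q0 v = v"
  using mder_unique[OF Er_mder[OF c0(2)]] mder_id[OF c0] unfolding q0_def by simp

text \<open>Differentiates \<open>x y = (x y x^-1) x\<close> in \<open>y\<close> at the
  identity.\<close>

lemma Ev_Er_Ad:
  assumes "p \<in> chart_img c0"
  shows "Ev c0 p v = Er p (Ad (chart_inv c0 p) v)"
proof -
  let ?x = "chart_inv c0 p"
  have "mder c0 c0 (\<lambda>y. conj ?x y \<cdot> ?x) \<epsilon> (\<lambda>v. Er p (Ad ?x v))"
    by (rule mder_comp[OF Ad_mder]) (use Er_mder[of ?x] assms in simp)
  then have "mder c0 c0 (\<lambda>y. ?x \<cdot> y) \<epsilon> (\<lambda>v. Er p (Ad ?x v))"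
    by (simp add: conj_def m_assoc)
  from mder_unique[OF this Ev_mder[OF c0(1), of ?x]] show ?thesis using assms by (simp add: fun_eq_iff)
qed

text \<open>\<open>ad\<close> is the differential of \<open>Ad\<close>. By \<open>Ev_Er_Ad\<close>,
  \<open>Ad\<close> solves a linear system with smooth data, hence is differentiable; the product
  rule then gives its differential as the difference of the derivatives of the left and right
  invariant fields.\<close>

lemma Ad_has_derivative: "((\<lambda>p. Ad (chart_inv c0 p) v) has_derivative (\<lambda>u. br u v)) (at q0)"
proof -
  have Er_D: "((\<lambda>p. Er p v) has_derivative fd (\<lambda>p. Er p v) q0) (at q0)" for v
    by (rule smooth_on_has_derivative[OF Er_smooth q0(1)])
  have Ev_D: "((\<lambda>p. Ev c0 p v) has_derivative fd (\<lambda>p. Ev c0 p v) q0) (at q0)" for v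
    by (rule smooth_on_has_derivative[OF Ev_smooth[OF c0(1)] q0(1)])
  have "(\<lambda>p. Ad (chart_inv c0 p) v) differentiable (at q0)"
  proof (rule differentiable_linear_solution[where A = "\<lambda>p. matrix (Er p)"])
    show "(\<lambda>p. matrix (Er p) $ i $ j) differentiable (at q0)" for i j
      using differentiable_vec_nth[of "\<lambda>p. Er p (axis j 1)"] Er_D unfolding differentiable_def matrix_def
      by simp blast
    show "(\<lambda>p. Ev c0 p v) differentiable (at q0)" using Ev_D unfolding differentiable_def by blast
    show "open (chart_img c0)" by (rule chart_open(2)[OF c0(1)])
    show "q0 \<in> chart_img c0" by simp
    fix p assume p: "p \<in> chart_img c0"
    show "invertible (matrix (Er p))"
      using Er_bij[OF p] Er_linear[OF p] by (simp add: invertible_eq_bij matrix_works ext)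
    show "matrix (Er p) *v Ad (chart_inv c0 p) v = Ev c0 p v"
      using Ev_Er_Ad[OF p] Er_linear[OF p] by (simp add: matrix_works)
  qed
  then obtain D where D: "((\<lambda>p. Ad (chart_inv c0 p) v) has_derivative D) (at q0)"
    unfolding differentiable_def by blast
  have "((\<lambda>p. Er p (Ad (chart_inv c0 p) v)) has_derivative
      (\<lambda>u. fd (\<lambda>p. Er p (Ad (chart_inv c0 q0) v)) q0 u + Er q0 (D u))) (at q0)"
    by (rule has_derivative_linear_family[OF chart_open(2)[OF c0(1)] q0(1) Er_linear Er_D D])
  then have "((\<lambda>p. Ev c0 p v) has_derivative (\<lambda>u. fd (\<lambda>p. Er p v) q0 u + D u)) (at q0)"
    unfolding Er_q0 q0(2) Ad_one
    by (rule has_derivative_transform_open[OF chart_open(2)[OF c0(1)] q0(1), rotated])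
      (rule Ev_Er_Ad[symmetric])
  then have D': "fd (\<lambda>p. Ev c0 p v) q0 u = fd (\<lambda>p. Er p v) q0 u + D u" for u
    using fun_cong[OF has_derivative_unique[OF Ev_D]] by blast
  let ?m = "mu c0 c0 c0"
  have z: "(q0, q0) \<in> mu_dom c0 c0 c0" by (rule mu_dom_q0) simp
  note sm = mu_smooth[OF c0(1) c0(1) c0(1)]
  have DD: "((\<lambda>z. fd ?m z a) has_derivative
      fd (\<lambda>z. fd ?m z a) (q0, q0)) (at (q0, q0))" for a
    by (rule smooth_on_has_derivative[OF smooth_on_derivative[OF sm] z])
  have "((\<lambda>p. (p, q0)) has_derivative (\<lambda>a. (a, 0))) (at q0)" "((\<lambda>p. (q0, p)) has_derivative (\<lambda>a. (0, a))) (at q0)"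
    by (auto intro!: derivative_eq_intros)
  from has_derivative_compose[OF this(1) DD] has_derivative_compose[OF this(2) DD]
  have 1: "fd (\<lambda>p. Ev c0 p u) q0 b =
        fd (\<lambda>z. fd ?m z (0, u)) (q0, q0) (b, 0)"
    and 2: "fd (\<lambda>p. Er p v) q0 u =
        fd (\<lambda>z. fd ?m z (v, 0)) (q0, q0) (0, u)" for u v b
    unfolding Ev_def Er_def using frechet_derivative_at by metis+
  \<comment> \<open>Both sides are the mixed derivative of multiplication with \<open>v\<close> in
    the left factor and \<open>u\<close> in the right one, taken in the two orders.\<close>
  have "fd (\<lambda>p. Er p v) q0 u = fd (\<lambda>p. Ev c0 p u) q0 v" for u
    unfolding 1 2 using symmetric_second_derivative[OF mu_dom_open[OF c0(1) c0(1) c0(1)] sm z] .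
  then have "D u = br u v" for u using D'[of u] unfolding br_def by simp
  then show ?thesis using D by presburger
qed

section \<open>Nilpotency passes from the group to the bracket\<close>

definition comm :: "'a \<Rightarrow> 'a \<Rightarrow> 'a" where
  "comm b y = y \<cdot> b \<cdot> \<iota> y \<cdot> \<iota> b"

lemma comm_one [simp]: "comm b \<epsilon> = \<epsilon>"
  unfolding comm_def by simp

lemma mu_derivative_q0: "fd (mu c0 c0 c0) (q0, q0) (u, v) = u + v"
proof -
  have "(mu c0 c0 c0 has_derivative fd (mu c0 c0 c0) (q0, q0)) (at (q0, q0))"
    by (rule smooth_on_has_derivative[OF mu_smooth[OF c0(1) c0(1) c0(1)] mu_dom_q0]) simp
  then have "linear (fd (mu c0 c0 c0) (q0, q0))" by (rule has_derivative_linear)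
  from linear_add[OF this, of "(u, 0)" "(0, v)"] show ?thesis
    using Ev_q0[of v] Er_q0[of u] unfolding Ev_def Er_def by simp
qed

lemma mder_mult_one:
  assumes "mder c0 c0 f \<epsilon> T" "mder c0 c0 h \<epsilon> S" "f \<epsilon> = \<epsilon>" "h \<epsilon> = \<epsilon>"
  shows "mder c0 c0 (\<lambda>y. f y \<cdot> h y) \<epsilon> (\<lambda>v. T v + S v)"
  using mder_mult[OF assms(1,2) c0(1)] assms(3,4) c0(2) mu_derivative_q0 unfolding q0_def by simp

lemma mder_inv_one: "mder c0 c0 (\<lambda>y. \<iota> y) \<epsilon> (\<lambda>v. - v)"
proof -
  obtain S where S: "mder c0 c0 (\<lambda>y. \<iota> y) \<epsilon> S"
    using mder_inv[OF c0(1) c0(1) c0(2)] c0 by auto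
  have "mder c0 c0 (\<lambda>y. y \<cdot> \<iota> y) \<epsilon> (\<lambda>v. v + S v)"
    by (rule mder_mult_one[OF mder_id[OF c0] S]) auto
  moreover have "mder c0 c0 (\<lambda>y. y \<cdot> \<iota> y) \<epsilon> (\<lambda>v. 0)"
    using mder_const[OF c0(1) c0(1) c0(2) c0(2)] by simp
  ultimately have "(\<lambda>v. v + S v) = (\<lambda>v. 0)" by (rule mder_unique)
  then have "S = (\<lambda>v. - v)" by (metis (no_types, lifting) add_eq_0_iff)
  then show ?thesis using S by simp
qed

text \<open>The commutator is \<open>y\<close> times the conjugate of its inverse by
  \<open>b\<close>; at the identity a product differentiates to a sum and inversion to a
  sign.\<close>

lemma comm_mder: "mder c0 c0 (comm b) \<epsilon> (\<lambda>v. v - Ad b v)"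
proof -
  have "mder c0 c0 (\<lambda>y. conj b (\<iota> y)) \<epsilon> (\<lambda>v. Ad b (- v))"
    by (rule mder_comp[OF mder_inv_one]) (use Ad_mder in simp)
  from mder_mult_one[OF mder_id[OF c0] this]
  have "mder c0 c0 (\<lambda>y. y \<cdot> conj b (\<iota> y)) \<epsilon> (\<lambda>v. v - Ad b v)"
    by (simp add: linear_neg[OF Ad_linear])
  then show ?thesis by (simp add: comm_def[abs_def] conj_def m_assoc)
qed

text \<open>An upper central series with the group acting by \<open>Ad\<close>. It mediates between
  \<open>lower_central\<close>, reached by commutators of group elements, and
  \<open>upper_central br\<close>.\<close>

primrec Ad_central :: "nat \<Rightarrow> (real^'n) set" where
  "Ad_central 0 = {0}"
| "Ad_central (Suc j) = {v. \<forall>b. v - Ad b v \<in> Ad_central j}"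

lemma Ad_central_subspace: "subspace (Ad_central j)"
proof (induction j)
  case (Suc j)
  have *: "u + v - Ad b (u + v) = (u - Ad b u) + (v - Ad b v)" "r *\<^sub>R v - Ad b (r *\<^sub>R v) = r *\<^sub>R (v - Ad b v)" for u v b r
    by (simp_all add: linear_add[OF Ad_linear] linear_cmul[OF Ad_linear] algebra_simps)
  show ?case
    unfolding subspace_def
    by (auto simp: * linear_0[OF Ad_linear] subspace_0[OF Suc] intro: subspace_add[OF Suc] subspace_scale[OF Suc]
        simp del: add_diff_eq)
qed simp

lemma fold_comm_lower_central:
  "y \<in> lower_central G j \<Longrightarrow> fold comm bs y \<in> lower_central G (j + length bs)"
proof (induction bs arbitrary: y j)
  case (Cons b bs)
  have "comm b y \<in> lower_central G (Suc j)"
    unfolding lower_central.simps comm_def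
    by (intro generate.incl UN_I[OF Cons.prems] UN_I[OF in_carrier[of b]]) simp
  from Cons.IH[OF this] show ?case by simp
qed simp

text \<open>Every commutator composed with \<open>f\<close> replaces the differential
  \<open>T\<close> by \<open>T - Ad b T\<close>. If all \<open>j\<close>-fold commutators of
  \<open>f\<close> are trivial, \<open>j\<close> such operations annihilate \<open>T\<close>. The
  case of interest is the identity map.\<close>

lemma derivative_in_Ad_central:
  assumes "mder c0 c0 f \<epsilon> T" "f \<epsilon> = \<epsilon>" "\<And>bs y. length bs = j \<Longrightarrow> fold comm bs (f y) = \<epsilon>"
  shows "T v \<in> Ad_central j"
  using assms
proof (induction j arbitrary: f T v)
  case 0
  have "f = (\<lambda>y. \<epsilon>)" using 0(3)[of "[]"] by auto
  then have "T = (\<lambda>v. 0)" using 0(1) mder_const[OF c0(1) c0(1) c0(2) c0(2)] mder_unique by blast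
  then show ?case by simp
next
  case (Suc j)
  have "T v - Ad b (T v) \<in> Ad_central j" for b
  proof (rule Suc.IH[of "\<lambda>y. comm b (f y)" "\<lambda>v. T v - Ad b (T v)"])
    show "mder c0 c0 (\<lambda>y. comm b (f y)) \<epsilon> (\<lambda>v. T v - Ad b (T v))"
      by (rule mder_comp[OF Suc.prems(1)]) (use comm_mder Suc.prems(2) in simp)
    show "comm b (f \<epsilon>) = \<epsilon>" using Suc.prems(2) by simp
    show "fold comm bs (comm b (f y)) = \<epsilon>" if "length bs = j" for bs y
      using Suc.prems(3)[of "b # bs" y] that by simp
  qed
  then show ?case by simp
qed

lemma Ad_central_UNIV:
  assumes "lower_central G k = {\<epsilon>}"
  shows "Ad_central k = UNIV"
proof -
  have "v \<in> Ad_central k" for v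
  proof (rule derivative_in_Ad_central[OF mder_id[OF c0]])
    show "fold comm bs y = \<epsilon>" if "length bs = k" for bs y
      using fold_comm_lower_central[of y 0 bs] that assms by simp
  qed simp
  then show ?thesis by blast
qed

text \<open>A subspace equals its double orthogonal complement, so the claim reduces to scalar
  functions that vanish identically.\<close>

lemma derivative_in_subspace:
  fixes \<phi> :: "real^'n \<Rightarrow> real^'n"
  assumes W: "subspace W" and D: "(\<phi> has_derivative D) (at p)" and U: "open U" "p \<in> U" "\<And>q. q \<in> U \<Longrightarrow> \<phi> q \<in> W"
  shows "D u \<in> W"
proof -
  have "z \<bullet> D u = 0" if z: "z \<in> orthogonal_comp W" for z
  proof -
    have "((\<lambda>q. z \<bullet> \<phi> q) has_derivative (\<lambda>u. z \<bullet> D u)) (at p)"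
      by (rule has_derivative_inner_right[OF D])
    moreover have "((\<lambda>q. z \<bullet> \<phi> q) has_derivative (\<lambda>u. 0)) (at p)"
      by (rule has_derivative_transform_open[OF U(1,2) _ has_derivative_const[of 0]])
        (use z U(3) in \<open>auto simp: orthogonal_comp_def orthogonal_def inner_commute\<close>)
    ultimately show ?thesis using has_derivative_unique by metis
  qed
  then have "D u \<in> orthogonal_comp (orthogonal_comp W)"
    by (auto simp: orthogonal_comp_def orthogonal_def)
  then show ?thesis using orthogonal_comp_self[OF W] by simp
qed

text \<open>The vectors \<open>Ad b v - v\<close> lie in a fixed subspace for all \<open>b\<close>;
  hence so do their derivatives at the identity, which are the brackets.\<close>

lemma Ad_central_subset: "Ad_central j \<subseteq> upper_central br j"
proof (induction j)
  case (Suc j)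
  show ?case
  proof
    fix v assume v: "v \<in> Ad_central (Suc j)"
    have "br u v \<in> Ad_central j" for u
    proof (rule derivative_in_subspace[where D = "\<lambda>u. br u v", OF Ad_central_subspace _ open_UNIV UNIV_I])
      show "((\<lambda>p. Ad (chart_inv c0 p) v - v) has_derivative (\<lambda>u. br u v)) (at q0)"
        using has_derivative_diff[OF Ad_has_derivative has_derivative_const] by simp
      show "Ad (chart_inv c0 p) v - v \<in> Ad_central j" for p
        using v subspace_neg[OF Ad_central_subspace] by (metis (mono_tags, lifting) Ad_central.simps(2) mem_Collect_eq minus_diff_eq)
    qed
    then show "v \<in> upper_central br (Suc j)" using Suc by auto
  qed
qed simp

lemma nilpotent_br:
  assumes "nilpotent_group G" shows "\<exists>k. upper_central br k = UNIV"
proof -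
  obtain k where "lower_central G k = {\<epsilon>}" using assms unfolding nilpotent_group_def by blast
  then show ?thesis using Ad_central_UNIV Ad_central_subset by blast
qed

section \<open>A zero bracket on a connected group forces commutativity\<close>

lemma br_zero_Ad:
  assumes "connected (UNIV :: 'a set)" and "\<And>u v. br u v = 0"
  shows "Ad a v = v"
proof -
  have "(\<lambda>x. Ad x v) constant_on UNIV"
  proof (rule locally_constant_imp_constant[OF assms(1)])
    fix x :: 'a
    obtain c where c: "c \<in> A" "x \<in> chart_dom c" using chart_exists by blast
    \<comment> \<open>Since \<open>Ad y = Ad z (Ad (z^-1 y))\<close>, the derivative at an arbitrary
      \<open>z\<close> is reduced to the one at the identity, which is the bracket.\<close>
    have "((\<lambda>p. Ad (chart_inv c p) v) has_derivative (\<lambda>a. 0)) (at p)" if p: "p \<in> chart_img c" for p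
    proof -
      define z where "z = chart_inv c p"
      have z: "z \<in> chart_dom c" "chart_map c z = p" unfolding z_def using p by auto
      obtain T where T: "mder c c0 (\<lambda>y. \<iota> z \<cdot> y) z T"
        using mder_left[OF c(1) c0(1) z(1), of "\<iota> z"] c0 by auto
      have "((\<lambda>p. Ad (chart_inv c0 p) v) has_derivative (\<lambda>u. 0)) (at (chart_map c0 (\<iota> z \<cdot> z)))"
        using Ad_has_derivative[of v] assms(2) by (simp add: q0_def)
      from mder_pull[OF T this]
      have "((\<lambda>p. Ad (\<iota> z \<cdot> chart_inv c p) v) has_derivative (\<lambda>u. 0)) (at p)"
        unfolding z(2) .
      from bounded_linear.has_derivative[OF linear_conv_bounded_linear[THEN iffD1, OF Ad_linear[of z]] this]
      have "((\<lambda>p. Ad z (Ad (\<iota> z \<cdot> chart_inv c p) v)) has_derivative (\<lambda>u. 0)) (at p)"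
        by (simp add: linear_0[OF Ad_linear])
      moreover have "Ad z (Ad (\<iota> z \<cdot> y) v) = Ad y v" for y
        using fun_cong[OF Ad_mult[of z "\<iota> z \<cdot> y"], of v] by simp
      ultimately show ?thesis by simp
    qed
    from chart_locally_constant[OF c chart_open(2)[OF c(1)] order_refl _ this] c
    show "\<exists>T. openin (top_of_set UNIV) T \<and> x \<in> T \<and> (\<forall>y\<in>T. Ad y v = Ad x v)" by auto
  qed
  then have "Ad a v = Ad \<epsilon> v" unfolding constant_on_def by auto
  then show ?thesis by (simp add: Ad_one)
qed

text \<open>With \<open>Ad\<close> trivial, the commutator map has differential zero at the
  identity, then everywhere by translation. Connectedness makes it constant with value the
  identity.\<close>

lemma br_nonzero:
  assumes conn: "connected (UNIV :: 'a set)" and "\<not> comm_group G"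
  shows "\<exists>u v. br u v \<noteq> 0"
proof (rule ccontr)
  assume "\<not> ?thesis"
  then have Ad: "Ad a v = v" for a v using br_zero_Ad[OF conn] by blast
  have "comm b y = \<epsilon>" for b y
  proof -
    have comm_D: "mder c c' (comm b) z (\<lambda>v. 0)"
      if c: "c \<in> A" "z \<in> chart_dom c" "c' \<in> A" "comm b z \<in> chart_dom c'" for c c' z
    proof -
      obtain T where T: "mder c c0 (\<lambda>y. \<iota> z \<cdot> y) z T"
        using mder_left[OF c(1) c0(1) c(2), of "\<iota> z"] c0 by auto
      \<comment> \<open>Chosen so that \<open>comm b y\<close> equals \<open>z\<close>, times
        \<open>comm b\<close> at \<open>z^-1 y\<close>, times \<open>r\<close>; this moves
        differentiation at \<open>z\<close> to the identity.\<close>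
      define r where "r = conj b (\<iota> z)"
      obtain c1 where c1: "c1 \<in> A" "z \<in> chart_dom c1" using chart_exists by blast
      obtain S1 where S1: "mder c0 c1 (\<lambda>y. z \<cdot> y) \<epsilon> S1"
        using mder_left[OF c0(1) c1(1) c0(2), of z] c1 by auto
      have zr: "z \<cdot> r = comm b z" unfolding r_def conj_def comm_def by (simp add: m_assoc)
      obtain S2 where S2: "mder c1 c' (\<lambda>y. y \<cdot> r) (z \<cdot> \<epsilon>) S2"
        using mder_right[OF c1(1) c(3), of z r] c1 c(4) zr by auto
      have "mder c0 c0 (comm b) (\<iota> z \<cdot> z) (\<lambda>v. 0)"
        using comm_mder[of b] Ad by simp
      from mder_comp[OF T this]
      have "mder c c0 (\<lambda>y. comm b (\<iota> z \<cdot> y)) z (\<lambda>v. 0)" .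
      from mder_comp[OF this, of c' "\<lambda>y. z \<cdot> y \<cdot> r"] mder_comp[OF S1 S2]
      have "mder c c' (\<lambda>y. z \<cdot> comm b (\<iota> z \<cdot> y) \<cdot> r) z (\<lambda>v. S2 (S1 0))" by simp
      moreover have "z \<cdot> comm b (\<iota> z \<cdot> y) \<cdot> r = comm b y" for y
        unfolding r_def conj_def comm_def by (simp add: m_assoc inv_mult_group)
      moreover have "S2 (S1 0) = 0"
        using linear_0[OF mder_linear[OF S1]] linear_0[OF mder_linear[OF S2]] by simp
      ultimately show ?thesis by simp
    qed
    have "comm b constant_on UNIV"
    proof (rule locally_constant_imp_constant[OF conn])
      fix x :: 'a
      obtain c where c: "c \<in> A" "x \<in> chart_dom c" using chart_exists by blast
      obtain c' where c': "c' \<in> A" "comm b x \<in> chart_dom c'" using chart_exists by blast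
      have cont: "continuous_on UNIV (comm b)" using comm_mder[of b] unfolding mder_def by blast
      let ?U = "{p \<in> chart_img c. comm b (chart_inv c p) \<in> chart_dom c'}"
      have "((\<lambda>p. chart_map c' (comm b (chart_inv c p))) has_derivative (\<lambda>a. 0)) (at p)" if "p \<in> ?U" for p
        using comm_D[of c "chart_inv c p" c'] that c c' unfolding mder_def by simp
      from chart_locally_constant[OF c chart_preimage_open[OF c(1) cont chart_open(1)[OF c'(1)]] _ _ this] c c'
      obtain T where T: "open T" "x \<in> T"
        "\<And>y. y \<in> T \<Longrightarrow> y \<in> chart_dom c \<and> chart_map c y \<in> ?U \<and> chart_map c' (comm b y) = chart_map c' (comm b x)"
        by auto
      have eq: "comm b y = comm b x" if "y \<in> T" for y
        using T(3)[OF that] c c' by (metis (mono_tags, lifting) chart_inv_map mem_Collect_eq)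
      show "\<exists>T. openin (top_of_set UNIV) T \<and> x \<in> T \<and> (\<forall>y\<in>T. comm b y = comm b x)"
        by (intro exI[of _ T] conjI ballI T(2) eq) (simp_all add: T(1))
    qed
    then have "comm b y = comm b \<epsilon>" unfolding constant_on_def by (metis UNIV_I)
    then show ?thesis by simp
  qed
  then have "y \<cdot> b = b \<cdot> y" for b y
  proof -
    have "comm b y \<cdot> (b \<cdot> y) = y \<cdot> b" unfolding comm_def by (simp add: m_assoc)
    then show ?thesis using \<open>\<And>b y. comm b y = \<epsilon>\<close> by simp
  qed
  then have "comm_group G" by (intro group_comm_groupI) auto
  then show False using assms(2) by blast
qed

section \<open>Tangent vectors under left translation and change of chart\<close>

lemma dleft_tvec:
  assumes "mder c c' (\<lambda>y. a \<cdot> y) x T"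
  shows "dleft G a (tvec c x v) = tvec c' (a \<cdot> x) (T v)"
proof -
  have c: "c \<in> A" "c' \<in> A" "x \<in> chart_dom c" "a \<cdot> x \<in> chart_dom c'" using assms unfolding mder_def by auto
  obtain S where "mder c' c (\<lambda>y. \<iota> a \<cdot> y) (a \<cdot> x) S"
    using mder_left[OF c(2,1,4), of "\<iota> a"] c by auto
  from tvec_push[OF assms this] show ?thesis unfolding dleft_def by simp
qed

text \<open>A change of chart is left translation by the identity, viewed in two charts.\<close>

lemma tvec_chart_change:
  assumes "c \<in> charts_at A x" "c' \<in> charts_at A x"
  shows "\<exists>T. \<forall>v. tvec c x v = tvec c' x (T v)"
proof -
  have c: "c \<in> A" "x \<in> chart_dom c" "c' \<in> A" "x \<in> chart_dom c'" using assms unfolding charts_at_def by auto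
  obtain T where T: "mder c c' (\<lambda>y. \<epsilon> \<cdot> y) x T"
    using mder_left[OF c(1,3,2), of "\<epsilon>"] c by auto
  from dleft_tvec[OF this] show ?thesis unfolding dleft_def by auto
qed

lemma tangent_space_range:
  assumes "c \<in> charts_at A x" shows "tangent_space A x = range (tvec c x)"
  unfolding tangent_space_def using tvec_chart_change[OF _ assms] assms by fastforce

lemma dleft_Ev:
  assumes "c \<in> charts_at A x"
  shows "dleft G x (tvec c0 \<epsilon> v) = tvec c x (Ev c (chart_map c x) v)"
  using dleft_tvec[OF Ev_mder[of c x]] assms unfolding charts_at_def by simp

end

section \<open>Flag curvature of left invariant metrics\<close>

locale left_invariant_structure = lie_group_chart G A c0
  for G :: "'a::{t2_space, second_countable_topology} monoid" and A :: "('a, 'n::finite) chart set" and c0 +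
  fixes g :: "'a \<Rightarrow> 'a tangent \<Rightarrow> 'a tangent \<Rightarrow> real" and X :: "'a \<Rightarrow> 'a tangent"
  assumes metric: "left_invariant_riemannian_metric G A g"
    and field: "left_invariant_field G A X"
    and conn: "connected (UNIV :: 'a set)"
    and noncomm: "\<not> comm_group G"
    and nilp: "nilpotent_group G"
begin

definition ip :: "real^'n \<Rightarrow> real^'n \<Rightarrow> real" where
  "ip u v = g \<epsilon> (tvec c0 \<epsilon> u) (tvec c0 \<epsilon> v)"

definition xi :: "real^'n" where "xi = coords c0 (X \<epsilon>)"

lemma c0_at: "c0 \<in> charts_at A \<epsilon>"
  using c0 unfolding charts_at_def by simp

lemma X_one: "X \<epsilon> = tvec c0 \<epsilon> xi"
proof -
  have "X \<epsilon> \<in> tangent_space A \<epsilon>"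
    using field unfolding left_invariant_field_def vector_field_def by blast
  then obtain v where "X \<epsilon> = tvec c0 \<epsilon> v" using tangent_space_range[OF c0_at] by auto
  then show ?thesis unfolding xi_def using c0 by simp
qed

lemma X_Ev:
  assumes "c \<in> charts_at A x" shows "X x = tvec c x (Ev c (chart_map c x) xi)"
proof -
  have "X (x \<cdot> \<epsilon>) = dleft G x (X \<epsilon>)"
    using field in_carrier unfolding left_invariant_field_def by blast
  then show ?thesis unfolding X_one dleft_Ev[OF assms] by simp
qed

lemma local_metric_eq:
  assumes "c \<in> A" "p \<in> chart_img c"
  shows "local_metric c g p v w = v \<bullet> (metric_matrix c g p *v w)"
proof -
  have "bilinear (local_metric c g p)"
    using metric assms unfolding left_invariant_riemannian_metric_def riemannian_metric_def by blast
  from bilinear_axis_expansion[OF this, of v w] show ?thesis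
    unfolding inner_vec_def matrix_vector_mult_def metric_matrix_def
    by (simp add: sum_distrib_left mult_ac)
qed

lemma local_metric_tensor_chart:
  assumes "c \<in> A" shows "local_metric_tensor (chart_img c) (metric_matrix c g)"
proof
  have R: "\<And>p v w. p \<in> chart_img c \<Longrightarrow> local_metric c g p v w = local_metric c g p w v"
    "\<And>p v. p \<in> chart_img c \<Longrightarrow> v \<noteq> 0 \<Longrightarrow> local_metric c g p v v > 0"
    "\<And>v w. smooth_on (chart_img c) (\<lambda>p. local_metric c g p v w)"
    using metric assms unfolding left_invariant_riemannian_metric_def riemannian_metric_def by blast+
  show "open (chart_img c)" by (rule chart_open(2)[OF assms])
  show "smooth_on (chart_img c) (\<lambda>q. metric_matrix c g q $ i $ j)" for i j
    unfolding metric_matrix_def by (simp add: R(3))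
  show "metric_matrix c g q $ i $ j = metric_matrix c g q $ j $ i" if "q \<in> chart_img c" for q i j
    unfolding metric_matrix_def by (simp add: R(1)[OF that])
  show "0 < v \<bullet> (metric_matrix c g q *v v)" if "q \<in> chart_img c" "v \<noteq> 0" for q v
    using R(2)[OF that] local_metric_eq[OF assms that(1)] by simp
qed

lemma g_dleft:
  "g x (dleft G x (tvec c0 \<epsilon> u)) (dleft G x (tvec c0 \<epsilon> v)) = ip u v"
proof -
  have "tvec c0 \<epsilon> w \<in> tangent_space A \<epsilon>" for w using tangent_space_range[OF c0_at] by simp
  then have "g (x \<cdot> \<epsilon>) (dleft G x (tvec c0 \<epsilon> u)) (dleft G x (tvec c0 \<epsilon> v)) = ip u v"
    using metric in_carrier unfolding left_invariant_riemannian_metric_def ip_def by blast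
  then show ?thesis by simp
qed

lemma chart_at_inv: "c \<in> A \<Longrightarrow> p \<in> chart_img c \<Longrightarrow> c \<in> charts_at A (chart_inv c p)"
  unfolding charts_at_def by simp

lemma local_frame_chart:
  assumes "c \<in> A" shows "local_frame (chart_img c) (metric_matrix c g) (Ev c) ip br"
proof -
  interpret local_metric_tensor "chart_img c" "metric_matrix c g" by (rule local_metric_tensor_chart[OF assms])
  show ?thesis
  proof (intro local_frame.intro local_frame_axioms.intro)
    show "local_metric_tensor (chart_img c) (metric_matrix c g)" by unfold_locales
    show "linear (Ev c q)" "bij (Ev c q)" if "q \<in> chart_img c" for q
      using Ev_linear[OF assms that] Ev_bij[OF assms that] by auto
    show "smooth_on (chart_img c) (\<lambda>q. Ev c q v)" for v by (rule Ev_smooth[OF assms])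
    show "frechet_derivative (\<lambda>q. Ev c q v) (at q) (Ev c q u)
        - frechet_derivative (\<lambda>q. Ev c q u) (at q) (Ev c q v) = Ev c q (br u v)"
      if "q \<in> chart_img c" for q u v by (rule Ev_bracket[OF assms that])
    show "m q (Ev c q u) (Ev c q v) = ip u v" if "q \<in> chart_img c" for q u v
      using g_dleft[of "chart_inv c q" u v] local_metric_eq[OF assms that, of "Ev c q u" "Ev c q v"] that
      unfolding m_def dleft_Ev[OF chart_at_inv[OF assms that]] local_metric_def by simp
  qed
qed

text \<open>The coefficients computed at the identity in \<open>c0\<close> serve in every chart,
  since \<open>ip\<close> and \<open>br\<close> do not change and determine them uniquely.\<close>

lemma connection_exists:
  "\<exists>nab. \<forall>c\<in>A. local_frame_connection (chart_img c) (metric_matrix c g) (Ev c) ip br nab"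
proof -
  interpret F0: local_frame "chart_img c0" "metric_matrix c0 g" "Ev c0" ip br
    by (rule local_frame_chart[OF c0(1)])
  let ?nab = "F0.nab_at q0"
  note nab = F0.metric_lie_algebra_nab_at[OF q0(1)]
  interpret L: metric_lie_algebra ip br ?nab by (rule nab)
  have "local_frame_connection (chart_img c) (metric_matrix c g) (Ev c) ip br ?nab" if "c \<in> A" for c
  proof -
    interpret F: local_frame "chart_img c" "metric_matrix c g" "Ev c" ip br
      by (rule local_frame_chart[OF that])
    show ?thesis
    proof
      show "Ev c q (?nab u v) = F.covd q u v" if "q \<in> chart_img c" for q u v
        using F.E_nab_at[OF that] metric_lie_algebra_unique[OF nab F.metric_lie_algebra_nab_at[OF that]] by metis
    qed
  qed
  then show ?thesis by blast
qed

lemma tspan_generators: "u \<in> tspan u v" "v \<in> tspan u v"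
  unfolding tspan_def
  by (rule CollectI, rule exI[of _ 1], rule exI[of _ 0], simp add: tcomb_def,
      rule CollectI, rule exI[of _ 0], rule exI[of _ 1], simp add: tcomb_def)

text \<open>Controls the vector that \<open>flag_curvature\<close> picks by \<open>SOME\<close>: it
  can only be a combination of the known spanning vectors, and \<open>a = 0\<close> would make
  \<open>U\<close> a multiple of \<open>Y\<close>.\<close>

lemma tspan_partner:
  assumes c: "c \<in> charts_at A x" and ind: "\<And>r. U \<noteq> r *\<^sub>R Y"
    and eq: "tspan (tvec c x U) (tvec c x Y) = tspan u (tvec c x Y)"
  shows "\<exists>a b. a \<noteq> 0 \<and> coords c u = a *\<^sub>R U + b *\<^sub>R Y"
proof -
  have c: "c \<in> A" "x \<in> chart_dom c" using c unfolding charts_at_def by auto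
  have "u \<in> tspan (tvec c x U) (tvec c x Y)" "tvec c x U \<in> tspan u (tvec c x Y)"
    using tspan_generators eq by metis+
  then obtain a b r s where ab: "u = tcomb a (tvec c x U) b (tvec c x Y)"
    and rs: "tvec c x U = tcomb r u s (tvec c x Y)" unfolding tspan_def by blast
  have u: "u = tvec c x (a *\<^sub>R U + b *\<^sub>R Y)" using ab tcomb_tvec by simp
  have "U = r *\<^sub>R (a *\<^sub>R U + b *\<^sub>R Y) + s *\<^sub>R Y"
    using arg_cong[OF rs, of "coords c"] c unfolding u tcomb_tvec by simp
  then have "a \<noteq> 0" using ind[of "r * b + s"] by (auto simp: scaleR_left_distrib)
  then show ?thesis using u c by auto
qed

definition all_signs :: "('a \<Rightarrow> 'a tangent \<Rightarrow> real) \<Rightarrow> ('a \<Rightarrow> 'a tangent set) \<Rightarrow> 'a \<Rightarrow> bool" where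
  "all_signs F D x \<longleftrightarrow>
    (\<exists>P y. is_flag A x P y \<and> y \<in> D x \<and> (\<forall>c\<in>charts_at A x. flag_curvature c F x P y > 0)) \<and>
     (\<exists>P y. is_flag A x P y \<and> y \<in> D x \<and> (\<forall>c\<in>charts_at A x. flag_curvature c F x P y < 0)) \<and>
     (\<exists>P y. is_flag A x P y \<and> y \<in> D x \<and> (\<forall>c\<in>charts_at A x. flag_curvature c F x P y = 0))"

text \<open>Assumption \<open>VD\<close> unifies the two metrics: vectors in the cone of
  \<open>xi\<close>, or all nonzero ones when \<open>xi = 0\<close>, are admissible.
  \<open>sect_signs\<close> delivers its planes with flagpoles of exactly this kind.\<close>

theorem flag_signs:
  assumes ab: "\<And>c. c \<in> A \<Longrightarrow> local_alpha_beta (chart_img c) (metric_matrix c g) (Ev c) ip br nab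
      (local_finsler c F) xi V L L1 L2 L11 L12 L22"
    and VD: "\<And>x v. v \<noteq> 0 \<Longrightarrow> (xi \<noteq> 0 \<Longrightarrow> ip xi v > 0) \<Longrightarrow>
      (ip v v, ip xi v) \<in> V \<and> dleft G x (tvec c0 \<epsilon> v) \<in> D x"
  shows "all_signs F D x"
proof -
  interpret AB0: local_alpha_beta "chart_img c0" "metric_matrix c0 g" "Ev c0" ip br nab
      "local_finsler c0 F" xi V L L1 L2 L11 L12 L22
    by (rule ab[OF c0(1)])
  interpret N: nilpotent_metric_lie_algebra ip br nab
    by unfold_locales (use nilpotent_br[OF nilp] br_nonzero[OF conn noncomm] in auto)
  have fibre: "Ev c q v \<in> local_alpha_beta_base.fibre (metric_matrix c g) (Ev c) xi V q"
    if c: "c \<in> A" and q: "q \<in> chart_img c" and v: "(ip v v, ip xi v) \<in> V" for c q v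
  proof -
    interpret AB: local_alpha_beta "chart_img c" "metric_matrix c g" "Ev c" ip br nab
        "local_finsler c F" xi V L L1 L2 L11 L12 L22
      by (rule ab[OF c])
    show ?thesis using v unfolding AB.fibre_def AB.AB_def AB.B_def by (simp add: AB.E_metric[OF q])
  qed
  obtain v0 where v0: "v0 \<noteq> 0" "xi \<noteq> 0 \<Longrightarrow> ip xi v0 > 0"
  proof (cases "xi = 0")
    case True
    \<comment> \<open>Only used as a supply of a nonzero vector.\<close>
    obtain u v where "br u v \<noteq> 0" using N.nonabelian by blast
    then show thesis using True that by blast
  next
    case False
    then show thesis using that[of xi] AB0.ip_pos by blast
  qed
  have par: "nab u xi = 0" for u
    by (rule AB0.field_parallel[OF q0(1) fibre[OF c0(1) q0(1), of v0]]) (use VD v0 in blast)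
  have flag: "\<exists>P y. is_flag A x P y \<and> y \<in> D x \<and> (\<forall>c\<in>charts_at A x. sgn (flag_curvature c F x P y) = sgn (AB0.sect u v))"
    if uv: "AB0.indep2 u v" and pos: "xi \<noteq> 0 \<longrightarrow> ip xi v > 0" for u v
  proof -
    define U where "U = dleft G x (tvec c0 \<epsilon> u)"
    define Y where "Y = dleft G x (tvec c0 \<epsilon> v)"
    have v: "v \<noteq> 0" using uv AB0.indep2_sym AB0.indep2_iff by blast
    have V: "(ip v v, ip xi v) \<in> V" and Y: "Y \<in> D x" using VD[OF v, of x] pos unfolding Y_def by auto
    have UY: "U = tvec c x (Ev c (chart_map c x) u)" "Y = tvec c x (Ev c (chart_map c x) v)"
      if "c \<in> charts_at A x" for c unfolding U_def Y_def by (simp_all add: dleft_Ev[OF that])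
    obtain c where c: "c \<in> A" "x \<in> chart_dom c" using chart_exists by blast
    then have cx: "c \<in> charts_at A x" by (simp add: charts_at_def)
    have E_inj: "Ev c (chart_map c x) w = 0 \<Longrightarrow> w = 0" if "c \<in> A" "x \<in> chart_dom c" for c w
      using Ev_bij[OF that(1), of "chart_map c x"] linear_0[OF Ev_linear[OF that(1), of "chart_map c x"]] that
      by (metis bij_is_inj chart_map_in_img injD)
    have E_comb: "a *\<^sub>R Ev c (chart_map c x) u + b *\<^sub>R Ev c (chart_map c x) v = Ev c (chart_map c x) (a *\<^sub>R u + b *\<^sub>R v)"
      if "c \<in> A" "x \<in> chart_dom c" for a b c
      using Ev_linear[OF that(1), of "chart_map c x"] that by (simp add: linear_add linear_cmul)
    have tzero: "a = 0 \<and> b = 0" if "tcomb a U b Y = tzero" for a b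
    proof -
      have "tvec c x (Ev c (chart_map c x) (a *\<^sub>R u + b *\<^sub>R v)) = tvec c x 0"
        using that unfolding UY[OF cx] tcomb_tvec E_comb[OF c] tvec_zero .
      then have "Ev c (chart_map c x) (a *\<^sub>R u + b *\<^sub>R v) = 0" using c by (metis coords_tvec)
      then show ?thesis using E_inj[OF c] uv unfolding AB0.indep2_def by blast
    qed
    have "is_flag A x (tspan U Y) Y"
    proof -
      have "U \<in> tangent_space A x" "Y \<in> tangent_space A x"
        unfolding UY[OF cx] tangent_space_range[OF cx] by auto
      moreover have "tindependent U Y" unfolding tindependent_def using tzero by blast
      moreover have "Y \<in> tspan U Y" by (rule tspan_generators(2))
      moreover have "Y \<noteq> tzero" using tzero[of 0 1] by (auto simp: tcomb_def tzero_def)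
      ultimately show ?thesis unfolding is_flag_def by blast
    qed
    moreover have "sgn (flag_curvature c F x (tspan U Y) Y) = sgn (AB0.sect u v)" if cx: "c \<in> charts_at A x" for c
    proof -
      have c: "c \<in> A" "x \<in> chart_dom c" using cx unfolding charts_at_def by auto
      let ?q = "chart_map c x"
      interpret AB: local_alpha_beta "chart_img c" "metric_matrix c g" "Ev c" ip br nab
          "local_finsler c F" xi V L L1 L2 L11 L12 L22
        by (rule ab[OF c(1)])
      \<comment> \<open>The choice in \<open>flag_curvature\<close> is legitimate because
        \<open>U\<close> itself is a candidate.\<close>
      have "tspan U Y = tspan (SOME u. tspan U Y = tspan u Y) Y" by (rule someI[of _ U]) simp
      moreover have "Ev c ?q u \<noteq> r *\<^sub>R Ev c ?q v" for r
      proof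
        assume "Ev c ?q u = r *\<^sub>R Ev c ?q v"
        then have "Ev c ?q (1 *\<^sub>R u + (- r) *\<^sub>R v) = 0" using E_comb[OF c, of 1 "- r"] by simp
        then show False using E_inj[OF c] uv unfolding AB0.indep2_def by (metis zero_neq_one)
      qed
      ultimately obtain a b where ab: "a \<noteq> 0"
          "coords c (SOME u. tspan U Y = tspan u Y) = a *\<^sub>R Ev c ?q u + b *\<^sub>R Ev c ?q v"
        using tspan_partner[OF cx, of "Ev c ?q u" "Ev c ?q v"] unfolding UY[OF cx] by blast
      have "coords c Y = Ev c ?q v" unfolding UY[OF cx] using c by simp
      then show ?thesis
        using AB.flag_quotient_sgn[OF _ fibre[OF c(1) _ V] uv ab(1), of ?q b] c(2)
        unfolding flag_curvature_def Let_def ab(2) by simp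
    qed
    ultimately show ?thesis using Y by blast
  qed
  have "\<exists>P y. is_flag A x P y \<and> y \<in> D x \<and> (\<forall>c\<in>charts_at A x. sgn (flag_curvature c F x P y) = 1)"
    using N.sect_signs(1)[OF par] flag by (metis sgn_pos)
  moreover have "\<exists>P y. is_flag A x P y \<and> y \<in> D x \<and> (\<forall>c\<in>charts_at A x. sgn (flag_curvature c F x P y) = - 1)"
    using N.sect_signs(2)[OF par] flag by (metis sgn_neg)
  moreover have "\<exists>P y. is_flag A x P y \<and> y \<in> D x \<and> (\<forall>c\<in>charts_at A x. sgn (flag_curvature c F x P y) = 0)"
    using N.sect_signs(3)[OF par] flag by (metis sgn_0)
  ultimately show ?thesis
    unfolding all_signs_def by (simp only: sgn_1_pos sgn_1_neg sgn_0_0)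
qed

end

section \<open>Matsumoto and Kropina metrics\<close>

text \<open>The condition on the denominator is nonvanishing, not a sign: this is what
  \<open>matsumoto_denominator_nonzero\<close> supplies.\<close>

definition matsumoto_domain :: "(real \<times> real) set" where
  "matsumoto_domain = {x. fst x > 0 \<and> sqrt (fst x) \<noteq> snd x}"

lemma matsumoto_domain_open: "open matsumoto_domain"
  unfolding matsumoto_domain_def
  by (intro open_Collect_conj open_Collect_less open_Collect_neq continuous_intros)

text \<open>With \<open>s = sqrt a\<close> and \<open>r = 1/(s - b)\<close>, the function \<open>L(a, b) = a\<^sup>2/(s - b)\<^sup>2\<close> and its partial
  derivatives are polynomials in \<open>s, r, b\<close>, and all identities follow from \<open>r (s - b) = 1\<close>.\<close>

definition mat_s :: "real \<times> real \<Rightarrow> real" where "mat_s x = sqrt (fst x)"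

definition mat_r :: "real \<times> real \<Rightarrow> real" where "mat_r x = 1 / (sqrt (fst x) - snd x)"

definition mat_i :: "real \<times> real \<Rightarrow> real" where "mat_i x = 1 / (2 * sqrt (fst x))"

lemma matsumoto_relations:
  "x \<in> matsumoto_domain \<Longrightarrow> 2 * mat_i x * mat_s x = 1" "x \<in> matsumoto_domain \<Longrightarrow> mat_r x * (mat_s x - snd x) = 1"
  "x \<in> matsumoto_domain \<Longrightarrow> fst x = mat_s x * mat_s x"
  unfolding matsumoto_domain_def mat_s_def mat_r_def mat_i_def by auto

lemma matsumoto_s_D: "x \<in> matsumoto_domain \<Longrightarrow> (mat_s has_derivative (\<lambda>h. mat_i x * fst h)) (at x)"
  unfolding matsumoto_domain_def mat_s_def mat_i_def by (auto intro!: derivative_eq_intros simp: divide_simps)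

lemma matsumoto_r_D:
  assumes "x \<in> matsumoto_domain"
  shows "(mat_r has_derivative (\<lambda>h. - (mat_r x * mat_r x) * (mat_i x * fst h - snd h))) (at x)"
proof -
  have r: "mat_r = (\<lambda>x. inverse (mat_s x - snd x))" unfolding mat_r_def mat_s_def by (simp add: divide_inverse)
  have "mat_s x - snd x \<noteq> 0" using assms unfolding matsumoto_domain_def mat_s_def by simp
  then show ?thesis unfolding r
    by (auto intro!: derivative_eq_intros matsumoto_s_D[OF assms] simp: fun_eq_iff algebra_simps)
qed

definition mat_L :: "real \<times> real \<Rightarrow> real" where
  "mat_L x = mat_s x ^ 4 * mat_r x ^ 2"

definition mat_L1 :: "real \<times> real \<Rightarrow> real" where
  "mat_L1 x = mat_s x ^ 2 * (mat_s x - 2 * snd x) * mat_r x ^ 3"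

definition mat_L2 :: "real \<times> real \<Rightarrow> real" where
  "mat_L2 x = 2 * mat_s x ^ 4 * mat_r x ^ 3"

definition mat_L11 :: "real \<times> real \<Rightarrow> real" where
  "mat_L11 x = - (1/2) * snd x * (mat_s x - 4 * snd x) * mat_r x ^ 4"

definition mat_L12 :: "real \<times> real \<Rightarrow> real" where
  "mat_L12 x = mat_s x ^ 2 * (mat_s x - 4 * snd x) * mat_r x ^ 4"

definition mat_L22 :: "real \<times> real \<Rightarrow> real" where
  "mat_L22 x = 6 * mat_s x ^ 4 * mat_r x ^ 4"

lemmas mat_defs = mat_L_def mat_L1_def mat_L2_def mat_L11_def mat_L12_def mat_L22_def

lemma matsumoto_Ds:
  assumes "x \<in> matsumoto_domain"
  shows "(mat_L has_derivative (\<lambda>h. mat_L1 x * fst h + mat_L2 x * snd h)) (at x)" (is ?A)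
    and "(mat_L1 has_derivative (\<lambda>h. mat_L11 x * fst h + mat_L12 x * snd h)) (at x)" (is ?B)
    and "(mat_L2 has_derivative (\<lambda>h. mat_L12 x * fst h + mat_L22 x * snd h)) (at x)" (is ?C)
proof -
  note D = matsumoto_s_D[OF assms] matsumoto_r_D[OF assms]
  note rel = matsumoto_relations(1,2)[OF assms]
  \<comment> \<open>The power rule leaves exponents of the form \<open>n - 1\<close>; they must be
    evaluated before the \<open>algebra\<close> method sees polynomials.\<close>
  have n: "4 - 1 = (3::nat)" "3 - 1 = (2::nat)" "2 - 1 = (1::nat)" by simp_all
  show ?A ?B ?C unfolding mat_defs[abs_def]
    by (rule has_derivative_eq_rhs, (rule derivative_intros D)+, rule ext,
        simp only: n of_nat_numeral, use rel in algebra)+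
qed

lemma matsumoto_differentiable:
  assumes "x \<in> matsumoto_domain"
  shows "mat_L11 differentiable (at x)" (is ?A)
    and "mat_L12 differentiable (at x)" (is ?B)
    and "mat_L22 differentiable (at x)" (is ?C)
proof -
  have D: "mat_s differentiable (at x)" "mat_r differentiable (at x)" "snd differentiable (at x)"
    using matsumoto_s_D[OF assms] matsumoto_r_D[OF assms]
      bounded_linear_imp_has_derivative[OF bounded_linear_snd, of "at x"] unfolding differentiable_def by blast+
  show ?A ?B ?C unfolding mat_defs[abs_def] by (simp_all add: D)
qed

lemma matsumoto_homogeneous:
  assumes "x \<in> matsumoto_domain"
  shows "2 * fst x * mat_L1 x + snd x * mat_L2 x = 2 * mat_L x" (is ?A)
    "2 * fst x * mat_L11 x + snd x * mat_L12 x = 0" (is ?B)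
    "2 * fst x * mat_L12 x + snd x * mat_L22 x = mat_L2 x" (is ?C)
    "mat_L2 x \<noteq> 0" (is ?D)
proof -
  note rel = matsumoto_relations[OF assms]
  show ?A ?B ?C unfolding mat_defs using rel by algebra+
  show ?D unfolding mat_defs using rel by auto
qed

lemma matsumoto_square:
  "x \<in> matsumoto_domain \<Longrightarrow> (fst x / (sqrt (fst x) - snd x))\<^sup>2 = mat_L x"
  unfolding mat_L_def mat_s_def mat_r_def matsumoto_domain_def
  by (simp add: power_divide power4_eq_xxxx power2_eq_square)

section \<open>The function \<open>L\<close> of a Kropina metric\<close>

definition kropina_domain :: "(real \<times> real) set" where
  "kropina_domain = {x. fst x > 0 \<and> snd x > 0}"

lemma kropina_domain_open: "open kropina_domain"
  unfolding kropina_domain_def by (intro open_Collect_conj open_Collect_less continuous_intros)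

definition kro_r :: "real \<times> real \<Rightarrow> real" where "kro_r x = 1 / snd x"

lemma kropina_relation: "x \<in> kropina_domain \<Longrightarrow> kro_r x * snd x = 1"
  unfolding kropina_domain_def kro_r_def by auto

lemma kropina_r_D:
  assumes "x \<in> kropina_domain"
  shows "(kro_r has_derivative (\<lambda>h. - (kro_r x * kro_r x) * snd h)) (at x)"
proof -
  have r: "kro_r = (\<lambda>x. inverse (snd x))" unfolding kro_r_def by (simp add: divide_inverse)
  have "snd x \<noteq> 0" using assms unfolding kropina_domain_def by simp
  then show ?thesis unfolding r by (auto intro!: derivative_eq_intros simp: fun_eq_iff algebra_simps)
qed

definition kro_L :: "real \<times> real \<Rightarrow> real" where
  "kro_L x = fst x ^ 2 * kro_r x ^ 2"

definition kro_L1 :: "real \<times> real \<Rightarrow> real" where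
  "kro_L1 x = 2 * fst x * kro_r x ^ 2"

definition kro_L2 :: "real \<times> real \<Rightarrow> real" where
  "kro_L2 x = - 2 * fst x ^ 2 * kro_r x ^ 3"

definition kro_L11 :: "real \<times> real \<Rightarrow> real" where
  "kro_L11 x = 2 * kro_r x ^ 2"

definition kro_L12 :: "real \<times> real \<Rightarrow> real" where
  "kro_L12 x = - 4 * fst x * kro_r x ^ 3"

definition kro_L22 :: "real \<times> real \<Rightarrow> real" where
  "kro_L22 x = 6 * fst x ^ 2 * kro_r x ^ 4"

lemmas kro_defs = kro_L_def kro_L1_def kro_L2_def kro_L11_def kro_L12_def kro_L22_def

lemma kropina_Ds:
  assumes "x \<in> kropina_domain"
  shows "(kro_L has_derivative (\<lambda>h. kro_L1 x * fst h + kro_L2 x * snd h)) (at x)" (is ?A)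
    and "(kro_L1 has_derivative (\<lambda>h. kro_L11 x * fst h + kro_L12 x * snd h)) (at x)" (is ?B)
    and "(kro_L2 has_derivative (\<lambda>h. kro_L12 x * fst h + kro_L22 x * snd h)) (at x)" (is ?C)
proof -
  have n: "3 - 1 = (2::nat)" "2 - 1 = (1::nat)" by simp_all
  show ?A ?B ?C unfolding kro_defs[abs_def]
    by (rule has_derivative_eq_rhs, (rule derivative_intros kropina_r_D[OF assms])+, rule ext,
        simp only: n of_nat_numeral, algebra)+
qed

lemma kropina_differentiable:
  assumes "x \<in> kropina_domain"
  shows "kro_L11 differentiable (at x)" (is ?A)
    and "kro_L12 differentiable (at x)" (is ?B)
    and "kro_L22 differentiable (at x)" (is ?C)
proof -
  have D: "kro_r differentiable (at x)" "fst differentiable (at x)"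
    using kropina_r_D[OF assms] bounded_linear_imp_has_derivative[OF bounded_linear_fst, of "at x"]
    unfolding differentiable_def by blast+
  show ?A ?B ?C unfolding kro_defs[abs_def] by (simp_all add: D)
qed

lemma kropina_homogeneous:
  assumes "x \<in> kropina_domain"
  shows "2 * fst x * kro_L1 x + snd x * kro_L2 x = 2 * kro_L x" (is ?A)
    "2 * fst x * kro_L11 x + snd x * kro_L12 x = 0" (is ?B)
    "2 * fst x * kro_L12 x + snd x * kro_L22 x = kro_L2 x" (is ?C)
    "kro_L2 x \<noteq> 0" (is ?D)
proof -
  note rel = kropina_relation[OF assms]
  show ?A ?B ?C unfolding kro_defs using rel by algebra+
  show ?D unfolding kro_defs using rel assms unfolding kropina_domain_def by auto
qed

context local_frame_connection
begin

lemma matsumoto_base: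
  assumes "\<And>q w. q \<in> S \<Longrightarrow> f q w = m q w w / (sqrt (m q w w) - m q (E q \<xi>) w)"
  shows "local_alpha_beta_base S M E ip br nab f \<xi> matsumoto_domain
    mat_L mat_L1 mat_L2 mat_L11 mat_L12 mat_L22"
proof (intro local_alpha_beta_base.intro local_alpha_beta_base_axioms.intro)
  show "local_frame_connection S M E ip br nab" by unfold_locales
  show "(f q w)\<^sup>2 = mat_L (m q w w, m q (E q \<xi>) w)"
    if "q \<in> S" "(m q w w, m q (E q \<xi>) w) \<in> matsumoto_domain" for q w
    using matsumoto_square[OF that(2)] unfolding assms[OF that(1)] by simp
qed (fact matsumoto_domain_open matsumoto_Ds matsumoto_differentiable matsumoto_homogeneous)+

lemma kropina_base:
  assumes "\<And>q w. q \<in> S \<Longrightarrow> f q w = m q w w / m q (E q \<xi>) w"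
  shows "local_alpha_beta_base S M E ip br nab f \<xi> kropina_domain
    kro_L kro_L1 kro_L2
    kro_L11 kro_L12 kro_L22"
proof (intro local_alpha_beta_base.intro local_alpha_beta_base_axioms.intro)
  show "local_frame_connection S M E ip br nab" by unfold_locales
  show "(f q w)\<^sup>2 = kro_L (m q w w, m q (E q \<xi>) w)"
    if "q \<in> S" for q w unfolding assms[OF that] kro_L_def kro_r_def by (simp add: power_divide)
qed (fact kropina_domain_open kropina_Ds kropina_differentiable kropina_homogeneous)+

end

text \<open>With \<open>a = g(y,u)\<close>, \<open>\<rho> = (g(y,y)/\<beta>(y)) \<beta>(u)\<close> the Kropina fundamental tensor is, up to a positive
  factor, \<open>(2a - \<rho>)\<^sup>2 + 2(\<rho> - a)\<^sup>2 + 2(g(y,y) g(u,u) - a\<^sup>2)\<close>.\<close>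

lemma kropina_form_pos:
  fixes A B C a b r :: real
  assumes "A > 0" "C > 0" "r > 0" "a\<^sup>2 \<le> A * C"
  shows "2 * A * r^2 * C + 2 * (2 * r^2) * (a * a) + (- 4 * A * r^3) * (b * a + a * b)
    + 1/2 * (6 * A^2 * r^4) * (b * b) > 0"
proof -
  define \<rho> where "\<rho> = A * r * b"
  have "2 * A * r^2 * C + 2 * (2 * r^2) * (a * a) + (- 4 * A * r^3) * (b * a + a * b)
      + 1/2 * (6 * A^2 * r^4) * (b * b) = r^2 * ((2 * a - \<rho>)^2 + 2 * (\<rho> - a)^2 + 2 * (A * C - a^2))"
    unfolding \<rho>_def by algebra
  moreover have "(2 * a - \<rho>)^2 + 2 * (\<rho> - a)^2 + 2 * (A * C - a^2) > 0"
  proof (rule ccontr)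
    have *: "x = 0 \<and> y = 0 \<and> z = 0" if "\<not> x + 2 * y + 2 * z > 0" "x \<ge> 0" "y \<ge> 0" "z \<ge> 0" for x y z :: real
      using that by auto
    assume "\<not> ?thesis"
    from *[OF this] have "(2 * a - \<rho>)^2 = 0" "(\<rho> - a)^2 = 0" "A * C - a^2 = 0"
      using assms(4) by auto
    \<comment> \<open>The first two squares give \<open>2a = \<rho>\<close> and
      \<open>\<rho> = a\<close>.\<close>
    then have "a = 0" by simp
    then show False using \<open>A * C - a^2 = 0\<close> assms(1,2) by simp
  qed
  ultimately show ?thesis using assms(3) by simp
qed

text \<open>A zero denominator does not contradict the formula by itself, since division by zero
  gives the value 0. But then continuity makes both \<open>f\<close> and the denominator small near
  \<open>w\<close> while \<open>A\<close> stays away from 0; as \<open>A\<close> is their product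
  wherever the denominator is nonzero, it must vanish throughout a neighbourhood. So
  \<open>f\<close> is 0 there, and the fundamental tensor cannot be positive definite.\<close>

lemma matsumoto_denominator_nonzero:
  fixes A B :: "real^'n \<Rightarrow> real" and f :: "real^'n \<Rightarrow> real^'n \<Rightarrow> real"
  assumes cont: "continuous_on UNIV A" "continuous_on UNIV B" "continuous_on (UNIV - {0}) (f q)"
    and f: "\<And>z. f q z = A z / (sqrt (A z) - B z)"
    and w: "w \<noteq> 0" "A w > 0"
    and pos: "w \<bullet> (fundamental_matrix f q w *v w) > 0"
  shows "sqrt (A w) \<noteq> B w"
proof
  assume eq: "sqrt (A w) = B w"
  define h where "h z = sqrt (A z) - B z" for z
  have tA: "(A \<longlongrightarrow> A w) (nhds w)"
    using cont(1) by (metis continuous_on_eq_continuous_at open_UNIV UNIV_I isCont_def tendsto_at_iff_tendsto_nhds)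
  have tB: "(B \<longlongrightarrow> B w) (nhds w)"
    using cont(2) by (metis continuous_on_eq_continuous_at open_UNIV UNIV_I isCont_def tendsto_at_iff_tendsto_nhds)
  have tf: "(f q \<longlongrightarrow> f q w) (nhds w)"
  proof -
    have "isCont (f q) w"
      using cont(3) w(1) continuous_on_eq_continuous_at[of "UNIV - {0}" "f q"] open_delete[OF open_UNIV] by blast
    then show ?thesis unfolding isCont_def tendsto_at_iff_tendsto_nhds .
  qed
  have "(h \<longlongrightarrow> sqrt (A w) - B w) (nhds w)"
    unfolding h_def by (intro tendsto_intros tA tB)
  then have th: "(h \<longlongrightarrow> 0) (nhds w)" using eq by simp
  have fw: "f q w = 0" using f eq by simp
  have "eventually (\<lambda>z. \<bar>h z\<bar> < A w / 2) (nhds w)"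
    using tendstoD[OF th, of "A w / 2"] w(2) by (simp add: dist_real_def)
  moreover have "eventually (\<lambda>z. \<bar>f q z\<bar> < 1) (nhds w)"
    using tendstoD[OF tf, of 1] fw by (simp add: dist_real_def)
  moreover have "eventually (\<lambda>z. A z > A w / 2) (nhds w)"
    using order_tendstoD(1)[OF tA, of "A w / 2"] w(2) by simp
  ultimately have "eventually (\<lambda>z. f q z = 0) (nhds w)"
  proof eventually_elim
    case (elim z)
    show ?case
    proof (cases "h z = 0")
      case True
      then show ?thesis using f[of z] unfolding h_def by simp
    next
      case False
      have "A z = f q z * h z" using f[of z] False unfolding h_def by simp
      then have "\<bar>A z\<bar> = \<bar>f q z\<bar> * \<bar>h z\<bar>" by (simp add: abs_mult)
      also have "\<dots> \<le> 1 * \<bar>h z\<bar>" using elim by (intro mult_right_mono) auto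
      finally show ?thesis using elim by linarith
    qed
  qed
  then obtain N where N: "open N" "w \<in> N" "\<And>z. z \<in> N \<Longrightarrow> f q z = 0"
    unfolding eventually_nhds by blast
  have D: "((\<lambda>z. (f q z)\<^sup>2) has_derivative (\<lambda>a. 0)) (at z)" if "z \<in> N" for z
    by (rule has_derivative_transform_open[OF N(1) that _ has_derivative_const[of 0]]) (simp add: N(3))
  have "fundamental_tensor f q w u v = 0" for u v
  proof -
    have "eventually (\<lambda>s. deriv (\<lambda>t. (f q (w + s *\<^sub>R u + t *\<^sub>R v))\<^sup>2) 0 = 0) (nhds 0)"
      by (rule eventually_mono[OF eventually_line_in_open[OF N(1,2), of u]]) (rule deriv_line[OF D])
    then have "deriv (\<lambda>s. deriv (\<lambda>t. (f q (w + s *\<^sub>R u + t *\<^sub>R v))\<^sup>2) 0) 0 = deriv (\<lambda>s. 0) 0"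
      by (rule deriv_cong_ev) simp
    then show ?thesis unfolding fundamental_tensor_def by simp
  qed
  then have "fundamental_matrix f q w *v w = 0"
    unfolding fundamental_matrix_def by (simp add: vec_eq_iff matrix_vector_mult_def)
  then show False using pos by simp
qed

section \<open>Verification of the hypotheses of \<open>flag_signs\<close> for the two
  metrics\<close>

context left_invariant_structure
begin

lemma metric_values:
  assumes "c \<in> A" "q \<in> chart_img c"
  shows "g (chart_inv c q) (tvec c (chart_inv c q) v) (tvec c (chart_inv c q) w) = v \<bullet> (metric_matrix c g q *v w)"
    "g (chart_inv c q) (X (chart_inv c q)) (tvec c (chart_inv c q) w) = Ev c q xi \<bullet> (metric_matrix c g q *v w)"
  unfolding X_Ev[OF chart_at_inv[OF assms]] local_metric_eq[OF assms, symmetric] local_metric_def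
  using assms by simp_all

lemma tvec_ne_tzero:
  assumes "c \<in> charts_at A x" "w \<noteq> 0" shows "tvec c x w \<noteq> tzero"
  using assms coords_tvec tvec_zero unfolding charts_at_def by (metis (no_types, lifting) mem_Collect_eq)

lemma dleft_mem:
  assumes "v \<noteq> 0"
  shows "dleft G x (tvec c0 \<epsilon> v) \<in> tangent_space A x" "dleft G x (tvec c0 \<epsilon> v) \<noteq> tzero"
proof -
  obtain c where c: "c \<in> A" "x \<in> chart_dom c" using chart_exists by blast
  then have cx: "c \<in> charts_at A x" by (simp add: charts_at_def)
  show "dleft G x (tvec c0 \<epsilon> v) \<in> tangent_space A x"
    unfolding dleft_Ev[OF cx] tangent_space_range[OF cx] by simp
  have "Ev c (chart_map c x) v \<noteq> 0"
    using Ev_bij[OF c(1), of "chart_map c x"] linear_0[OF Ev_linear[OF c(1), of "chart_map c x"]] c assms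
    by (metis bij_is_inj chart_map_in_img injD)
  then show "dleft G x (tvec c0 \<epsilon> v) \<noteq> tzero"
    unfolding dleft_Ev[OF cx] by (rule tvec_ne_tzero[OF cx])
qed

lemma chern_local:
  assumes "chern_eq_levi_civita A g F D" "c \<in> A" "q \<in> chart_img c" "tvec c (chart_inv c q) w \<in> D (chart_inv c q)"
  shows "chern_coeff (local_finsler c F) q w i j k = levi_civita_coeff c g q i j k"
proof -
  have "\<forall>i j k. chern_coeff (local_finsler c F) (chart_map c (chart_inv c q)) (coords c (tvec c (chart_inv c q) w)) i j k
      = levi_civita_coeff c g (chart_map c (chart_inv c q)) i j k"
    using assms chart_inv_in_dom[OF assms(3)] unfolding chern_eq_levi_civita_def by blast
  then show ?thesis using assms(2,3) by simp
qed

theorem matsumoto_flag_signs: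
  assumes F: "is_matsumoto_metric A g X F D" and ch: "chern_eq_levi_civita A g F D"
  shows "all_signs F D x"
proof -
  obtain nab where nab: "\<And>c. c \<in> A \<Longrightarrow> local_frame_connection (chart_img c) (metric_matrix c g) (Ev c) ip br nab"
    using connection_exists by blast
  have Fdef: "F = matsumoto g X" "finsler_metric A F" "D = (\<lambda>x. tangent_space A x - {tzero})"
    using F unfolding is_matsumoto_metric_def by auto
  have pd: "\<xi> \<bullet> (fundamental_matrix (local_finsler c F) q w *v \<xi>) > 0"
    if "c \<in> A" "q \<in> chart_img c" "w \<noteq> 0" "\<xi> \<noteq> 0" for c q w \<xi>
    using Fdef(2) that unfolding finsler_metric_def by blast
  have f: "local_finsler c F q w = w \<bullet> (metric_matrix c g q *v w) /
      (sqrt (w \<bullet> (metric_matrix c g q *v w)) - Ev c q xi \<bullet> (metric_matrix c g q *v w))"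
    if "c \<in> A" "q \<in> chart_img c" for c q w
    unfolding local_finsler_def Fdef(1) matsumoto_def metric_values[OF that] ..
  have ab: "local_alpha_beta (chart_img c) (metric_matrix c g) (Ev c) ip br nab (local_finsler c F) xi matsumoto_domain
    mat_L mat_L1 mat_L2 mat_L11 mat_L12 mat_L22"
    if c: "c \<in> A" for c
  proof -
    interpret C: local_frame_connection "chart_img c" "metric_matrix c g" "Ev c" ip br nab by (rule nab[OF c])
    interpret Ba: local_alpha_beta_base "chart_img c" "metric_matrix c g" "Ev c" ip br nab
        "local_finsler c F" xi matsumoto_domain mat_L mat_L1 mat_L2 mat_L11 mat_L12 mat_L22
      by (rule C.matsumoto_base) (simp add: C.m_def f[OF c])
    have nz: "w \<noteq> 0" if "w \<in> Ba.fibre q" for w q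
    proof -
      have "Ba.AB q w \<in> matsumoto_domain" using that unfolding Ba.fibre_def by simp
      then have "C.m q w w > 0" unfolding Ba.AB_def matsumoto_domain_def by simp
      then show ?thesis unfolding C.m_def by auto
    qed
    show ?thesis
    proof
      show "Ba.gt q w u u > 0" if "q \<in> chart_img c" "w \<in> Ba.fibre q" "u \<noteq> 0" for q w u
        using pd[OF c that(1) nz[OF that(2)] that(3)] Ba.fundamental_matrix_quadratic[OF that(1,2)] by simp
      show "chern_coeff (local_finsler c F) q w i j k = C.LC q i j k"
        if "q \<in> chart_img c" "w \<in> Ba.fibre q" for q w i j k
      proof -
        have at: "c \<in> charts_at A (chart_inv c q)" by (rule chart_at_inv[OF c that(1)])
        have "tvec c (chart_inv c q) w \<in> D (chart_inv c q)"
          unfolding Fdef(3) tangent_space_range[OF at] using tvec_ne_tzero[OF at nz[OF that(2)]] by simp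
        from chern_local[OF ch c that(1) this] show ?thesis
          unfolding levi_civita_coeff_def C.LC_def .
      qed
    qed
  qed
  show ?thesis
  proof (rule flag_signs[OF ab])
    fix x v assume v: "v \<noteq> (0 :: real^'n)"
    interpret C: local_frame_connection "chart_img c0" "metric_matrix c0 g" "Ev c0" ip br nab by (rule nab[OF c0(1)])
    have E: "C.m q0 u w = ip u w" for u w using C.E_metric[OF q0(1), of u w] unfolding Ev_q0 .
    \<comment> \<open>\<open>ip v v\<close> and \<open>ip xi v\<close> do not depend on the point,
      so the denominator only has to be examined at the identity.\<close>
    have "sqrt (v \<bullet> (metric_matrix c0 g q0 *v v)) \<noteq> Ev c0 q0 xi \<bullet> (metric_matrix c0 g q0 *v v)"
    proof (rule matsumoto_denominator_nonzero[where A = "\<lambda>v. v \<bullet> (metric_matrix c0 g q0 *v v)"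
          and B = "\<lambda>v. Ev c0 q0 xi \<bullet> (metric_matrix c0 g q0 *v v)", OF _ _ _ f[OF c0(1) q0(1)] v _ pd[OF c0(1) q0(1) v v]])
      have "continuous_on UNIV ((*v) (metric_matrix c0 g q0))"
        by (intro linear_continuous_on linear_conv_bounded_linear[THEN iffD1] matrix_vector_mul_linear)
      then show "continuous_on UNIV (\<lambda>v. v \<bullet> (metric_matrix c0 g q0 *v v))"
        "continuous_on UNIV (\<lambda>v. Ev c0 q0 xi \<bullet> (metric_matrix c0 g q0 *v v))"
        by (intro continuous_intros)+
      have "continuous_on (chart_img c0 \<times> (UNIV - {0})) (\<lambda>(p, y). local_finsler c0 F p y)"
        using Fdef(2) c0 smooth_on_continuous unfolding finsler_metric_def by blast
      from continuous_on_compose2[OF this, of "UNIV - {0}" "\<lambda>y. (q0, y)"]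
      show "continuous_on (UNIV - {0}) (local_finsler c0 F q0)"
        by (simp add: continuous_on_Pair continuous_on_const continuous_on_id image_subset_iff)
      show "v \<bullet> (metric_matrix c0 g q0 *v v) > 0" by (rule C.M_pos[OF q0(1) v])
    qed
    then have "sqrt (ip v v) \<noteq> ip xi v" unfolding C.m_def[symmetric] Ev_q0 E .
    moreover have "ip v v > 0" using C.ip_pos[OF v] .
    ultimately show "(ip v v, ip xi v) \<in> matsumoto_domain \<and> dleft G x (tvec c0 \<epsilon> v) \<in> D x"
      unfolding matsumoto_domain_def Fdef(3) using dleft_mem[OF v] by simp
  qed
qed

theorem kropina_flag_signs:
  assumes F: "is_kropina_metric A g X F D" and ch: "chern_eq_levi_civita A g F D"
  shows "all_signs F D x"
proof -
  obtain nab where nab: "\<And>c. c \<in> A \<Longrightarrow> local_frame_connection (chart_img c) (metric_matrix c g) (Ev c) ip br nab"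
    using connection_exists by blast
  have Fdef: "F = kropina g X" "X \<epsilon> \<noteq> tzero" "D = (\<lambda>x. {y \<in> tangent_space A x. g x (X x) y > 0})"
    using F unfolding is_kropina_metric_def by auto
  have xi: "xi \<noteq> 0" using Fdef(2) X_one tvec_zero by metis
  have f: "local_finsler c F q w = w \<bullet> (metric_matrix c g q *v w) / (Ev c q xi \<bullet> (metric_matrix c g q *v w))"
    if "c \<in> A" "q \<in> chart_img c" for c q w
    unfolding local_finsler_def Fdef(1) kropina_def metric_values[OF that] ..
  have ab: "local_alpha_beta (chart_img c) (metric_matrix c g) (Ev c) ip br nab (local_finsler c F) xi kropina_domain
    kro_L kro_L1 kro_L2
    kro_L11 kro_L12 kro_L22"
    if c: "c \<in> A" for c
  proof -
    interpret C: local_frame_connection "chart_img c" "metric_matrix c g" "Ev c" ip br nab by (rule nab[OF c])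
    interpret Ba: local_alpha_beta_base "chart_img c" "metric_matrix c g" "Ev c" ip br nab
        "local_finsler c F" xi kropina_domain kro_L kro_L1 kro_L2 kro_L11 kro_L12 kro_L22
      by (rule C.kropina_base) (simp add: C.m_def f[OF c])
    have pos: "C.m q w w > 0" "Ba.B q w > 0" if "w \<in> Ba.fibre q" for w q
    proof -
      have "Ba.AB q w \<in> kropina_domain" using that unfolding Ba.fibre_def by simp
      then show "C.m q w w > 0" "Ba.B q w > 0" unfolding Ba.AB_def kropina_domain_def by simp_all
    qed
    show ?thesis
    proof
      \<comment> \<open>In the Kropina case positive definiteness is not among the assumptions; it
        follows on the cone from Cauchy-Schwarz for the Riemannian metric.\<close>
      show "Ba.gt q w u u > 0" if q: "q \<in> chart_img c" and w: "w \<in> Ba.fibre q" and u: "u \<noteq> 0" for q w u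
      proof -
        interpret I: inner_space "C.m q" by (rule C.inner_space_m[OF q])
        have "kro_r (Ba.AB q w) > 0" unfolding kro_r_def Ba.AB_def using pos(2)[OF w] by simp
        from kropina_form_pos[OF pos(1)[OF w] I.ip_pos[OF u] this I.cauchy_schwarz[of w u], of "Ba.B q u"]
        show ?thesis unfolding Ba.gt_def kro_defs by (simp add: Ba.AB_def mult_ac)
      qed
      show "chern_coeff (local_finsler c F) q w i j k = C.LC q i j k"
        if "q \<in> chart_img c" "w \<in> Ba.fibre q" for q w i j k
      proof -
        have at: "c \<in> charts_at A (chart_inv c q)" by (rule chart_at_inv[OF c that(1)])
        have "tvec c (chart_inv c q) w \<in> D (chart_inv c q)"
          unfolding Fdef(3) tangent_space_range[OF at]
          using pos(2)[OF that(2)] unfolding Ba.B_def C.m_def by (simp add: metric_values[OF c that(1)])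
        from chern_local[OF ch c that(1) this] show ?thesis
          unfolding levi_civita_coeff_def C.LC_def .
      qed
    qed
  qed
  show ?thesis
  proof (rule flag_signs[OF ab])
    fix x v assume v: "v \<noteq> (0 :: real^'n)" "xi \<noteq> 0 \<Longrightarrow> ip xi v > 0"
    interpret C: local_frame_connection "chart_img c0" "metric_matrix c0 g" "Ev c0" ip br nab by (rule nab[OF c0(1)])
    obtain c where c: "c \<in> A" "x \<in> chart_dom c" using chart_exists by blast
    then have "c \<in> charts_at A x" by (simp add: charts_at_def)
    then have "X x = dleft G x (tvec c0 \<epsilon> xi)" using X_Ev dleft_Ev by simp
    then have "g x (X x) (dleft G x (tvec c0 \<epsilon> v)) = ip xi v" using g_dleft by simp
    then show "(ip v v, ip xi v) \<in> kropina_domain \<and> dleft G x (tvec c0 \<epsilon> v) \<in> D x"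
      unfolding kropina_domain_def Fdef(3) using dleft_mem(1)[OF v(1)] C.ip_pos[OF v(1)] v(2)[OF xi] by simp
  qed
qed

end

theorem theorem3p4:
  fixes G :: "'a::{t2_space, second_countable_topology} monoid"
    and A :: "('a, 'n::finite) chart set"
    and g :: "'a \<Rightarrow> 'a tangent \<Rightarrow> 'a tangent \<Rightarrow> real"
    and X :: "'a \<Rightarrow> 'a tangent"
    and F :: "'a \<Rightarrow> 'a tangent \<Rightarrow> real"
    and D :: "'a \<Rightarrow> 'a tangent set"
  assumes "lie_group G A"
    and "connected (UNIV :: 'a set)"
    and "\<not> comm_group G"
    and "nilpotent_group G"
    and "left_invariant_riemannian_metric G A g"
    and "left_invariant_field G A X"
    and "is_matsumoto_metric A g X F D \<or> is_kropina_metric A g X F D"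
    and "chern_eq_levi_civita A g F D"
  shows "\<forall>x\<in>carrier G.
     (\<exists>P y. is_flag A x P y \<and> y \<in> D x \<and> (\<forall>c\<in>charts_at A x. flag_curvature c F x P y > 0)) \<and>
     (\<exists>P y. is_flag A x P y \<and> y \<in> D x \<and> (\<forall>c\<in>charts_at A x. flag_curvature c F x P y < 0)) \<and>
     (\<exists>P y. is_flag A x P y \<and> y \<in> D x \<and> (\<forall>c\<in>charts_at A x. flag_curvature c F x P y = 0))"
proof -
  interpret lie_group G A by fact
  obtain c0 where c0: "c0 \<in> A" "\<one>\<^bsub>G\<^esub> \<in> chart_dom c0" using chart_exists by blast
  interpret left_invariant_structure G A c0 g X
    by unfold_locales (use assms c0 in auto)
  show ?thesis using assms(7,8) matsumoto_flag_signs kropina_flag_signs unfolding all_signs_def by blast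
qed

end
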